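(* Let $N\ge2$, let $0<s<\frac12$, let $P(\xi)=\xi_1^2-\xi_2^2\pm\xi_3^2\pm\cdots\pm\xi_N^2$ for $\xi\in\mathbb{R}^N$ (with any fixed choice of the signs $\pm$), and let $\{t_n\}_{n=1}^\infty\subset(0,1)$ be a decreasing sequence converging to zero such that the sequence of differences $t_n-t_{n+1}$ is decreasing in $n$. Then $$\lim_{n\to\infty}e^{it_nP(D)}f(x)=f(x)\quad\text{for a.e. }x\in\mathbb{R}^N$$ holds for all $f\in H^s(\mathbb{R}^N)$ if and only if $\{t_n\}_{n=1}^\infty\in\ell^{r(s),\infty}(\mathbb{N})$, where $r(s)=\frac{s}{1-s}$.
   Context: For $t\in\mathbb{R}$, $$e^{itP(D)}f(x):=\int_{\mathbb{R}^N}e^{ix\cdot\xi+itP(\xi)}\widehat f(\xi)\,d\xi,$$ interpreted in the $L^2$ sense, where $\widehat f$ is the Fourier transform of $f$, normalized so that $e^{i0P(D)}f=f$, i.e. $\widehat f(\xi)=(2\pi)^{-N}\int_{\mathbb{R}^N}e^{-ix\cdot\xi}f(x)\,dx$. $H^s(\mathbb{R}^N)$ is the usual $L^2$-based inhomogeneous Sobolev space. For $r>0$, a sequence $\{t_n\}_{n=1}^\infty\subset(0,1)$ belongs to $\ell^{r,\infty}(\mathbb{N})$ if and only if $\sup_{b>0}b^{r}\,\#\{n:t_n>b\}<\infty$. *)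

theory Defs
  imports "HOL-Analysis.Analysis"
begin

text \<open>
  Elements of \<open>L\<^sup>2\<close> are represented by functions, not by classes modulo null sets. Squared
  \<open>L\<^sup>2\<close> norms are nonnegative integrals, so that a function which is not square integrable has
  norm \<open>\<infinity>\<close> (its Bochner integral would be the junk value 0).
\<close>

definition L2_norm_sq :: "(real ^ 'n \<Rightarrow> complex) \<Rightarrow> ennreal" where
  "L2_norm_sq f = (\<integral>\<^sup>+ x. ennreal ((cmod (f x))\<^sup>2) \<partial>lebesgue)"

definition L2_space :: "(real ^ 'n \<Rightarrow> complex) set" where
  "L2_space = {f. f \<in> borel_measurable lebesgue \<and> L2_norm_sq f < \<infinity>}"

definition L2_limit :: "(real \<Rightarrow> real ^ 'n \<Rightarrow> complex) \<Rightarrow> (real ^ 'n \<Rightarrow> complex) \<Rightarrow> bool" where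
  "L2_limit G g \<longleftrightarrow>
     g \<in> L2_space \<and> ((\<lambda>R. L2_norm_sq (\<lambda>x. G R x - g x)) \<longlongrightarrow> 0) at_top"

text \<open>
  The Fourier transform on \<open>L\<^sup>2\<close> is the \<open>L\<^sup>2\<close> limit of the integrals truncated to balls of radius
  \<open>R \<rightarrow> \<infinity>\<close> (it exists by Plancherel). The limit is unique only up to null sets; the choice
  operator picks a representative. The same applies to the propagator below.
\<close>

definition fourier_L2 :: "(real ^ 'n \<Rightarrow> complex) \<Rightarrow> real ^ 'n \<Rightarrow> complex" where
  "fourier_L2 f = (SOME F. L2_limit
     (\<lambda>R \<xi>. (1 / (2 * pi) ^ CARD('n)) *\<^sub>R
        (LINT x:cball 0 R|lebesgue. cis (- (x \<bullet> \<xi>)) * f x)) F)"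

definition propagator ::
    "(real ^ 'n \<Rightarrow> real) \<Rightarrow> real \<Rightarrow> (real ^ 'n \<Rightarrow> complex) \<Rightarrow> real ^ 'n \<Rightarrow> complex" where
  "propagator P t f = (SOME u. L2_limit
     (\<lambda>R x. LINT \<xi>:cball 0 R|lebesgue. cis (x \<bullet> \<xi> + t * P \<xi>) * fourier_L2 f \<xi>) u)"

text \<open>
  This is the inhomogeneous Sobolev space for \<open>s \<ge> 0\<close> only, where it is contained in \<open>L\<^sup>2\<close>;
  for \<open>s < 0\<close> it would contain distributions that are not functions.
\<close>

definition sobolev_space :: "real \<Rightarrow> (real ^ 'n \<Rightarrow> complex) set" where
  "sobolev_space s = {f \<in> L2_space.
     (\<integral>\<^sup>+ \<xi>. ennreal ((1 + (norm \<xi>)\<^sup>2) powr s * (cmod (fourier_L2 f \<xi>))\<^sup>2) \<partial>lebesgue) < \<infinity>}"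

text \<open>
  The indices \<open>i\<close> and \<open>j\<close> are those of the first two coordinates. The values of \<open>\<epsilon>\<close> at the
  other indices are the free signs; its values at \<open>i\<close> and \<open>j\<close> are not used.
\<close>

definition nonelliptic_symbol ::
    "'n \<Rightarrow> 'n \<Rightarrow> ('n \<Rightarrow> real) \<Rightarrow> real ^ 'n \<Rightarrow> real" where
  "nonelliptic_symbol i j \<epsilon> \<xi> =
     (\<xi> $ i)\<^sup>2 - (\<xi> $ j)\<^sup>2 + (\<Sum>k\<in>UNIV - {i, j}. \<epsilon> k * (\<xi> $ k)\<^sup>2)"

text \<open>
  Finiteness of the superlevel sets is stated separately, because \<^const>\<open>card\<close> is 0 on
  infinite sets.
\<close>

definition weak_ell :: "real \<Rightarrow> (nat \<Rightarrow> real) set" where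
  "weak_ell r = {t. (\<forall>b>0. finite {n. t n > b}) \<and>
     bdd_above ((\<lambda>b. b powr r * real (card {n. t n > b})) ` {0<..})}"

end

theory Submission
  imports Defs "HOL-Probability.Probability"
begin

text \<open>
  Put \<open>r = s / (1 - s)\<close>, so that \<open>r (1 - s) = s\<close>. The exponent comes from comparing two ways to control a
  maximum over the times below \<open>b\<close> at frequencies of size \<open>R\<close>. Summing over the times costs their
  number, which is \<open>b powr (- r)\<close> under the weak-type condition. Since \<open>\<bar>P \<xi>\<bar> \<le> (norm \<xi>)\<^sup>2\<close>, the evolution
  varies in time on the scale \<open>1 / R\<^sup>2\<close>, so that controlling a whole interval of length \<open>b\<close> costs
  \<open>b R\<^sup>2\<close>. The two costs agree for \<open>R = b powr (- 1 / (2 (1 - s)))\<close>, and their common value is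
  \<open>R powr (2 s)\<close>: exactly the weight of the Sobolev space.

  Sufficiency (\<open>convergence_of_weak_ell\<close>). Group the times into dyadic blocks and split the frequencies
  of each block at this radius. Above it, sum over the times; below it, chain through dyadic times
  (\<open>low_frequency_maximal\<close>). Away from the critical radius both bounds decay geometrically, so for a
  fixed frequency the sum over all blocks is again of the size of the weight
  (\<open>block_frequency_sum\<close>). Hence the squared maximal deviations of the blocks have a finite sum of
  integrals, and therefore tend to 0 almost everywhere.

  Necessity (\<open>weak_ell_of_convergence\<close>). If the weak-type condition fails, then for every \<open>K\<close> there are
  arbitrarily late indices \<open>n\<close> with \<open>t n - t (Suc n) < t n powr (1 + r) / (32 K)\<close>
  (\<open>weak_ell_if_gaps_large\<close>); since the gaps decrease, all later gaps are as small. The isotropic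
  directions of \<open>P\<close> now enter. With \<open>\<zeta> = \<xi>\<^sub>i - \<xi>\<^sub>j\<close> and \<open>\<eta> = \<xi>\<^sub>i + \<xi>\<^sub>j\<close> the first two squares
  are \<open>\<zeta> \<eta>\<close>, which is linear on the line \<open>\<zeta> = \<mu>\<close>: frequencies on it are transported with velocity \<open>\<mu>\<close>
  without dispersion. Equally spaced frequencies \<open>\<eta> = m \<kappa>\<close>, \<open>m < M\<close>, on this line form a periodic
  train of narrow spikes. The period is chosen as \<open>\<mu> t n\<close> and the width so large that the small time
  steps cannot jump over a spike; then every point of the unit ball is met by a spike at one of the
  times (\<open>lattice_bump_lower_bound\<close>). The spikes have size 1, but the squared Sobolev norm of the train
  is of the order \<open>K powr (s - 1)\<close> (\<open>resonant_bump_exists\<close>). A gliding hump adds up such trains with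
  rapidly increasing \<open>K\<close> into one function for which convergence fails on the whole unit ball.

  The first half of the text supplies the Fourier analysis on \<open>L\<^sup>2\<close>: Plancherel's identity for functions
  of bounded support, the extension to \<open>L\<^sup>2\<close>, and inversion.
\<close>

section \<open>The Fourier integral of integrable functions\<close>

text \<open>
  The inverse Fourier integral, without a normalising factor: all factors \<open>2 * pi\<close> are on the side
  of the forward transform.
\<close>

definition fourier_ext :: "(real ^ 'n \<Rightarrow> complex) \<Rightarrow> real ^ 'n \<Rightarrow> complex" where
  "fourier_ext g x = (\<integral>\<xi>. cis (x \<bullet> \<xi>) * g \<xi> \<partial>lborel)"

lemma cis_measurable [measurable]: "cis \<in> borel_measurable borel"
  by (intro borel_measurable_continuous_onI continuous_intros)

lemma cnj_measurable [measurable]: "cnj \<in> borel_measurable borel"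
  by (intro borel_measurable_continuous_onI continuous_intros)

lemma integrable_cis_mult:
  assumes "integrable lborel g" "\<theta> \<in> borel_measurable borel"
  shows "integrable lborel (\<lambda>\<xi>. cis (\<theta> \<xi>) * g \<xi> :: complex)"
  by (rule Bochner_Integration.integrable_bound[OF assms(1)])
     (use assms in \<open>auto simp: norm_mult\<close>)

lemma fourier_ext_measurable [measurable]:
  assumes [measurable]: "g \<in> borel_measurable borel"
  shows "fourier_ext g \<in> borel_measurable borel"
  unfolding fourier_ext_def by measurable

lemma norm_fourier_ext_le: "norm (fourier_ext g x) \<le> (\<integral>\<xi>. norm (g \<xi>) \<partial>lborel)"
proof -
  have "norm (fourier_ext g x) \<le> (\<integral>\<xi>. norm (cis (x \<bullet> \<xi>) * g \<xi>) \<partial>lborel)"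
    unfolding fourier_ext_def by (rule integral_norm_bound)
  thus ?thesis by (simp add: norm_mult)
qed

text \<open>
  Both sides are the same double integral, as the kernel is symmetric.
\<close>

lemma multiplication_formula:
  fixes a b :: "real ^ 'n \<Rightarrow> complex"
  assumes a: "integrable lborel a" and b: "integrable lborel b"
  shows "(\<integral>x. a x * fourier_ext b x \<partial>lborel) = (\<integral>\<xi>. b \<xi> * fourier_ext a \<xi> \<partial>lborel)"
proof -
  have [measurable]: "a \<in> borel_measurable borel" "b \<in> borel_measurable borel"
    using a b by auto
  have ab: "integrable (lborel \<Otimes>\<^sub>M lborel) (\<lambda>(x, \<xi>). a x * b \<xi>)"
  proof (rule lborel_pair.Fubini_integrable)
    have "integrable lborel (\<lambda>x. norm (a x) * (\<integral>\<xi>. norm (b \<xi>) \<partial>lborel))"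
      using a by (intro integrable_mult_left integrable_norm)
    thus "integrable lborel (\<lambda>x. \<integral>\<xi>. norm (case (x, \<xi>) of (x, \<xi>) \<Rightarrow> a x * b \<xi>) \<partial>lborel)"
      by (simp add: norm_mult)
    show "AE x in lborel. integrable lborel (\<lambda>\<xi>. case (x, \<xi>) of (x, \<xi>) \<Rightarrow> a x * b \<xi>)"
      using b by simp
  qed measurable
  have int: "integrable (lborel \<Otimes>\<^sub>M lborel) (\<lambda>(x, \<xi>). a x * (cis (x \<bullet> \<xi>) * b \<xi>))"
    by (rule Bochner_Integration.integrable_bound[OF ab]) (auto simp: norm_mult)
  have "(\<integral>x. a x * fourier_ext b x \<partial>lborel) = (\<integral>x. (\<integral>\<xi>. a x * (cis (x \<bullet> \<xi>) * b \<xi>) \<partial>lborel) \<partial>lborel)"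
    unfolding fourier_ext_def by simp
  also have "\<dots> = (\<integral>\<xi>. (\<integral>x. a x * (cis (x \<bullet> \<xi>) * b \<xi>) \<partial>lborel) \<partial>lborel)"
    using lborel_pair.Fubini_integral[OF int] by simp
  also have "\<dots> = (\<integral>\<xi>. (\<integral>x. b \<xi> * (cis (\<xi> \<bullet> x) * a x) \<partial>lborel) \<partial>lborel)"
    by (simp add: mult_ac inner_commute)
  finally show ?thesis by (simp add: fourier_ext_def)
qed

section \<open>Gaussian regularisation\<close>

definition gaussian :: "real \<Rightarrow> real ^ 'n \<Rightarrow> real" where
  "gaussian e x = exp (- (e * norm x)\<^sup>2 / 2)"

lemma gaussian_measurable [measurable]: "gaussian e \<in> borel_measurable borel"
  unfolding gaussian_def by measurable

lemma gaussian_prod: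
  "gaussian e (x::real^'n) = (\<Prod>b\<in>Basis. exp (- (e * (x \<bullet> b))\<^sup>2 / 2))"
proof -
  have "(norm x)\<^sup>2 = (\<Sum>b\<in>Basis. (x \<bullet> b)\<^sup>2)"
    by (subst power2_norm_eq_inner, subst euclidean_inner) (simp add: power2_eq_square)
  thus ?thesis unfolding gaussian_def
    by (simp add: exp_sum[symmetric] power_mult_distrib sum_distrib_left sum_negf sum_divide_distrib)
qed

text \<open>
  The characteristic function of the standard normal distribution, freed from its normalisation.
\<close>

lemma gaussian_integral_1d:
  fixes v :: real
  shows "(\<integral>x. cis (v * x) * exp (- x\<^sup>2 / 2) \<partial>lborel) = sqrt (2 * pi) * exp (- v\<^sup>2 / 2)"
    and "integrable lborel (\<lambda>x::real. complex_of_real (exp (- x\<^sup>2 / 2)))"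
proof -
  have eq: "complex_of_real (exp (- x\<^sup>2 / 2)) = sqrt (2 * pi) *\<^sub>R of_real (std_normal_density x)" for x
    by (simp add: std_normal_density_def scaleR_conv_of_real)
  have int: "integrable lborel std_normal_density"
    by simp
  show "integrable lborel (\<lambda>x::real. complex_of_real (exp (- x\<^sup>2 / 2)))"
    unfolding eq using int by (intro integrable_scaleR_right integrable_of_real)
  have "char std_normal_distribution v = (\<integral>x. std_normal_density x *\<^sub>R cis (v * x) \<partial>lborel)"
    unfolding char_def cis_conv_exp[symmetric]
    by (subst integral_density) (auto simp: normal_density_nonneg)
  hence *: "(\<integral>x. std_normal_density x *\<^sub>R cis (v * x) \<partial>lborel) = of_real (exp (- v\<^sup>2 / 2))"
    by (simp add: char_std_normal_distribution)
  have "(\<integral>x. cis (v * x) * exp (- x\<^sup>2 / 2) \<partial>lborel)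
      = (\<integral>x. sqrt (2*pi) *\<^sub>R (std_normal_density x *\<^sub>R cis (v * x)) \<partial>lborel)"
    unfolding eq by (simp add: scaleR_conv_of_real mult_ac)
  also have "\<dots> = sqrt (2*pi) *\<^sub>R of_real (exp (- v\<^sup>2 / 2))"
    unfolding integral_scaleR_right * ..
  finally show "(\<integral>x. cis (v * x) * exp (- x\<^sup>2 / 2) \<partial>lborel) = sqrt (2 * pi) * exp (- v\<^sup>2 / 2)"
    by (simp add: scaleR_conv_of_real)
qed

lemma lborel_prod_integral:
  fixes f :: "'a::euclidean_space \<Rightarrow> real \<Rightarrow> complex"
  assumes int: "\<And>b. b \<in> Basis \<Longrightarrow> integrable lborel (f b)"
  shows "(\<integral>x. (\<Prod>b\<in>Basis. f b (x \<bullet> b)) \<partial>lborel) = (\<Prod>b\<in>Basis. (\<integral>x. f b x \<partial>lborel))"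
    and "integrable lborel (\<lambda>x::'a. (\<Prod>b\<in>Basis. f b (x \<bullet> b)))"
proof -
  interpret product_sigma_finite "\<lambda>_::'a. lborel :: real measure" ..
  have [measurable]: "\<And>b. b \<in> Basis \<Longrightarrow> f b \<in> borel_measurable borel" using int by fastforce
  have m: "(\<lambda>x::'a. (\<Prod>b\<in>Basis. f b (x \<bullet> b))) \<in> borel_measurable borel"
    by (intro borel_measurable_prod) auto
  have m2: "(\<lambda>f. \<Sum>b\<in>Basis. f b *\<^sub>R b) \<in> (\<Pi>\<^sub>M b\<in>Basis. lborel) \<rightarrow>\<^sub>M (borel :: 'a measure)"
    by (intro borel_measurable_sum borel_measurable_scaleR) auto
  have eq: "(\<Prod>b\<in>Basis. f b ((\<Sum>c\<in>Basis. g c *\<^sub>R c) \<bullet> b)) = (\<Prod>b\<in>Basis. f b (g b))" for g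
    by (intro prod.cong refl) (simp add: inner_sum_left_Basis)
  show "(\<integral>x. (\<Prod>b\<in>Basis. f b (x \<bullet> b)) \<partial>lborel) = (\<Prod>b\<in>Basis. (\<integral>x. f b x \<partial>lborel))"
    by (subst lborel_eq, subst integral_distr[OF m2 m]) (simp add: eq product_integral_prod int)
  show "integrable lborel (\<lambda>x::'a. (\<Prod>b\<in>Basis. f b (x \<bullet> b)))"
    by (subst lborel_eq, subst integrable_distr_eq[OF m2 m]) (simp add: eq product_integrable_prod int)
qed

lemma lborel_scale:
  fixes f :: "'a::euclidean_space \<Rightarrow> 'b::{banach, second_countable_topology}"
  assumes "c \<noteq> 0" and [measurable]: "f \<in> borel_measurable borel"
  shows "(\<integral>x. f x \<partial>lborel) = \<bar>c\<bar> ^ DIM('a) *\<^sub>R (\<integral>x. f (t + c *\<^sub>R x) \<partial>lborel)"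
    and "integrable lborel f \<longleftrightarrow> integrable lborel (\<lambda>x. f (t + c *\<^sub>R x))"
proof -
  show "(\<integral>x. f x \<partial>lborel) = \<bar>c\<bar> ^ DIM('a) *\<^sub>R (\<integral>x. f (t + c *\<^sub>R x) \<partial>lborel)"
    by (subst lborel_affine[OF assms(1), of t], subst integral_density) (auto simp: integral_distr)
  have "integrable lborel f \<longleftrightarrow> integrable (density (distr lborel borel (\<lambda>x. t + c *\<^sub>R x)) (\<lambda>_. \<bar>c\<bar>^DIM('a))) f"
    using lborel_affine[OF assms(1), of t] by simp
  also have "\<dots> \<longleftrightarrow> integrable (distr lborel borel (\<lambda>x. t + c *\<^sub>R x)) (\<lambda>x. (\<bar>c\<bar>^DIM('a)) *\<^sub>R f x)"
    by (subst integrable_density) auto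
  also have "\<dots> \<longleftrightarrow> integrable lborel (\<lambda>x. (\<bar>c\<bar>^DIM('a)) *\<^sub>R f (t + c *\<^sub>R x))"
    by (subst integrable_distr_eq) auto
  also have "\<dots> \<longleftrightarrow> integrable lborel (\<lambda>x. f (t + c *\<^sub>R x))"
    using assms(1) integrable_scaleR_right[of "1 / (\<bar>c\<bar>^DIM('a))" lborel "\<lambda>x. (\<bar>c\<bar>^DIM('a)) *\<^sub>R f (t + c *\<^sub>R x)"] by auto
  finally show "integrable lborel f \<longleftrightarrow> integrable lborel (\<lambda>x. f (t + c *\<^sub>R x))" .
qed

lemma lborel_nn_scale:
  fixes f :: "'a::euclidean_space \<Rightarrow> ennreal"
  assumes "c \<noteq> 0" and [measurable]: "f \<in> borel_measurable borel"
  shows "(\<integral>\<^sup>+x. f x \<partial>lborel) = ennreal (\<bar>c\<bar> ^ DIM('a)) * (\<integral>\<^sup>+x. f (t + c *\<^sub>R x) \<partial>lborel)"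
    by (subst lborel_affine[OF assms(1), of t], subst nn_integral_density)
      (auto simp: nn_integral_distr nn_integral_cmult ennreal_power)

lemma gaussian_integrable1: "integrable lborel (\<lambda>x::real^'n. complex_of_real (gaussian 1 x))"
proof -
  have "integrable lborel (\<lambda>x::real^'n. \<Prod>b\<in>Basis. complex_of_real (exp (- (x \<bullet> b)\<^sup>2 / 2)))"
    by (rule lborel_prod_integral(2)) (rule gaussian_integral_1d(2))
  moreover have "(\<lambda>x::real^'n. complex_of_real (gaussian 1 x))
      = (\<lambda>x. \<Prod>b\<in>Basis. complex_of_real (exp (- (x \<bullet> b)\<^sup>2 / 2)))"
    by (simp add: gaussian_prod)
  ultimately show ?thesis by (simp only:)
qed

text \<open>
  The exponential and the Gaussian both factor over the coordinates.
\<close>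

lemma gaussian_fourier1:
  "fourier_ext (\<lambda>x::real^'n. complex_of_real (gaussian 1 x)) v = sqrt (2 * pi) ^ CARD('n) * gaussian 1 v"
proof -
  have int: "integrable lborel (\<lambda>x. cis ((v \<bullet> b) * x) * exp (- x\<^sup>2 / 2))" for b
    by (intro integrable_cis_mult gaussian_integral_1d(2)) auto
  have cis: "cis (v \<bullet> x) = (\<Prod>b\<in>Basis. cis ((v \<bullet> b) * (x \<bullet> b)))" for x
    by (simp add: euclidean_inner[of v x] cis_conv_exp exp_sum sum_distrib_left)
  have "fourier_ext (\<lambda>x::real^'n. complex_of_real (gaussian 1 x)) v
     = (\<integral>x. (\<Prod>b\<in>Basis. cis ((v \<bullet> b) * (x \<bullet> b)) * exp (- (x \<bullet> b)\<^sup>2 / 2)) \<partial>lborel)"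
    unfolding fourier_ext_def cis gaussian_prod by (simp add: prod.distrib)
  also have "\<dots> = (\<Prod>b\<in>(Basis :: (real^'n) set). complex_of_real (sqrt (2 * pi) * exp (- (v \<bullet> b)\<^sup>2 / 2)))"
    by (subst lborel_prod_integral(1)[where f = "\<lambda>b x. cis ((v \<bullet> b) * x) * exp (- x\<^sup>2 / 2)"])
       (use int gaussian_integral_1d(1) in simp_all)
  also have "\<dots> = sqrt (2 * pi) ^ CARD('n) * gaussian 1 v"
    unfolding of_real_prod[symmetric] prod.distrib by (simp add: gaussian_prod)
  finally show ?thesis .
qed

lemma gaussian_scale: "gaussian e (c *\<^sub>R x) = gaussian (e * c) x"
  by (simp add: gaussian_def power_mult_distrib mult_ac)

lemma gaussian_integrable:
  assumes "e > 0"
  shows "integrable lborel (\<lambda>x::real^'n. complex_of_real (gaussian e x))"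
  using gaussian_integrable1 assms
  by (subst lborel_scale(2)[where c="1/e" and t=0]) (auto simp: gaussian_scale)

lemma gaussian_fourier:
  assumes "e > 0"
  shows "fourier_ext (\<lambda>x::real^'n. complex_of_real (gaussian e x)) v
     = (sqrt (2 * pi) / e) ^ CARD('n) * gaussian (1/e) v"
proof -
  have "fourier_ext (\<lambda>x::real^'n. complex_of_real (gaussian e x)) v
     = (1/e) ^ CARD('n) *\<^sub>R (\<integral>x. cis (v \<bullet> (0 + (1/e) *\<^sub>R x)) * gaussian e (0 + (1/e) *\<^sub>R x) \<partial>lborel)"
    unfolding fourier_ext_def using assms by (subst lborel_scale(1)[where c="1/e" and t=0]) auto
  also have "(\<integral>x. cis (v \<bullet> (0 + (1/e) *\<^sub>R x)) * gaussian e (0 + (1/e) *\<^sub>R x) \<partial>lborel)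
     = fourier_ext (\<lambda>x::real^'n. complex_of_real (gaussian 1 x)) ((1/e) *\<^sub>R v)"
    unfolding fourier_ext_def using assms by (simp add: gaussian_scale)
  finally have "fourier_ext (\<lambda>x::real^'n. complex_of_real (gaussian e x)) v
     = complex_of_real ((1/e) ^ CARD('n)) * (complex_of_real (sqrt (2 * pi) ^ CARD('n)) * of_real (gaussian (1/e) v))"
    by (simp only: gaussian_fourier1 gaussian_scale scaleR_conv_of_real[where 'a=complex] of_real_mult mult_1)
  thus ?thesis by (simp add: power_divide)
qed

lemma gaussian_total:
  "(\<integral>x. sqrt (2 * pi) ^ CARD('n) * gaussian 1 x \<partial>(lborel :: (real^'n) measure)) = (2 * pi) ^ CARD('n)"
proof -
  have "complex_of_real (\<integral>x. gaussian 1 x \<partial>(lborel :: (real^'n) measure)) = sqrt (2 * pi) ^ CARD('n)"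
    using gaussian_fourier1[of "0::real^'n"] unfolding fourier_ext_def
    by (simp add: gaussian_def del: of_real_power)
  hence "(\<integral>x. gaussian 1 x \<partial>(lborel :: (real^'n) measure)) = sqrt (2 * pi) ^ CARD('n)"
    using of_real_eq_iff by blast
  moreover have "sqrt (2 * pi) ^ n * sqrt (2 * pi) ^ n = (2 * pi) ^ n" for n
    by (subst power_mult_distrib[symmetric]) simp
  ultimately show ?thesis by simp
qed

lemma fourier_ext_cnj: "cnj (fourier_ext g x) = fourier_ext (\<lambda>\<xi>. cnj (g \<xi>)) (- x)"
  unfolding fourier_ext_def Bochner_Integration.integral_cnj[symmetric] by (simp add: cis_cnj)

lemma norm_integral_le_nn_integral:
  fixes f :: "'a \<Rightarrow> 'b::{banach, second_countable_topology}"
  shows "ennreal (norm (integral\<^sup>L M f)) \<le> (\<integral>\<^sup>+x. ennreal (norm (f x)) \<partial>M)"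
  by (cases "integrable M f") (auto intro: integral_norm_bound_ennreal simp: not_integrable_integral_eq)

text \<open>
  Multiplying by a wide Gaussian makes the squared modulus of \<open>fourier_ext g\<close> integrable. Two
  applications of the multiplication formula move everything to the side of \<open>g\<close>, where the Fourier
  transform of the Gaussian appears as an approximate identity of total mass \<open>(2 * pi) ^ CARD('n)\<close>.
\<close>

lemma gaussian_regularised_norm:
  fixes g :: "real ^ 'n \<Rightarrow> complex"
  assumes g: "integrable lborel g" and e: "e > 0"
  shows "(\<integral>x. gaussian e x * (cmod (fourier_ext g x))\<^sup>2 \<partial>lborel) =
         (\<integral>\<xi>. g \<xi> * (\<integral>w. cnj (g (\<xi> + e *\<^sub>R w)) * (sqrt (2 * pi) ^ CARD('n) * gaussian 1 w) \<partial>lborel) \<partial>lborel)"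
proof -
  have [measurable]: "g \<in> borel_measurable borel" using g by auto
  let ?\<phi> = "\<lambda>x::real^'n. complex_of_real (gaussian e x)"
  let ?c = "\<integral>\<xi>. norm (g \<xi>) \<partial>lborel"
  have \<phi>: "integrable lborel ?\<phi>" by (rule gaussian_integrable[OF e])
  have gc: "integrable lborel (\<lambda>x. cnj (g x))"
    by (rule Bochner_Integration.integrable_bound[OF g]) auto
  have a: "integrable lborel (\<lambda>x. ?\<phi> x * cnj (fourier_ext g x))"
  proof (rule Bochner_Integration.integrable_bound)
    show "integrable lborel (\<lambda>x. ?\<phi> x * of_real ?c)" using \<phi> by simp
    show "AE x in lborel. norm (?\<phi> x * cnj (fourier_ext g x)) \<le> norm (?\<phi> x * of_real ?c)"
      using norm_fourier_ext_le[of g] by (auto simp: norm_mult intro!: mult_left_mono)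
  qed auto
  have inner: "fourier_ext (\<lambda>x. ?\<phi> x * cnj (fourier_ext g x)) \<xi>
      = (\<integral>w. cnj (g (\<xi> + e *\<^sub>R w)) * (sqrt (2 * pi) ^ CARD('n) * gaussian 1 w) \<partial>lborel)" for \<xi>
  proof -
    have "fourier_ext (\<lambda>x. ?\<phi> x * cnj (fourier_ext g x)) \<xi>
      = (\<integral>x. cis (\<xi> \<bullet> x) * ?\<phi> x * fourier_ext (\<lambda>\<xi>. cnj (g \<xi>)) (- x) \<partial>lborel)"
      unfolding fourier_ext_cnj by (subst fourier_ext_def) (simp add: mult_ac)
    also have "\<dots> = (\<integral>x. cis (- (\<xi> \<bullet> x)) * ?\<phi> x * fourier_ext (\<lambda>\<xi>. cnj (g \<xi>)) x \<partial>lborel)"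
      by (subst lborel_scale(1)[where c="-1" and t=0]) (auto simp: gaussian_def)
    also have "\<dots> = (\<integral>\<eta>. cnj (g \<eta>) * fourier_ext (\<lambda>x. cis (- (\<xi> \<bullet> x)) * ?\<phi> x) \<eta> \<partial>lborel)"
      by (rule multiplication_formula[OF _ gc]) (intro integrable_cis_mult \<phi>, measurable)
    also have "\<dots> = (\<integral>\<eta>. cnj (g \<eta>) * fourier_ext ?\<phi> (\<eta> - \<xi>) \<partial>lborel)"
      unfolding fourier_ext_def by (simp add: mult.assoc[symmetric] cis_mult inner_diff_left)
    also have "\<dots> = (\<integral>\<eta>. cnj (g \<eta>) * ((sqrt (2 * pi) / e) ^ CARD('n) * gaussian (1/e) (\<eta> - \<xi>)) \<partial>lborel)"
      by (subst gaussian_fourier[OF e]) simp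
    also have "\<dots> = (e ^ CARD('n)) *\<^sub>R
        (\<integral>w. cnj (g (\<xi> + e *\<^sub>R w)) * ((sqrt (2 * pi) / e) ^ CARD('n) * gaussian (1/e) (e *\<^sub>R w)) \<partial>lborel)"
      using e by (subst lborel_scale(1)[where c=e and t=\<xi>]) auto
    also have "\<dots> = (\<integral>w. cnj (g (\<xi> + e *\<^sub>R w)) * (sqrt (2 * pi) ^ CARD('n) * gaussian 1 w) \<partial>lborel)"
      unfolding integral_scaleR_right[symmetric] gaussian_scale using e
      by (intro Bochner_Integration.integral_cong refl)
         (simp add: scaleR_conv_of_real power_divide)
    finally show ?thesis .
  qed
  have "complex_of_real (\<integral>x. gaussian e x * (cmod (fourier_ext g x))\<^sup>2 \<partial>lborel)
      = (\<integral>x. (?\<phi> x * cnj (fourier_ext g x)) * fourier_ext g x \<partial>lborel)"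
    unfolding integral_complex_of_real[symmetric]
    by (intro Bochner_Integration.integral_cong refl) (simp add: complex_norm_square[symmetric] mult_ac)
  also have "\<dots> = (\<integral>\<xi>. g \<xi> * fourier_ext (\<lambda>x. ?\<phi> x * cnj (fourier_ext g x)) \<xi> \<partial>lborel)"
    by (rule multiplication_formula[OF a g])
  finally show ?thesis unfolding inner .
qed

lemma gaussian_kernel_integrable:
  "integrable lborel (\<lambda>w::real^'n. sqrt (2 * pi) ^ CARD('n) * gaussian 1 w)"
proof -
  have "integrable lborel (\<lambda>x::real^'n. Re (complex_of_real (gaussian 1 x)))"
    by (rule integrable_Re[OF gaussian_integrable1])
  thus ?thesis by simp
qed

lemma gaussian_kernel_nn:
  "(\<integral>\<^sup>+w. ennreal (sqrt (2 * pi) ^ CARD('n) * gaussian 1 w) \<partial>(lborel :: (real^'n) measure)) = ennreal ((2*pi) ^ CARD('n))"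
  by (subst nn_integral_eq_integral[OF gaussian_kernel_integrable])
     (simp_all only: gaussian_total, simp add: gaussian_def)

abbreviation sqn :: "(real ^ 'n \<Rightarrow> complex) \<Rightarrow> ennreal" where
  "sqn \<equiv> L2_norm_sq"

lemma sqn_lborel: "sqn f = (\<integral>\<^sup>+ x. ennreal ((cmod (f x))\<^sup>2) \<partial>lborel)"
  by (simp add: L2_norm_sq_def nn_integral_completion)

text \<open>
  The kernel is positive, so that \<open>2 a b \<le> a\<^sup>2 + b\<^sup>2\<close> and translation invariance already give the upper
  half of Plancherel's identity, uniformly in the regularisation.
\<close>

lemma gaussian_regularised_bound:
  fixes g :: "real ^ 'n \<Rightarrow> complex"
  assumes g: "integrable lborel g" and e: "e > 0"
  shows "(\<integral>\<^sup>+x. ennreal (gaussian e x * (cmod (fourier_ext g x))\<^sup>2) \<partial>lborel) \<le> ennreal ((2*pi) ^ CARD('n)) * sqn g"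
proof -
  have [measurable]: "g \<in> borel_measurable borel" using g by auto
  let ?k = "\<lambda>w::real^'n. sqrt (2 * pi) ^ CARD('n) * gaussian 1 w"
  let ?C = "ennreal ((2*pi) ^ CARD('n))"
  let ?c = "\<integral>\<xi>. norm (g \<xi>) \<partial>lborel"
  have k0: "?k w \<ge> 0" for w by (auto simp: gaussian_def)
  have int: "integrable lborel (\<lambda>x. gaussian e x * (cmod (fourier_ext g x))\<^sup>2)"
  proof (rule Bochner_Integration.integrable_bound)
    have "integrable lborel (\<lambda>x::real^'n. Re (complex_of_real (gaussian e x)))"
      by (rule integrable_Re[OF gaussian_integrable[OF e]])
    thus "integrable lborel (\<lambda>x::real^'n. gaussian e x * ?c\<^sup>2)" by simp
    show "AE x in lborel. norm (gaussian e x * (cmod (fourier_ext g x))\<^sup>2) \<le> norm (gaussian e x * ?c\<^sup>2)"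
      using norm_fourier_ext_le[of g] by (auto simp: norm_mult gaussian_def intro!: mult_left_mono power_mono)
  qed auto
  have "(\<integral>\<^sup>+x. ennreal (gaussian e x * (cmod (fourier_ext g x))\<^sup>2) \<partial>lborel)
     = ennreal (\<integral>x. gaussian e x * (cmod (fourier_ext g x))\<^sup>2 \<partial>lborel)"
    by (rule nn_integral_eq_integral[OF int]) (auto simp: gaussian_def)
  also have "\<dots> \<le> ennreal (norm (complex_of_real (\<integral>x. gaussian e x * (cmod (fourier_ext g x))\<^sup>2 \<partial>lborel)))"
    by (intro ennreal_leI) simp
  also have "\<dots> \<le> (\<integral>\<^sup>+\<xi>. ennreal (norm (g \<xi> * (\<integral>w. cnj (g (\<xi> + e *\<^sub>R w)) * ?k w \<partial>lborel))) \<partial>lborel)"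
    unfolding gaussian_regularised_norm[OF g e] by (rule norm_integral_le_nn_integral)
  also have "\<dots> \<le> (\<integral>\<^sup>+\<xi>. (\<integral>\<^sup>+w. ennreal (((cmod (g \<xi>))\<^sup>2 + (cmod (g (\<xi> + e *\<^sub>R w)))\<^sup>2) / 2) * ennreal (?k w) \<partial>lborel) \<partial>lborel)"
  proof (intro nn_integral_mono)
    fix \<xi>
    have "ennreal (norm (g \<xi> * (\<integral>w. cnj (g (\<xi> + e *\<^sub>R w)) * ?k w \<partial>lborel)))
       = ennreal (norm (\<integral>w. g \<xi> * (cnj (g (\<xi> + e *\<^sub>R w)) * ?k w) \<partial>lborel))" by simp
    also have "\<dots> \<le> (\<integral>\<^sup>+w. ennreal (norm (g \<xi> * (cnj (g (\<xi> + e *\<^sub>R w)) * ?k w))) \<partial>lborel)"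
      by (rule norm_integral_le_nn_integral)
    also have "\<dots> \<le> (\<integral>\<^sup>+w. ennreal (((cmod (g \<xi>))\<^sup>2 + (cmod (g (\<xi> + e *\<^sub>R w)))\<^sup>2) / 2) * ennreal (?k w) \<partial>lborel)"
    proof (intro nn_integral_mono)
      fix w
      have "cmod (g \<xi>) * cmod (g (\<xi> + e *\<^sub>R w)) \<le> ((cmod (g \<xi>))\<^sup>2 + (cmod (g (\<xi> + e *\<^sub>R w)))\<^sup>2) / 2"
        using sum_squares_bound[of "cmod (g \<xi>)" "cmod (g (\<xi> + e *\<^sub>R w))"] by simp
      from mult_right_mono[OF this k0[of w]]
      have "norm (g \<xi> * (cnj (g (\<xi> + e *\<^sub>R w)) * ?k w)) \<le> ((cmod (g \<xi>))\<^sup>2 + (cmod (g (\<xi> + e *\<^sub>R w)))\<^sup>2) / 2 * ?k w"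
        using k0[of w] by (simp add: norm_mult norm_power mult.assoc gaussian_def)
      thus "ennreal (norm (g \<xi> * (cnj (g (\<xi> + e *\<^sub>R w)) * ?k w))) \<le> ennreal (((cmod (g \<xi>))\<^sup>2 + (cmod (g (\<xi> + e *\<^sub>R w)))\<^sup>2) / 2) * ennreal (?k w)"
        using k0[of w] by (subst ennreal_mult[symmetric]) (auto intro!: ennreal_leI)
    qed
    finally show "ennreal (norm (g \<xi> * (\<integral>w. cnj (g (\<xi> + e *\<^sub>R w)) * ?k w \<partial>lborel))) \<le> \<dots>" .
  qed
  also have "\<dots> = (\<integral>\<^sup>+\<xi>. (\<integral>\<^sup>+w. ennreal (1/2) * (ennreal ((cmod (g \<xi>))\<^sup>2) * ennreal (?k w)) + ennreal (1/2) * (ennreal ((cmod (g (\<xi> + e *\<^sub>R w)))\<^sup>2) * ennreal (?k w)) \<partial>lborel) \<partial>lborel)"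
  proof -
    have *: "ennreal ((a + b) / 2) * ennreal k
         = ennreal (1/2) * (ennreal a * ennreal k) + ennreal (1/2) * (ennreal b * ennreal k)"
      if "a \<ge> 0" "b \<ge> 0" "k \<ge> 0" for a b k :: real
    proof -
      have "ennreal ((a + b) / 2) * ennreal k = ennreal ((a + b) / 2 * k)"
        using that by (intro ennreal_mult[symmetric]) auto
      also have "(a + b) / 2 * k = 1/2 * (a * k) + 1/2 * (b * k)" by (simp add: field_simps)
      also have "ennreal \<dots> = ennreal (1/2 * (a * k)) + ennreal (1/2 * (b * k))"
        using that by (intro ennreal_plus) auto
      also have "\<dots> = ennreal (1/2) * (ennreal a * ennreal k) + ennreal (1/2) * (ennreal b * ennreal k)"
        using that by (simp only: ennreal_mult mult_nonneg_nonneg zero_le_divide_1_iff zero_le_numeral)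
      finally show ?thesis .
    qed
    show ?thesis by (intro nn_integral_cong * k0) auto
  qed
  also have "\<dots> = ennreal (1/2) * (\<integral>\<^sup>+\<xi>. (\<integral>\<^sup>+w. (ennreal ((cmod (g \<xi>))\<^sup>2) * ennreal (?k w)) \<partial>lborel) \<partial>lborel) +
      ennreal (1/2) * (\<integral>\<^sup>+\<xi>. (\<integral>\<^sup>+w. (ennreal ((cmod (g (\<xi> + e *\<^sub>R w)))\<^sup>2) * ennreal (?k w)) \<partial>lborel) \<partial>lborel)"
    by (simp add: nn_integral_add nn_integral_cmult)
  also have "(\<integral>\<^sup>+\<xi>. (\<integral>\<^sup>+w. (ennreal ((cmod (g \<xi>))\<^sup>2) * ennreal (?k w)) \<partial>lborel) \<partial>lborel) = ?C * sqn g"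
    by (subst nn_integral_cmult, simp, subst gaussian_kernel_nn, subst nn_integral_multc) (auto simp: sqn_lborel mult_ac)
  also have "(\<integral>\<^sup>+\<xi>. (\<integral>\<^sup>+w. (ennreal ((cmod (g (\<xi> + e *\<^sub>R w)))\<^sup>2) * ennreal (?k w)) \<partial>lborel) \<partial>lborel)
     = (\<integral>\<^sup>+w. (\<integral>\<^sup>+\<xi>. (ennreal ((cmod (g (\<xi> + e *\<^sub>R w)))\<^sup>2) * ennreal (?k w)) \<partial>lborel) \<partial>lborel)"
  proof -
    show ?thesis
      by (rule lborel_pair.Fubini'[symmetric]) measurable
  qed
  also have "\<dots> = (\<integral>\<^sup>+w. ennreal (?k w) * sqn g \<partial>lborel)"
  proof (intro nn_integral_cong)
    fix w :: "real^'n"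
    have "(\<integral>\<^sup>+\<xi>. ennreal ((cmod (g (\<xi> + e *\<^sub>R w)))\<^sup>2) \<partial>lborel) = sqn g"
      unfolding sqn_lborel by (subst (2) lborel_nn_scale[where c=1 and t = "e *\<^sub>R w"]) (auto simp: add_ac)
    thus "(\<integral>\<^sup>+\<xi>. (ennreal ((cmod (g (\<xi> + e *\<^sub>R w)))\<^sup>2) * ennreal (?k w)) \<partial>lborel) = ennreal (?k w) * sqn g"
      by (subst nn_integral_multc) (auto simp: mult_ac)
  qed
  also have "\<dots> = ?C * sqn g"
    by (subst nn_integral_multc, simp, subst gaussian_kernel_nn) simp
  also have "ennreal (1/2) * (?C * sqn g) + ennreal (1/2) * (?C * sqn g) = ?C * sqn g"
    unfolding distrib_right[symmetric] by (subst ennreal_plus[symmetric]) auto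
  finally show ?thesis .
qed

lemma gaussian_tendsto_1: "(\<lambda>n. gaussian (1 / real (Suc n)) x) \<longlonglongrightarrow> 1"
proof -
  have "(\<lambda>n. exp (- (1 / real (Suc n) * norm x)\<^sup>2 / 2)) \<longlonglongrightarrow> exp (- (0 * norm x)\<^sup>2 / 2)"
    by (intro tendsto_intros LIMSEQ_Suc[OF lim_1_over_n]) auto
  thus ?thesis by (simp add: gaussian_def)
qed

text \<open>
  Fatou's lemma removes the regularisation.
\<close>

lemma plancherel_le:
  fixes g :: "real ^ 'n \<Rightarrow> complex"
  assumes g: "integrable lborel g"
  shows "sqn (fourier_ext g) \<le> ennreal ((2*pi) ^ CARD('n)) * sqn g"
proof -
  have [measurable]: "g \<in> borel_measurable borel" using g by auto
  have "sqn (fourier_ext g) = (\<integral>\<^sup>+x. liminf (\<lambda>n. ennreal (gaussian (1 / real (Suc n)) x * (cmod (fourier_ext g x))\<^sup>2)) \<partial>lborel)"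
    unfolding sqn_lborel
  proof (intro nn_integral_cong)
    fix x
    have "(\<lambda>n. ennreal (gaussian (1 / real (Suc n)) x * (cmod (fourier_ext g x))\<^sup>2)) \<longlonglongrightarrow> ennreal (1 * (cmod (fourier_ext g x))\<^sup>2)"
      by (intro tendsto_ennrealI tendsto_intros gaussian_tendsto_1)
    from lim_imp_Liminf[OF _ this]
    show "ennreal ((cmod (fourier_ext g x))\<^sup>2) = liminf (\<lambda>n. ennreal (gaussian (1 / real (Suc n)) x * (cmod (fourier_ext g x))\<^sup>2))"
      by simp
  qed
  also have "\<dots> \<le> liminf (\<lambda>n. \<integral>\<^sup>+x. ennreal (gaussian (1 / real (Suc n)) x * (cmod (fourier_ext g x))\<^sup>2) \<partial>lborel)"
    by (rule nn_integral_liminf) measurable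
  also have "\<dots> \<le> liminf (\<lambda>n::nat. ennreal ((2*pi) ^ CARD('n)) * sqn g)"
    by (intro Liminf_mono always_eventually allI gaussian_regularised_bound g) auto
  also have "\<dots> = ennreal ((2*pi) ^ CARD('n)) * sqn g" by (simp add: Liminf_const)
  finally show ?thesis .
qed

text \<open>
  For the indicator of an open set the approximate identity converges pointwise: a point of the set
  keeps a neighbourhood inside it.
\<close>

lemma plancherel_ge_open:
  fixes U :: "(real ^ 'n) set"
  assumes U: "open U" "bounded U"
  shows "ennreal ((2*pi) ^ CARD('n)) * sqn (indicator U) \<le> sqn (fourier_ext (indicator U))"
proof -
  let ?g = "indicator U :: real^'n \<Rightarrow> complex"
  let ?k = "\<lambda>w::real^'n. sqrt (2 * pi) ^ CARD('n) * gaussian 1 w"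
  let ?e = "\<lambda>n. 1 / real (Suc n)"
  have k0: "?k w \<ge> 0" for w by (auto simp: gaussian_def)
  have [measurable]: "U \<in> sets borel" using U by auto
  have fin: "emeasure lborel U < \<infinity>" by (rule emeasure_bounded_finite[OF U(2)])
  have "integrable lborel (\<lambda>x. indicat_real U x *\<^sub>R (1::complex))"
    using fin by (intro integrable_indicator) auto
  moreover have "(\<lambda>x. indicat_real U x *\<^sub>R (1::complex)) = ?g" by (auto simp: indicator_def)
  ultimately have g: "integrable lborel ?g" by simp
  have kint: "integrable lborel (\<lambda>w::real^'n. complex_of_real (?k w))"
    using gaussian_kernel_integrable by (rule integrable_of_real)
  define I where "I = (\<lambda>n \<xi>. \<integral>w. cnj (?g (\<xi> + ?e n *\<^sub>R w)) * ?k w \<partial>lborel)"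
  have Ilim: "(\<lambda>n. I n \<xi>) \<longlonglongrightarrow> (\<integral>w. complex_of_real (?k w) \<partial>lborel)" if "\<xi> \<in> U" for \<xi>
    unfolding I_def
  proof (rule integral_dominated_convergence)
    show "integrable lborel ?k" by (rule gaussian_kernel_integrable)
    show "AE w in lborel. (\<lambda>n. cnj (?g (\<xi> + ?e n *\<^sub>R w)) * ?k w) \<longlonglongrightarrow> complex_of_real (?k w)"
    proof (intro AE_I2)
      fix w
      have "(\<lambda>n. \<xi> + ?e n *\<^sub>R w) \<longlonglongrightarrow> \<xi> + 0 *\<^sub>R w"
        by (intro tendsto_intros LIMSEQ_Suc[OF lim_1_over_n])
      hence "\<forall>\<^sub>F n in sequentially. \<xi> + ?e n *\<^sub>R w \<in> U"
        using topological_tendstoD[OF _ U(1)] that by auto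
      thus "(\<lambda>n. cnj (?g (\<xi> + ?e n *\<^sub>R w)) * ?k w) \<longlonglongrightarrow> complex_of_real (?k w)"
        by (intro tendsto_eventually, elim eventually_mono) simp
    qed
    show "AE w in lborel. norm (cnj (?g (\<xi> + ?e n *\<^sub>R w)) * complex_of_real (?k w)) \<le> ?k w" for n
      using k0 by (intro AE_I2) (auto simp: indicator_def gaussian_def norm_mult norm_power)
  qed (auto intro!: borel_measurable_times)
  have kk: "(\<integral>w. complex_of_real (?k w) \<partial>(lborel :: (real^'n) measure)) = complex_of_real ((2*pi) ^ CARD('n))"
    by (subst integral_complex_of_real, subst gaussian_total) simp
  have Ibd: "norm (I n \<xi>) \<le> (2*pi) ^ CARD('n)" for n \<xi>
  proof -
    have "norm (I n \<xi>) \<le> (\<integral>w. norm (cnj (?g (\<xi> + ?e n *\<^sub>R w)) * complex_of_real (?k w)) \<partial>lborel)"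
      unfolding I_def by (rule integral_norm_bound)
    also have "\<dots> \<le> (\<integral>w. ?k w \<partial>(lborel :: (real^'n) measure))"
    proof (rule integral_mono')
      show "integrable lborel ?k" by (rule gaussian_kernel_integrable)
    qed (use k0 in \<open>auto simp: indicator_def gaussian_def norm_mult norm_power\<close>)
    finally show ?thesis using gaussian_total[where 'n='n] by simp
  qed
  have [measurable]: "I n \<in> borel_measurable borel" for n unfolding I_def by measurable
  have lim: "(\<lambda>n. \<integral>\<xi>. ?g \<xi> * I n \<xi> \<partial>lborel) \<longlonglongrightarrow> (\<integral>\<xi>. ?g \<xi> * complex_of_real ((2*pi) ^ CARD('n)) \<partial>lborel)"
  proof (rule integral_dominated_convergence)
    show "integrable lborel (\<lambda>\<xi>. norm (?g \<xi> * complex_of_real ((2*pi) ^ CARD('n))))"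
      using g by auto
    show "AE \<xi> in lborel. (\<lambda>n. ?g \<xi> * I n \<xi>) \<longlonglongrightarrow> ?g \<xi> * complex_of_real ((2*pi) ^ CARD('n))"
    proof (intro AE_I2)
      fix \<xi> show "(\<lambda>n. ?g \<xi> * I n \<xi>) \<longlonglongrightarrow> ?g \<xi> * complex_of_real ((2*pi) ^ CARD('n))"
        using Ilim[of \<xi>] unfolding kk by (cases "\<xi> \<in> U") (auto simp del: of_real_power)
    qed
    show "AE \<xi> in lborel. norm (?g \<xi> * I n \<xi>) \<le> norm (?g \<xi> * complex_of_real ((2*pi) ^ CARD('n)))" for n
      using Ibd[of n] by (intro AE_I2) (auto simp: norm_mult norm_power indicator_def)
  qed auto
  have lim': "(\<lambda>n. ennreal (norm (\<integral>\<xi>. ?g \<xi> * I n \<xi> \<partial>lborel))) \<longlonglongrightarrow> ennreal (norm (\<integral>\<xi>. ?g \<xi> * complex_of_real ((2*pi) ^ CARD('n)) \<partial>lborel))"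
    by (intro tendsto_ennrealI tendsto_norm lim)
  have "ennreal (norm (\<integral>\<xi>. ?g \<xi> * I n \<xi> \<partial>lborel)) \<le> sqn (fourier_ext ?g)" for n
  proof -
    have "(\<integral>\<xi>. ?g \<xi> * I n \<xi> \<partial>lborel) = complex_of_real (\<integral>x. gaussian (?e n) x * (cmod (fourier_ext ?g x))\<^sup>2 \<partial>lborel)"
      unfolding I_def by (rule gaussian_regularised_norm[OF g, symmetric]) auto
    hence "ennreal (norm (\<integral>\<xi>. ?g \<xi> * I n \<xi> \<partial>lborel)) = ennreal (norm (\<integral>x. gaussian (?e n) x * (cmod (fourier_ext ?g x))\<^sup>2 \<partial>lborel))"
      by (simp only: norm_of_real real_norm_def)
    also have "\<dots> \<le> (\<integral>\<^sup>+x. ennreal (norm (gaussian (?e n) x * (cmod (fourier_ext ?g x))\<^sup>2)) \<partial>lborel)"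
      by (rule norm_integral_le_nn_integral)
    also have "\<dots> \<le> sqn (fourier_ext ?g)"
      unfolding sqn_lborel by (intro nn_integral_mono ennreal_leI) (auto simp: gaussian_def intro!: mult_left_le_one_le)
    finally show ?thesis .
  qed
  hence "ennreal (norm (\<integral>\<xi>. ?g \<xi> * complex_of_real ((2*pi) ^ CARD('n)) \<partial>lborel)) \<le> sqn (fourier_ext ?g)"
    by (intro LIMSEQ_le_const2[OF lim']) auto
  moreover have "ennreal (norm (\<integral>\<xi>. ?g \<xi> * complex_of_real ((2*pi) ^ CARD('n)) \<partial>lborel)) = ennreal ((2*pi) ^ CARD('n)) * sqn ?g"
  proof -
    have "(\<integral>\<xi>. ?g \<xi> \<partial>lborel) = complex_of_real (\<integral>\<xi>. indicat_real U \<xi> \<partial>lborel)"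
      unfolding integral_complex_of_real[symmetric] by (intro Bochner_Integration.integral_cong) (auto simp: indicator_def)
    hence "(\<integral>\<xi>. ?g \<xi> \<partial>lborel) = complex_of_real (measure lborel U)" by simp
    moreover have "sqn ?g = (\<integral>\<^sup>+x. indicator U x \<partial>lborel)"
      unfolding sqn_lborel by (intro nn_integral_cong) (auto simp: indicator_def)
    moreover have "emeasure lborel U = ennreal (measure lborel U)" using fin by (simp add: emeasure_eq_ennreal_measure)
    ultimately show ?thesis by (simp add: norm_mult ennreal_mult norm_power mult_ac)
  qed
  ultimately show ?thesis by simp
qed

lemma sqn_0 [simp]: "sqn (\<lambda>x. 0) = 0" by (simp add: L2_norm_sq_def)

lemma sqn_cong_AE: "AE x in lborel. f x = g x \<Longrightarrow> sqn f = sqn g"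
  unfolding sqn_lborel by (rule nn_integral_cong_AE) auto

lemma sqn_mono: "(\<And>x. cmod (f x) \<le> cmod (g x)) \<Longrightarrow> sqn f \<le> sqn g"
  unfolding sqn_lborel by (intro nn_integral_mono ennreal_leI power_mono) auto

lemma sqn_cmult: "f \<in> borel_measurable borel \<Longrightarrow> sqn (\<lambda>x. c * f x) = ennreal ((cmod c)\<^sup>2) * sqn f"
  unfolding sqn_lborel by (subst nn_integral_cmult[symmetric]) (auto simp: norm_mult power_mult_distrib ennreal_mult)

lemma borel_measurable_lebesgueI: "f \<in> borel_measurable borel \<Longrightarrow> f \<in> borel_measurable lebesgue"
  by (rule measurable_completion) simp

text \<open>
  This identity replaces the triangle inequality below: it holds in the extended nonnegative reals
  without any finiteness assumption.
\<close>

lemma sqn_parallelogram: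
  assumes [measurable]: "f \<in> borel_measurable lebesgue" "g \<in> borel_measurable lebesgue"
  shows "sqn (\<lambda>x. f x + g x) + sqn (\<lambda>x. f x - g x) = 2 * sqn f + 2 * sqn g"
proof -
  have "(cmod (a + b))\<^sup>2 + (cmod (a - b))\<^sup>2 = 2 * (cmod a)\<^sup>2 + 2 * (cmod b)\<^sup>2" for a b
    unfolding cmod_power2 by (simp add: power2_eq_square algebra_simps)
  hence eq: "ennreal ((cmod (a + b))\<^sup>2) + ennreal ((cmod (a - b))\<^sup>2) = 2 * ennreal ((cmod a)\<^sup>2) + 2 * ennreal ((cmod b)\<^sup>2)" for a b
    by (simp add: ennreal_plus[symmetric] ennreal_mult'[symmetric] ennreal_numeral[symmetric]
             del: ennreal_plus ennreal_numeral)
  have "sqn (\<lambda>x. f x + g x) + sqn (\<lambda>x. f x - g x)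
      = (\<integral>\<^sup>+x. ennreal ((cmod (f x + g x))\<^sup>2) + ennreal ((cmod (f x - g x))\<^sup>2) \<partial>lebesgue)"
    unfolding L2_norm_sq_def by (rule nn_integral_add[symmetric]) auto
  also have "\<dots> = 2 * sqn f + 2 * sqn g"
    unfolding eq L2_norm_sq_def by (subst nn_integral_add) (auto simp: nn_integral_cmult)
  finally show ?thesis .
qed

lemma sqn_add_le:
  assumes "f \<in> borel_measurable lebesgue" "g \<in> borel_measurable lebesgue"
  shows "sqn (\<lambda>x. f x + g x) \<le> 2 * sqn f + 2 * sqn g"
  using sqn_parallelogram[OF assms] by (metis le_iff_add)

lemma sqn_diff_le:
  assumes "f \<in> borel_measurable lebesgue" "g \<in> borel_measurable lebesgue"
  shows "sqn (\<lambda>x. f x - g x) \<le> 2 * sqn f + 2 * sqn g"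
  using sqn_parallelogram[OF assms] by (metis le_iff_add add.commute)

section \<open>Plancherel's identity\<close>

text \<open>
  Square integrable functions of bounded support are integrable, so that their Fourier integrals
  converge absolutely.
\<close>

definition L2_compact :: "(real ^ 'n \<Rightarrow> complex) set" where
  "L2_compact = {g \<in> borel_measurable borel. sqn g < \<infinity> \<and> (\<exists>R. \<forall>x. norm x > R \<longrightarrow> g x = 0)}"

lemma L2_compactI: "g \<in> borel_measurable borel \<Longrightarrow> sqn g < \<infinity> \<Longrightarrow> (\<And>x. norm x > R \<Longrightarrow> g x = 0) \<Longrightarrow> g \<in> L2_compact"
  unfolding L2_compact_def by auto

lemma L2_compactD:
  assumes "g \<in> L2_compact"
  shows "g \<in> borel_measurable borel" "sqn g < \<infinity>"
  using assms unfolding L2_compact_def by auto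

lemma L2_compact_integrable:
  fixes g :: "real ^ 'n \<Rightarrow> complex"
  assumes "g \<in> L2_compact"
  shows "integrable lborel g"
proof -
  obtain R where g[measurable]: "g \<in> borel_measurable borel" and "sqn g < \<infinity>" and R: "\<And>x. norm x > R \<Longrightarrow> g x = 0"
    using assms unfolding L2_compact_def by auto
  have "(\<integral>\<^sup>+x. ennreal (cmod (g x)) \<partial>lborel) \<le> (\<integral>\<^sup>+x. indicator (cball 0 R) x + ennreal ((cmod (g x))\<^sup>2) \<partial>lborel)"
  proof (intro nn_integral_mono)
    fix x
    have "a \<le> 1 + a\<^sup>2" if "a \<ge> 0" for a :: real
      using sum_squares_bound[of a 1] that by simp
    hence "ennreal (cmod (g x)) \<le> ennreal (1 + (cmod (g x))\<^sup>2)" by (intro ennreal_leI) auto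
    thus "ennreal (cmod (g x)) \<le> indicator (cball 0 R) x + ennreal ((cmod (g x))\<^sup>2)"
      using R[of x] by (cases "norm x > R") (auto simp: indicator_def)
  qed
  also have "\<dots> = emeasure lborel (cball 0 R :: (real^'n) set) + sqn g"
    unfolding sqn_lborel by (subst nn_integral_add) (auto intro!: borel_measurable_indicator)
  also have "\<dots> < \<infinity>" using \<open>sqn g < \<infinity>\<close> emeasure_bounded_finite[of "cball 0 R :: (real^'n) set"] by auto
  finally show ?thesis by (simp add: integrable_iff_bounded)
qed

lemma L2_compact_add:
  assumes "f \<in> L2_compact" "g \<in> L2_compact" shows "(\<lambda>x. f x + g x) \<in> L2_compact"
proof -
  obtain R R' where "\<And>x. norm x > R \<Longrightarrow> f x = 0" "\<And>x. norm x > R' \<Longrightarrow> g x = 0"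
    using assms unfolding L2_compact_def by auto
  moreover have "sqn (\<lambda>x. f x + g x) < \<infinity>"
    using sqn_add_le[OF assms[THEN L2_compactD(1), THEN borel_measurable_lebesgueI]] L2_compactD(2)[OF assms(1)] L2_compactD(2)[OF assms(2)]
    by (auto simp: ennreal_mult_less_top order_le_less_trans)
  ultimately show ?thesis
    using L2_compactD(1)[OF assms(1)] L2_compactD(1)[OF assms(2)]
    by (intro L2_compactI[of _ "max R R'"]) auto
qed

lemma L2_compact_bounded_mult:
  assumes f: "f \<in> L2_compact" and [measurable]: "m \<in> borel_measurable borel" and c: "\<And>x. cmod (m x) \<le> c"
  shows "(\<lambda>x. m x * f x) \<in> L2_compact"
proof -
  obtain R where R: "\<And>x. norm x > R \<Longrightarrow> f x = 0" using f unfolding L2_compact_def by auto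
  have [measurable]: "f \<in> borel_measurable borel" using f by (rule L2_compactD)
  have "c \<ge> 0" using c[of 0] norm_ge_zero[of "m 0"] by linarith
  hence "sqn (\<lambda>x. m x * f x) \<le> sqn (\<lambda>x. of_real c * f x)"
    using c by (intro sqn_mono) (auto simp: norm_mult intro!: mult_right_mono)
  also have "\<dots> < \<infinity>" using L2_compactD(2)[OF f] by (subst sqn_cmult) (auto simp: ennreal_mult_less_top)
  finally show ?thesis using R by (intro L2_compactI[of _ R]) auto
qed

lemma L2_compact_cmult: "f \<in> L2_compact \<Longrightarrow> (\<lambda>x. c * f x) \<in> L2_compact"
  by (rule L2_compact_bounded_mult[of _ _ "cmod c"]) auto

lemma L2_compact_diff:
  assumes "f \<in> L2_compact" "g \<in> L2_compact" shows "(\<lambda>x. f x - g x) \<in> L2_compact"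
  using L2_compact_add[OF assms(1) L2_compact_cmult[OF assms(2), of "-1"]] by simp

lemma fourier_ext_add:
  "integrable lborel f \<Longrightarrow> integrable lborel g \<Longrightarrow> fourier_ext (\<lambda>x. f x + g x) x = fourier_ext f x + fourier_ext g x"
  unfolding fourier_ext_def by (subst Bochner_Integration.integral_add[symmetric]) (auto intro!: integrable_cis_mult simp: distrib_left)

lemma fourier_ext_cmult: "fourier_ext (\<lambda>x. c * f x) x = c * fourier_ext f x"
  unfolding fourier_ext_def by (subst Bochner_Integration.integral_mult_right_zero[symmetric]) (simp add: mult_ac)

lemma fourier_ext_diff:
  assumes "integrable lborel f" "integrable lborel g"
  shows "fourier_ext (\<lambda>x. f x - g x) x = fourier_ext f x - fourier_ext g x"
  using fourier_ext_add[of f "\<lambda>x. (-1) * g x"] assms fourier_ext_cmult[of "-1" g] by simp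

text \<open>
  The functions for which the converse of \<open>plancherel_le\<close> holds. By \<open>plancherel_le\<close> the defect
  \<open>(2 * pi) ^ CARD('n) * sqn g - sqn (fourier_ext g)\<close> is a nonnegative quadratic form, and the null
  set of such a form is a closed subspace.
\<close>

definition plancherel_set :: "(real ^ 'n \<Rightarrow> complex) set" where
  "plancherel_set = {g \<in> L2_compact. ennreal ((2*pi) ^ CARD('n)) * sqn g \<le> sqn (fourier_ext g)}"

lemma ennreal_sum_le_cancel:
  fixes a b c d :: ennreal
  assumes "a + b \<le> c + d" "d \<le> b" "b < \<infinity>"
  shows "a \<le> c"
proof -
  have "a + b \<le> c + b" using assms by (meson add_left_mono order_trans)
  thus ?thesis using assms(3) by (metis ennreal_add_left_cancel_le add.commute infinity_ennreal_def less_irrefl)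
qed

text \<open>
  The parallelogram identity for the defect, with the defect of \<open>u - v\<close> estimated by 0. The first
  statement gives closedness, the second one additivity.
\<close>

lemma plancherel_set_near:
  fixes u v :: "real ^ 'n \<Rightarrow> complex"
  assumes u: "u \<in> plancherel_set" and v: "v \<in> L2_compact"
  shows "ennreal ((2*pi) ^ CARD('n)) * sqn (\<lambda>x. u x + v x) \<le> sqn (fourier_ext (\<lambda>x. u x + v x))
     + 2 * (ennreal ((2*pi) ^ CARD('n)) * sqn v)"
    and "v \<in> plancherel_set \<Longrightarrow> ennreal ((2*pi) ^ CARD('n)) * sqn (\<lambda>x. u x + v x) \<le> sqn (fourier_ext (\<lambda>x. u x + v x))"
proof -
  let ?C = "ennreal ((2*pi) ^ CARD('n))"
  have uL: "u \<in> L2_compact" using u unfolding plancherel_set_def by auto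
  note [measurable] = L2_compactD(1)[OF uL] L2_compactD(1)[OF v]
  note ints = L2_compact_integrable[OF uL] L2_compact_integrable[OF v]
  have d: "(\<lambda>x. u x - v x) \<in> L2_compact" by (rule L2_compact_diff[OF uL v])
  have fin: "?C * sqn (\<lambda>x. u x - v x) < \<infinity>"
    using L2_compactD(2)[OF d] by (auto simp: ennreal_mult_less_top)
  have par: "?C * sqn (\<lambda>x. u x + v x) + ?C * sqn (\<lambda>x. u x - v x) = 2 * (?C * sqn u) + 2 * (?C * sqn v)"
  proof -
    have *: "c * (2 * a + 2 * b) = 2 * (c * a) + 2 * (c * b)" for a b c :: ennreal
      by (simp add: distrib_left mult_ac)
    show ?thesis
      by (subst distrib_left[symmetric], subst sqn_parallelogram[OF L2_compactD(1)[OF uL, THEN borel_measurable_lebesgueI] L2_compactD(1)[OF v, THEN borel_measurable_lebesgueI]], rule *)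
  qed
  have parE: "sqn (fourier_ext (\<lambda>x. u x + v x)) + sqn (fourier_ext (\<lambda>x. u x - v x)) = 2 * sqn (fourier_ext u) + 2 * sqn (fourier_ext v)"
    unfolding fourier_ext_add[OF ints, abs_def] fourier_ext_diff[OF ints, abs_def]
    by (intro sqn_parallelogram borel_measurable_lebesgueI) auto
  have uu: "?C * sqn u \<le> sqn (fourier_ext u)" using u unfolding plancherel_set_def by auto
  have dd: "sqn (fourier_ext (\<lambda>x. u x - v x)) \<le> ?C * sqn (\<lambda>x. u x - v x)"
    by (rule plancherel_le[OF L2_compact_integrable[OF d]])
  have "?C * sqn (\<lambda>x. u x + v x) + ?C * sqn (\<lambda>x. u x - v x) \<le> 2 * sqn (fourier_ext u) + 2 * (?C * sqn v)"
    unfolding par by (intro add_mono mult_left_mono uu) auto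
  also have "\<dots> \<le> 2 * sqn (fourier_ext u) + 2 * sqn (fourier_ext v) + 2 * (?C * sqn v)"
    by (intro add_mono) auto
  also have "\<dots> = (sqn (fourier_ext (\<lambda>x. u x + v x)) + 2 * (?C * sqn v)) + sqn (fourier_ext (\<lambda>x. u x - v x))"
    unfolding parE[symmetric] by (simp add: add_ac)
  finally show "?C * sqn (\<lambda>x. u x + v x) \<le> sqn (fourier_ext (\<lambda>x. u x + v x)) + 2 * (?C * sqn v)"
    by (rule ennreal_sum_le_cancel[OF _ dd fin])
  assume "v \<in> plancherel_set"
  hence vv: "?C * sqn v \<le> sqn (fourier_ext v)" unfolding plancherel_set_def by auto
  have "?C * sqn (\<lambda>x. u x + v x) + ?C * sqn (\<lambda>x. u x - v x) \<le> 2 * sqn (fourier_ext u) + 2 * sqn (fourier_ext v)"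
    unfolding par by (intro add_mono mult_left_mono uu vv) auto
  thus "?C * sqn (\<lambda>x. u x + v x) \<le> sqn (fourier_ext (\<lambda>x. u x + v x))"
    unfolding parE[symmetric] by (rule ennreal_sum_le_cancel[OF _ dd fin])
qed

lemma plancherel_set_add: "u \<in> plancherel_set \<Longrightarrow> v \<in> plancherel_set \<Longrightarrow> (\<lambda>x. u x + v x) \<in> plancherel_set"
  using plancherel_set_near(2)[of u v] L2_compact_add[of u v] by (auto simp: plancherel_set_def)

lemma plancherel_set_cmult:
  assumes "u \<in> plancherel_set" shows "(\<lambda>x. c * u x) \<in> plancherel_set"
proof -
  have u: "u \<in> L2_compact" using assms unfolding plancherel_set_def by auto
  note [measurable] = L2_compactD(1)[OF u]
  have "ennreal ((2*pi) ^ CARD('a)) * sqn u \<le> sqn (fourier_ext u)" using assms unfolding plancherel_set_def by auto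
  from mult_left_mono[OF this, of "ennreal ((cmod c)\<^sup>2)"]
  show ?thesis using L2_compact_cmult[OF u]
    by (auto simp: plancherel_set_def fourier_ext_cmult[abs_def] sqn_cmult mult_ac)
qed

lemma plancherel_set_limit:
  assumes fn: "\<And>n. f n \<in> plancherel_set" and f: "f' \<in> L2_compact"
    and lim: "\<And>x. (\<lambda>n. f n x) \<longlonglongrightarrow> f' x" and dom: "\<And>n x. cmod (f n x) \<le> cmod (f' x)"
  shows "f' \<in> plancherel_set"
proof -
  let ?C = "ennreal ((2*pi) ^ CARD('a))"
  have fL: "f n \<in> L2_compact" for n using fn unfolding plancherel_set_def by auto
  note [measurable] = L2_compactD(1)[OF f] L2_compactD(1)[OF fL]
  have fin: "(\<integral>\<^sup>+x. ennreal (4 * (cmod (f' x))\<^sup>2) \<partial>lborel) < \<infinity>"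
    using L2_compactD(2)[OF f] unfolding sqn_lborel
    by (simp add: ennreal_mult' nn_integral_cmult ennreal_mult_less_top)
  have "(\<lambda>n. \<integral>\<^sup>+x. ennreal ((cmod (f' x - f n x))\<^sup>2) \<partial>lborel) \<longlonglongrightarrow> (\<integral>\<^sup>+x. 0 \<partial>(lborel :: (real^'a) measure))"
  proof (rule nn_integral_dominated_convergence)
    show "(\<integral>\<^sup>+x. ennreal (4 * (cmod (f' x))\<^sup>2) \<partial>lborel) < \<infinity>" by (rule fin)
    show "AE x in lborel. ennreal ((cmod (f' x - f n x))\<^sup>2) \<le> ennreal (4 * (cmod (f' x))\<^sup>2)" for n
    proof (intro AE_I2 ennreal_leI)
      fix x have "cmod (f' x - f n x) \<le> 2 * cmod (f' x)"
        using norm_triangle_ineq4[of "f' x" "f n x"] dom[of n x] by linarith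
      from power_mono[OF this, of 2] show "(cmod (f' x - f n x))\<^sup>2 \<le> 4 * (cmod (f' x))\<^sup>2"
        by (simp add: power_mult_distrib)
    qed
    show "AE x in lborel. (\<lambda>n. ennreal ((cmod (f' x - f n x))\<^sup>2)) \<longlonglongrightarrow> 0"
    proof (intro AE_I2)
      fix x have "(\<lambda>n. ennreal ((cmod (f' x - f n x))\<^sup>2)) \<longlonglongrightarrow> ennreal ((cmod (f' x - f' x))\<^sup>2)"
        by (intro tendsto_ennrealI tendsto_intros lim)
      thus "(\<lambda>n. ennreal ((cmod (f' x - f n x))\<^sup>2)) \<longlonglongrightarrow> 0" by simp
    qed
  qed auto
  hence lim0: "(\<lambda>n. sqn (\<lambda>x. f' x - f n x)) \<longlonglongrightarrow> 0" by (simp add: sqn_lborel)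
  have "(\<lambda>n. sqn (fourier_ext f') + 2 * (?C * sqn (\<lambda>x. f' x - f n x))) \<longlonglongrightarrow> sqn (fourier_ext f') + 2 * (?C * 0)"
    by (intro tendsto_intros ennreal_tendsto_cmult lim0) auto
  hence "?C * sqn f' \<le> sqn (fourier_ext f') + 2 * (?C * 0)"
  proof (rule LIMSEQ_le_const, intro exI allI impI)
    fix n
    show "?C * sqn f' \<le> sqn (fourier_ext f') + 2 * (?C * sqn (\<lambda>x. f' x - f n x))"
      using plancherel_set_near(1)[OF fn[of n] L2_compact_diff[OF f fL[of n]]] by simp
  qed
  thus ?thesis using f by (simp add: plancherel_set_def)
qed

text \<open>
  Dynkin's theorem: open sets form an intersection-stable generator of the Borel sets, and
  complements and disjoint unions are a difference and a limit.
\<close>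

lemma plancherel_set_indicator:
  fixes S :: "(real ^ 'n) set"
  assumes "S \<in> sets borel"
  shows "indicator (S \<inter> ball 0 R) \<in> plancherel_set"
proof -
  have comp: "indicator (S \<inter> ball 0 R) \<in> L2_compact" if "S \<in> sets borel" for S :: "(real ^ 'n) set"
  proof (rule L2_compactI[of _ R])
    show "indicator (S \<inter> ball 0 R) \<in> borel_measurable borel"
      using that by (intro borel_measurable_indicator sets.Int) auto
    have "sqn (indicator (S \<inter> ball 0 R)) = (\<integral>\<^sup>+x. indicator (S \<inter> ball 0 R) x \<partial>lborel)"
      unfolding sqn_lborel by (intro nn_integral_cong) (auto simp: indicator_def)
    also have "\<dots> = emeasure lborel (S \<inter> ball 0 R)" using that by simp
    also have "\<dots> < \<infinity>" by (rule emeasure_bounded_finite) (auto intro: bounded_subset[OF bounded_ball])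
    finally show "sqn (indicator (S \<inter> ball 0 R)) < \<infinity>" .
  qed (auto simp: indicator_def)
  have op: "indicator (S \<inter> ball 0 R) \<in> plancherel_set" if "open S" for S :: "(real ^ 'n) set"
    using plancherel_ge_open[of "S \<inter> ball 0 R"] comp[of S] that
    by (auto simp: plancherel_set_def intro: bounded_subset[OF bounded_ball])
  have "Int_stable {S :: (real ^ 'n) set. open S}" by (auto simp: Int_stable_def)
  moreover have "{S :: (real ^ 'n) set. open S} \<subseteq> Pow UNIV" by auto
  moreover have "S \<in> sigma_sets UNIV {S. open S}" using assms by (simp add: borel_def)
  ultimately show ?thesis
  proof (induction rule: sigma_sets_induct_disjoint)
    case (basic A) thus ?case by (auto intro: op)
  next
    case empty show ?case by (rule op) simp
  next
    case (compl A)
    have "(\<lambda>x. indicator (UNIV \<inter> ball 0 R) x + (-1) * indicator (A \<inter> ball 0 R) x) \<in> plancherel_set"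
      by (intro plancherel_set_add plancherel_set_cmult compl op) auto
    also have "(\<lambda>x. indicator (UNIV \<inter> ball 0 R) x + (-1) * indicator (A \<inter> ball 0 R) x) = (indicator ((UNIV - A) \<inter> ball 0 R) :: _ \<Rightarrow> complex)"
      by (auto simp: indicator_def)
    finally show ?case .
  next
    case (union A)
    have meas: "A i \<in> sets borel" for i using union(2) by (auto simp: borel_def)
    have fin: "indicator ((\<Union>i<n. A i) \<inter> ball 0 R) \<in> plancherel_set" for n
    proof (induction n)
      case 0 show ?case by (rule op) simp
    next
      case (Suc n)
      have "(\<lambda>x. indicator ((\<Union>i<n. A i) \<inter> ball 0 R) x + indicator (A n \<inter> ball 0 R) x) \<in> plancherel_set"
        by (intro plancherel_set_add union Suc)
      also have "(\<lambda>x. indicator ((\<Union>i<n. A i) \<inter> ball 0 R) x + indicator (A n \<inter> ball 0 R) x)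
         = (indicator ((\<Union>i<Suc n. A i) \<inter> ball 0 R) :: _ \<Rightarrow> complex)"
        using union(1) unfolding disjoint_family_on_def
        by (auto simp: indicator_def fun_eq_iff less_Suc_eq) (metis UNIV_I disjoint_iff less_irrefl)+
      finally show ?case .
    qed
    show ?case
    proof (rule plancherel_set_limit[where f = "\<lambda>n. indicator ((\<Union>i<n. A i) \<inter> ball 0 R)"])
      show "indicator (\<Union> (range A) \<inter> ball 0 R) \<in> L2_compact" using meas by (intro comp) auto
      show "(\<lambda>n. indicator ((\<Union>i<n. A i) \<inter> ball 0 R) x) \<longlonglongrightarrow> (indicator (\<Union> (range A) \<inter> ball 0 R) x :: complex)" for x
      proof (cases "x \<in> \<Union> (range A)")
        case True
        then obtain k where "x \<in> A k" by auto
        thus ?thesis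
          by (intro tendsto_eventually eventually_sequentiallyI[of "Suc k"]) (auto simp: indicator_def)
      qed (auto simp: indicator_def)
      show "cmod (indicator ((\<Union>i<n. A i) \<inter> ball 0 R) x) \<le> cmod (indicator (\<Union> (range A) \<inter> ball 0 R) x)" for n x
        by (auto simp: indicator_def)
    qed (rule fin)
  qed
qed

lemma plancherel_set_nonneg:
  fixes u :: "real ^ 'n \<Rightarrow> real"
  assumes "u \<in> borel_measurable borel" "\<And>x. 0 \<le> u x"
  shows "sqn (\<lambda>x. of_real (u x) * indicator (ball 0 R) x) < \<infinity> \<longrightarrow> (\<lambda>x. of_real (u x) * indicator (ball 0 R) x) \<in> plancherel_set"
  using assms
proof (induction rule: borel_measurable_induct_real)
  case (set A)
  have eq: "(\<lambda>x. complex_of_real (indicat_real A x) * indicator (ball 0 R) x) = indicator (A \<inter> ball 0 R)"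
    by (auto simp: indicator_def)
  show ?case unfolding eq using plancherel_set_indicator[OF set, of R] by simp
next
  case (mult u c)
  note [measurable] = \<open>u \<in> borel_measurable borel\<close>
  show ?case
  proof (cases "c = 0")
    case True
    moreover have "(indicator {} :: real^'n \<Rightarrow> complex) = (\<lambda>x. 0)" by auto
    ultimately show ?thesis using plancherel_set_indicator[of "{} :: (real^'n) set" R] True by simp
  next
    case False
    have eq: "(\<lambda>x. complex_of_real (c * u x) * indicator (ball 0 R) x) = (\<lambda>x. of_real c * (of_real (u x) * indicator (ball 0 R) x))"
      by auto
    show ?thesis unfolding eq
    proof
      assume "sqn (\<lambda>x. of_real c * (of_real (u x) * indicator (ball 0 R) x)) < \<infinity>"
      hence "sqn (\<lambda>x. of_real (u x) * indicator (ball 0 R) x) < \<infinity>"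
        using False by (subst (asm) sqn_cmult, measurable) (auto simp: ennreal_mult_less_top)
      thus "(\<lambda>x. of_real c * (of_real (u x) * indicator (ball 0 R) x)) \<in> plancherel_set"
        using mult by (intro plancherel_set_cmult) auto
    qed
  qed
next
  case (add u v)
  have eq: "(\<lambda>x. complex_of_real (v x + u x) * indicator (ball 0 R) x)
     = (\<lambda>x. of_real (v x) * indicator (ball 0 R) x + of_real (u x) * indicator (ball 0 R) x)"
    by (auto simp: distrib_right)
  show ?case
  proof
    assume fin: "sqn (\<lambda>x. complex_of_real (v x + u x) * indicator (ball 0 R) x) < \<infinity>"
    have "sqn (\<lambda>x. of_real (u x) * indicator (ball 0 R) x) \<le> sqn (\<lambda>x. complex_of_real (v x + u x) * indicator (ball 0 R) x)"
      using add by (intro sqn_mono) (auto simp: norm_mult simp flip: of_real_add intro!: mult_right_mono)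
    moreover have "sqn (\<lambda>x. of_real (v x) * indicator (ball 0 R) x) \<le> sqn (\<lambda>x. complex_of_real (v x + u x) * indicator (ball 0 R) x)"
      using add by (intro sqn_mono) (auto simp: norm_mult simp flip: of_real_add intro!: mult_right_mono)
    ultimately have "(\<lambda>x. of_real (u x) * indicator (ball 0 R) x) \<in> plancherel_set"
      "(\<lambda>x. of_real (v x) * indicator (ball 0 R) x) \<in> plancherel_set"
      using add.IH fin by (meson order_le_less_trans)+
    thus "(\<lambda>x. complex_of_real (v x + u x) * indicator (ball 0 R) x) \<in> plancherel_set"
      unfolding eq by (intro plancherel_set_add)
  qed
next
  case (seq U)
  have le: "U n x \<le> u x" for n x
  proof (rule incseq_le)
    show "incseq (\<lambda>n. U n x)" using \<open>incseq U\<close> by (simp add: incseq_def le_fun_def)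
    show "(\<lambda>n. U n x) \<longlonglongrightarrow> u x" using seq by auto
  qed
  have nn: "0 \<le> U n x" "0 \<le> u x" for n x using seq le[of n x] by (meson order_trans)+
  have dom: "cmod (of_real (U n x) * indicator (ball 0 R) x) \<le> cmod (of_real (u x) * indicator (ball 0 R) x)" for n x
    using le[of n x] nn(1)[of n x] nn(2)[of x] by (auto simp: norm_mult intro!: mult_right_mono)
  have [measurable]: "u \<in> borel_measurable borel"
    by (rule borel_measurable_LIMSEQ_real[of _ U]) (use seq in auto)
  show ?case
  proof
    assume fin: "sqn (\<lambda>x. of_real (u x) * indicator (ball 0 R) x) < \<infinity>"
    show "(\<lambda>x. of_real (u x) * indicator (ball 0 R) x) \<in> plancherel_set"
    proof (rule plancherel_set_limit[where f = "\<lambda>n x. of_real (U n x) * indicator (ball 0 R) x"])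
      show "(\<lambda>x. of_real (U n x) * indicator (ball 0 R) x) \<in> plancherel_set" for n
      proof -
        have "sqn (\<lambda>x. of_real (U n x) * indicator (ball 0 R) x) < \<infinity> \<longrightarrow> (\<lambda>x. of_real (U n x) * indicator (ball 0 R) x) \<in> plancherel_set"
          using seq by blast
        thus ?thesis using order_le_less_trans[OF sqn_mono[OF dom[of n]] fin] by blast
      qed
      show "(\<lambda>x. of_real (u x) * indicator (ball 0 R) x) \<in> L2_compact"
        by (rule L2_compactI[of _ R]) (use fin in \<open>auto simp: indicator_def\<close>)
      show "(\<lambda>n. of_real (U n x) * indicator (ball 0 R) x) \<longlonglongrightarrow> complex_of_real (u x) * indicator (ball 0 R) x" for x
        by (intro tendsto_intros seq) auto
    qed (rule dom)
  qed
qed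

theorem plancherel:
  fixes g :: "real ^ 'n \<Rightarrow> complex"
  assumes "g \<in> L2_compact"
  shows "sqn (fourier_ext g) = ennreal ((2*pi) ^ CARD('n)) * sqn g"
proof -
  obtain R where g[measurable]: "g \<in> borel_measurable borel" and fin: "sqn g < \<infinity>" and R: "\<And>x. norm x > R \<Longrightarrow> g x = 0"
    using assms unfolding L2_compact_def by auto
  let ?B = "indicator (ball 0 (R + 1)) :: real^'n \<Rightarrow> complex"
  have part: "(\<lambda>x. of_real (p x) * ?B x) \<in> plancherel_set"
    if [measurable]: "p \<in> borel_measurable borel" and p: "\<And>x. 0 \<le> p x" "\<And>x. p x \<le> cmod (g x)" for p :: "real ^ 'n \<Rightarrow> real"
  proof -
    have "sqn (\<lambda>x. of_real (p x) * ?B x) \<le> sqn g"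
      using p by (intro sqn_mono) (auto simp: norm_mult indicator_def)
    thus ?thesis using plancherel_set_nonneg[of p "R + 1"] p fin by (auto intro: order_le_less_trans)
  qed
  let ?f = "\<lambda>x. (of_real (max 0 (Re (g x))) * ?B x + (-1) * (of_real (max 0 (- Re (g x))) * ?B x))
     + \<i> * (of_real (max 0 (Im (g x))) * ?B x + (-1) * (of_real (max 0 (- Im (g x))) * ?B x))"
  have "?f \<in> plancherel_set"
    using abs_Re_le_cmod abs_Im_le_cmod
    by (intro plancherel_set_add plancherel_set_cmult part) (auto simp: abs_le_iff)
  also have "?f = g"
  proof
    fix x show "?f x = g x"
      using R[of x] by (cases "norm x > R") (auto simp: indicator_def complex_eq_iff max_def)
  qed
  finally have "ennreal ((2*pi) ^ CARD('n)) * sqn g \<le> sqn (fourier_ext g)" by (simp add: plancherel_set_def)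
  with plancherel_le[OF L2_compact_integrable[OF assms]] show ?thesis by (rule antisym)
qed

lemma cball_sets_borel [measurable]: "cball c R \<in> sets (borel :: ('a :: metric_space) measure)"
  by (intro borel_closed closed_cball)

section \<open>The Fourier integral on square integrable functions\<close>

lemma sqn_zero_AE:
  assumes [measurable]: "f \<in> borel_measurable lebesgue" and "sqn f = 0"
  shows "AE x in lebesgue. f x = 0"
  using assms(2) unfolding L2_norm_sq_def by (subst (asm) nn_integral_0_iff_AE) auto

lemma sqn_reflect:
  assumes [measurable]: "f \<in> borel_measurable borel"
  shows "sqn (\<lambda>x. f (- x)) = sqn f"
  unfolding sqn_lborel by (subst (2) lborel_nn_scale[where c="-1" and t=0]) auto

lemma L2_limit_unique:
  assumes "L2_limit G g" "L2_limit G g'" and G: "\<And>R. G R \<in> borel_measurable lebesgue"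
  shows "AE x in lebesgue. g x = g' x"
proof -
  have [measurable]: "g \<in> borel_measurable lebesgue" "g' \<in> borel_measurable lebesgue"
    using assms(1,2) by (auto simp: L2_limit_def L2_space_def)
  note [measurable] = G
  have "((\<lambda>R. 2 * sqn (\<lambda>x. G R x - g' x) + 2 * sqn (\<lambda>x. G R x - g x)) \<longlongrightarrow> 2 * 0 + 2 * 0) at_top"
    using assms(1,2) unfolding L2_limit_def by (intro tendsto_intros ennreal_tendsto_cmult) auto
  moreover have "sqn (\<lambda>x. g x - g' x) \<le> 2 * sqn (\<lambda>x. G R x - g' x) + 2 * sqn (\<lambda>x. G R x - g x)" for R
    using sqn_diff_le[of "\<lambda>x. G R x - g' x" "\<lambda>x. G R x - g x"] by simp
  ultimately have "sqn (\<lambda>x. g x - g' x) \<le> 2 * 0 + 2 * 0"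
    by (intro tendsto_lowerbound[of _ "2 * 0 + 2 * 0" at_top]) auto
  hence "sqn (\<lambda>x. g x - g' x) = 0" by simp
  hence "AE x in lebesgue. g x - g' x = 0" by (intro sqn_zero_AE) auto
  thus ?thesis by simp
qed

definition trunc :: "real \<Rightarrow> (real ^ 'n \<Rightarrow> complex) \<Rightarrow> real ^ 'n \<Rightarrow> complex" where
  "trunc R F = (\<lambda>\<xi>. indicator (cball 0 R) \<xi> * F \<xi>)"

definition L2_borel :: "(real ^ 'n \<Rightarrow> complex) set" where
  "L2_borel = {F \<in> borel_measurable borel. sqn F < \<infinity>}"

lemma L2_borelD: "F \<in> L2_borel \<Longrightarrow> F \<in> borel_measurable borel" "F \<in> L2_borel \<Longrightarrow> sqn F < \<infinity>"
  by (auto simp: L2_borel_def)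

lemma L2_borel_space: "F \<in> L2_borel \<Longrightarrow> F \<in> L2_space"
  by (auto simp: L2_borel_def L2_space_def intro: borel_measurable_lebesgueI)

lemma L2_compact_borel: "F \<in> L2_compact \<Longrightarrow> F \<in> L2_borel"
  by (auto simp: L2_borel_def L2_compact_def)

lemma L2_borel_diff: "F \<in> L2_borel \<Longrightarrow> G \<in> L2_borel \<Longrightarrow> (\<lambda>x. F x - G x) \<in> L2_borel"
  by (auto simp: L2_borel_def ennreal_mult_less_top
      intro!: order_le_less_trans[OF sqn_diff_le[of F G]] borel_measurable_lebesgueI)

lemma L2_borel_add: "F \<in> L2_borel \<Longrightarrow> G \<in> L2_borel \<Longrightarrow> (\<lambda>x. F x + G x) \<in> L2_borel"
  by (auto simp: L2_borel_def ennreal_mult_less_top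
      intro!: order_le_less_trans[OF sqn_add_le[of F G]] borel_measurable_lebesgueI)

lemma L2_borel_bounded_mult:
  assumes f: "f \<in> L2_borel" and [measurable]: "m \<in> borel_measurable borel" and c: "\<And>x. cmod (m x) \<le> c"
  shows "(\<lambda>x. m x * f x) \<in> L2_borel"
proof -
  have [measurable]: "f \<in> borel_measurable borel" using f by (rule L2_borelD)
  have "c \<ge> 0" using c[of 0] norm_ge_zero[of "m 0"] by linarith
  hence "sqn (\<lambda>x. m x * f x) \<le> sqn (\<lambda>x. of_real c * f x)"
    using c by (intro sqn_mono) (auto simp: norm_mult intro!: mult_right_mono)
  also have "\<dots> < \<infinity>" using L2_borelD(2)[OF f] by (subst sqn_cmult) (auto simp: ennreal_mult_less_top)
  finally show ?thesis by (auto simp: L2_borel_def)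
qed

lemma trunc_measurable [measurable]: "F \<in> borel_measurable borel \<Longrightarrow> trunc R F \<in> borel_measurable borel"
  unfolding trunc_def by measurable

lemma trunc_L2_compact:
  assumes "F \<in> L2_borel" shows "trunc R F \<in> L2_compact"
proof (rule L2_compactI[of _ R])
  have [measurable]: "F \<in> borel_measurable borel" using assms by (rule L2_borelD)
  show "trunc R F \<in> borel_measurable borel" by measurable
  have "sqn (trunc R F) \<le> sqn F" by (rule sqn_mono) (auto simp: trunc_def indicator_def)
  thus "sqn (trunc R F) < \<infinity>" using L2_borelD(2)[OF assms] by (rule order_le_less_trans)
qed (auto simp: trunc_def indicator_def)

lemma trunc_tail:
  assumes "F \<in> L2_borel"
  shows "((\<lambda>R. sqn (\<lambda>x. trunc R F x - F x)) \<longlongrightarrow> 0) at_top"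
proof (rule tendsto_at_topI_sequentially)
  fix X :: "nat \<Rightarrow> real" assume X: "filterlim X at_top sequentially"
  have [measurable]: "F \<in> borel_measurable borel" using assms by (rule L2_borelD)
  have "(\<lambda>n. \<integral>\<^sup>+x. ennreal ((cmod (trunc (X n) F x - F x))\<^sup>2) \<partial>lborel) \<longlonglongrightarrow> (\<integral>\<^sup>+x. 0 \<partial>(lborel :: (real^'a) measure))"
  proof (rule nn_integral_dominated_convergence)
    show "(\<integral>\<^sup>+x. ennreal ((cmod (F x))\<^sup>2) \<partial>lborel) < \<infinity>" using L2_borelD(2)[OF assms] by (simp add: sqn_lborel)
    show "AE x in lborel. ennreal ((cmod (trunc (X n) F x - F x))\<^sup>2) \<le> ennreal ((cmod (F x))\<^sup>2)" for n
      by (intro AE_I2 ennreal_leI) (auto simp: trunc_def indicator_def)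
    show "AE x in lborel. (\<lambda>n. ennreal ((cmod (trunc (X n) F x - F x))\<^sup>2)) \<longlonglongrightarrow> 0"
    proof (intro AE_I2 tendsto_eventually)
      fix x :: "real^'a"
      have "\<forall>\<^sub>F n in sequentially. norm x \<le> X n" using X unfolding filterlim_at_top by auto
      thus "\<forall>\<^sub>F n in sequentially. ennreal ((cmod (trunc (X n) F x - F x))\<^sup>2) = 0"
        by eventually_elim (auto simp: trunc_def indicator_def)
    qed
  qed auto
  thus "(\<lambda>n. sqn (\<lambda>x. trunc (X n) F x - F x)) \<longlonglongrightarrow> 0" by (simp add: sqn_lborel)
qed

text \<open>
  The relation between \<open>F\<close> and a representative of the \<open>L\<^sup>2\<close> limit of its truncated Fourier integrals.
  A relation is used, as the limit is determined only up to null sets.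
\<close>

definition is_ext :: "(real ^ 'n \<Rightarrow> complex) \<Rightarrow> (real ^ 'n \<Rightarrow> complex) \<Rightarrow> bool" where
  "is_ext F u \<longleftrightarrow> L2_limit (\<lambda>R. fourier_ext (trunc R F)) u"

lemma is_extD:
  assumes "is_ext F u"
  shows "u \<in> L2_space" "u \<in> borel_measurable lebesgue" "sqn u < \<infinity>"
    "((\<lambda>R. sqn (\<lambda>x. fourier_ext (trunc R F) x - u x)) \<longlongrightarrow> 0) at_top"
  using assms by (auto simp: is_ext_def L2_limit_def L2_space_def)

lemma is_extI:
  assumes "u \<in> borel_measurable lebesgue" "sqn u < \<infinity>"
    "((\<lambda>R. sqn (\<lambda>x. fourier_ext (trunc R F) x - u x)) \<longlongrightarrow> 0) at_top"
  shows "is_ext F u"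
  using assms by (auto simp: is_ext_def L2_limit_def L2_space_def)

lemma fourier_ext_leb [measurable]:
  "F \<in> borel_measurable borel \<Longrightarrow> fourier_ext F \<in> borel_measurable lebesgue"
  by (intro borel_measurable_lebesgueI fourier_ext_measurable)

lemma is_ext_unique:
  assumes "is_ext F u" "is_ext F v" "F \<in> borel_measurable borel"
  shows "AE x in lebesgue. u x = v x"
  using assms unfolding is_ext_def by (intro L2_limit_unique[of _ u v]) auto

text \<open>
  The factor 2 is lost by passing to the limit with \<open>sqn_diff_le\<close>.
\<close>

lemma is_ext_norm:
  fixes F :: "real ^ 'n \<Rightarrow> complex"
  assumes "is_ext F u" and F: "F \<in> L2_borel"
  shows "sqn u \<le> 2 * (ennreal ((2*pi) ^ CARD('n)) * sqn F)"
proof -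
  note [measurable] = is_extD(2)[OF assms(1)] L2_borelD(1)[OF F]
  let ?C = "ennreal ((2*pi) ^ CARD('n))"
  have "((\<lambda>R. 2 * (?C * sqn F) + 2 * sqn (\<lambda>x. fourier_ext (trunc R F) x - u x)) \<longlongrightarrow> 2 * (?C * sqn F) + 2 * 0) at_top"
    by (intro tendsto_intros ennreal_tendsto_cmult is_extD(4)[OF assms(1)]) auto
  moreover have "sqn u \<le> 2 * (?C * sqn F) + 2 * sqn (\<lambda>x. fourier_ext (trunc R F) x - u x)" for R
  proof -
    have "sqn u \<le> 2 * sqn (fourier_ext (trunc R F)) + 2 * sqn (\<lambda>x. fourier_ext (trunc R F) x - u x)"
      using sqn_diff_le[of "fourier_ext (trunc R F)" "\<lambda>x. fourier_ext (trunc R F) x - u x"] by simp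
    also have "sqn (fourier_ext (trunc R F)) = ?C * sqn (trunc R F)"
      by (rule plancherel[OF trunc_L2_compact[OF F]])
    also have "2 * (?C * sqn (trunc R F)) \<le> 2 * (?C * sqn F)"
      by (intro mult_left_mono sqn_mono) (auto simp: trunc_def indicator_def)
    finally show ?thesis by (simp add: add_right_mono)
  qed
  ultimately have "sqn u \<le> 2 * (?C * sqn F) + 2 * 0"
    by (intro tendsto_lowerbound[of _ "2 * (?C * sqn F) + 2 * 0" at_top]) auto
  thus ?thesis by simp
qed

lemma is_ext_diff:
  assumes "is_ext F u" "is_ext G v" and F: "F \<in> L2_borel" and G: "G \<in> L2_borel"
  shows "is_ext (\<lambda>x. F x - G x) (\<lambda>x. u x - v x)"
proof (rule is_extI)
  note [measurable] = is_extD(2)[OF assms(1)] is_extD(2)[OF assms(2)] L2_borelD(1)[OF F] L2_borelD(1)[OF G]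
  show "(\<lambda>x. u x - v x) \<in> borel_measurable lebesgue" by measurable
  show "sqn (\<lambda>x. u x - v x) < \<infinity>"
    using is_extD(3)[OF assms(1)] is_extD(3)[OF assms(2)]
    by (intro order_le_less_trans[OF sqn_diff_le]) (auto simp: ennreal_mult_less_top)
  have "((\<lambda>R. 2 * sqn (\<lambda>x. fourier_ext (trunc R F) x - u x) + 2 * sqn (\<lambda>x. fourier_ext (trunc R G) x - v x)) \<longlongrightarrow> 2 * 0 + 2 * 0) at_top"
    by (intro tendsto_intros ennreal_tendsto_cmult is_extD(4)[OF assms(1)] is_extD(4)[OF assms(2)]) auto
  hence lim: "((\<lambda>R. 2 * sqn (\<lambda>x. fourier_ext (trunc R F) x - u x) + 2 * sqn (\<lambda>x. fourier_ext (trunc R G) x - v x)) \<longlongrightarrow> 0) at_top"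
    by simp
  show "((\<lambda>R. sqn (\<lambda>x. fourier_ext (trunc R (\<lambda>x. F x - G x)) x - (u x - v x))) \<longlongrightarrow> 0) at_top"
  proof (rule tendsto_sandwich[OF _ _ tendsto_const lim])
    show "\<forall>\<^sub>F R in at_top. sqn (\<lambda>x. fourier_ext (trunc R (\<lambda>x. F x - G x)) x - (u x - v x))
      \<le> 2 * sqn (\<lambda>x. fourier_ext (trunc R F) x - u x) + 2 * sqn (\<lambda>x. fourier_ext (trunc R G) x - v x)"
    proof (intro always_eventually allI)
      fix R
      have eq: "trunc R (\<lambda>x. F x - G x) = (\<lambda>x. trunc R F x - trunc R G x)"
        by (auto simp: trunc_def right_diff_distrib)
      have "fourier_ext (trunc R (\<lambda>x. F x - G x)) x = fourier_ext (trunc R F) x - fourier_ext (trunc R G) x" for x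
        unfolding eq
        by (subst fourier_ext_diff) (auto intro: L2_compact_integrable trunc_L2_compact F G)
      hence eq2: "(\<lambda>x. fourier_ext (trunc R (\<lambda>x. F x - G x)) x - (u x - v x))
        = (\<lambda>x. (fourier_ext (trunc R F) x - u x) - (fourier_ext (trunc R G) x - v x))" by auto
      show "sqn (\<lambda>x. fourier_ext (trunc R (\<lambda>x. F x - G x)) x - (u x - v x))
      \<le> 2 * sqn (\<lambda>x. fourier_ext (trunc R F) x - u x) + 2 * sqn (\<lambda>x. fourier_ext (trunc R G) x - v x)"
        unfolding eq2 by (rule sqn_diff_le) measurable
    qed
  qed auto
qed

lemma is_ext_compact:
  fixes F :: "real ^ 'n \<Rightarrow> complex"
  assumes F: "F \<in> L2_compact"
  shows "is_ext F (fourier_ext F)"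
proof (rule is_extI)
  obtain R0 where R0: "\<And>x. norm x > R0 \<Longrightarrow> F x = 0" using F by (auto simp: L2_compact_def)
  note [measurable] = L2_compactD(1)[OF F]
  show "fourier_ext F \<in> borel_measurable lebesgue" by measurable
  show "sqn (fourier_ext F) < \<infinity>"
    using plancherel[OF F] L2_compactD(2)[OF F] by (simp add: ennreal_mult_less_top)
  show "((\<lambda>R. sqn (\<lambda>x. fourier_ext (trunc R F) x - fourier_ext F x)) \<longlongrightarrow> 0) at_top"
  proof (rule tendsto_eventually, rule eventually_at_top_linorderI)
    fix R assume "R \<ge> R0"
    hence "trunc R F = F" using R0 by (force simp: trunc_def indicator_def fun_eq_iff)
    thus "sqn (\<lambda>x. fourier_ext (trunc R F) x - fourier_ext F x) = 0" by simp
  qed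
qed

lemma fourier_ext_cong_AE:
  assumes [measurable]: "F \<in> borel_measurable borel" "G \<in> borel_measurable borel"
    and "AE x in lborel. F x = G x"
  shows "fourier_ext F x = fourier_ext G x"
  unfolding fourier_ext_def by (rule integral_cong_AE) (use assms(3) in auto)

lemma is_ext_cong_AE:
  assumes "is_ext F u" and [measurable]: "F \<in> borel_measurable borel" "G \<in> borel_measurable borel"
    and FG: "AE x in lborel. F x = G x"
    and [measurable]: "v \<in> borel_measurable lebesgue" and uv: "AE x in lebesgue. u x = v x"
  shows "is_ext G v"
proof (rule is_extI)
  show "v \<in> borel_measurable lebesgue" by fact
  have uv': "AE x in lborel. u x = v x" using uv by (simp add: AE_completion_iff)
  show "sqn v < \<infinity>" using is_extD(3)[OF assms(1)] sqn_cong_AE[OF uv'] by simp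
  have "sqn (\<lambda>x. fourier_ext (trunc R G) x - v x) = sqn (\<lambda>x. fourier_ext (trunc R F) x - u x)" for R
  proof (rule sqn_cong_AE)
    have "fourier_ext (trunc R G) x = fourier_ext (trunc R F) x" for x
      by (rule fourier_ext_cong_AE) (use FG in \<open>auto simp: trunc_def\<close>)
    thus "AE x in lborel. fourier_ext (trunc R G) x - v x = fourier_ext (trunc R F) x - u x"
      using uv' by auto
  qed
  thus "((\<lambda>R. sqn (\<lambda>x. fourier_ext (trunc R G) x - v x)) \<longlongrightarrow> 0) at_top"
    using is_extD(4)[OF assms(1)] by simp
qed

lemma nn_integral_suminf_finite_AE:
  fixes Y :: "nat \<Rightarrow> 'a \<Rightarrow> ennreal"
  assumes [measurable]: "\<And>k. Y k \<in> borel_measurable M" and fin: "(\<Sum>k. \<integral>\<^sup>+x. Y k x \<partial>M) < \<infinity>"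
  shows "AE x in M. (\<Sum>k. Y k x) < \<infinity>"
proof -
  have "(\<integral>\<^sup>+x. (\<Sum>k. Y k x) \<partial>M) < \<infinity>" using fin by (subst nn_integral_suminf) auto
  hence "AE x in M. (\<Sum>k. Y k x) \<noteq> \<infinity>" by (intro nn_integral_PInf_AE) auto
  thus ?thesis by (simp add: less_top)
qed

lemma ennreal_le_suminf: "f k \<le> (\<Sum>k. f k :: ennreal)"
  using sum_le_suminf[of f "{k}"] by simp

lemma ennreal_geometric:
  assumes "0 \<le> c" "c < 1"
  shows "(\<Sum>k. ennreal (c ^ k)) = ennreal (1 / (1 - c))"
  using assms by (subst suminf_ennreal2) (auto simp: suminf_geometric summable_geometric)

lemma summable_of_weighted_squares:
  fixes g :: "nat \<Rightarrow> complex"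
  assumes "\<And>k. 2 ^ k * (cmod (g k))\<^sup>2 \<le> s"
  shows "summable g"
proof -
  have s: "s \<ge> 0" using assms[of 0] by (simp, meson order_trans zero_le_power2)
  have bd: "cmod (g k) \<le> sqrt s * (1 / sqrt 2) ^ k" for k
  proof -
    have "(cmod (g k))\<^sup>2 \<le> s * (1/2) ^ k" using assms[of k] by (simp add: field_simps power_divide)
    also have "\<dots> = (sqrt s * (1 / sqrt 2) ^ k)\<^sup>2"
    proof -
      have "((1 / sqrt 2) ^ k)\<^sup>2 = ((1 / sqrt 2)\<^sup>2) ^ k" by (simp only: power_mult[symmetric] mult.commute)
      also have "\<dots> = (1 / 2) ^ k" by (simp add: power_divide)
      finally show ?thesis using s by (simp add: power_mult_distrib)
    qed
    finally show ?thesis by (rule power2_le_imp_le) (use s in auto)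
  qed
  show ?thesis
  proof (rule summable_comparison_test')
    show "summable (\<lambda>k. sqrt s * (1 / sqrt 2) ^ k)"
      by (intro summable_mult summable_geometric) simp
  qed (rule bd)
qed

text \<open>
  With the weights \<open>2 ^ k\<close> the squared increments still have a finite sum of integrals, so that almost
  everywhere they are summable even after taking square roots.
\<close>

lemma L2_fast_cauchy_limit:
  fixes U :: "nat \<Rightarrow> real ^ 'n \<Rightarrow> complex"
  assumes U[measurable]: "\<And>k. U k \<in> borel_measurable borel"
    and fast: "\<And>k. sqn (\<lambda>x. U (Suc k) x - U k x) \<le> ennreal c * ennreal ((1/8) ^ k)"
  shows "AE x in lborel. convergent (\<lambda>k. U k x)"
proof -
  have "(\<Sum>k. \<integral>\<^sup>+x. ennreal (2 ^ k) * ennreal ((cmod (U (Suc k) x - U k x))\<^sup>2) \<partial>lborel)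
      \<le> (\<Sum>k. ennreal c * ennreal ((1/4) ^ k))"
  proof (rule suminf_le)
    fix k
    have "(\<integral>\<^sup>+x. ennreal (2 ^ k) * ennreal ((cmod (U (Suc k) x - U k x))\<^sup>2) \<partial>lborel)
       = ennreal (2 ^ k) * sqn (\<lambda>x. U (Suc k) x - U k x)"
      unfolding sqn_lborel by (rule nn_integral_cmult) measurable
    also have "\<dots> \<le> ennreal (2 ^ k) * (ennreal c * ennreal ((1/8) ^ k))"
      by (intro mult_left_mono fast) auto
    also have "\<dots> = ennreal c * (ennreal (2 ^ k) * ennreal ((1/8) ^ k))" by (simp add: mult_ac)
    also have "ennreal (2 ^ k) * ennreal ((1/8) ^ k) = ennreal ((1/4) ^ k)"
      by (subst ennreal_mult[symmetric]) (auto simp: power_mult_distrib[symmetric])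
    finally show "(\<integral>\<^sup>+x. ennreal (2 ^ k) * ennreal ((cmod (U (Suc k) x - U k x))\<^sup>2) \<partial>lborel) \<le> ennreal c * ennreal ((1/4) ^ k)" .
  qed auto
  also have "\<dots> = ennreal c * ennreal (1 / (1 - 1/4))"
    by (subst ennreal_suminf_cmult, subst ennreal_geometric) auto
  also have "\<dots> < \<infinity>" by (simp add: ennreal_mult_less_top)
  finally have "AE x in lborel. (\<Sum>k. ennreal (2 ^ k) * ennreal ((cmod (U (Suc k) x - U k x))\<^sup>2)) < \<infinity>"
    by (intro nn_integral_suminf_finite_AE) auto
  thus ?thesis
  proof eventually_elim
    case (elim x)
    define S where "S = (\<Sum>k. ennreal (2 ^ k) * ennreal ((cmod (U (Suc k) x - U k x))\<^sup>2))"
    obtain s where s: "S = ennreal s" "s \<ge> 0" using elim unfolding S_def[symmetric] by (cases S) auto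
    have "2 ^ k * (cmod (U (Suc k) x - U k x))\<^sup>2 \<le> s" for k
    proof -
      have "ennreal (2 ^ k * (cmod (U (Suc k) x - U k x))\<^sup>2) \<le> ennreal s"
        using ennreal_le_suminf[of "\<lambda>k. ennreal (2 ^ k) * ennreal ((cmod (U (Suc k) x - U k x))\<^sup>2)" k] s(1)
        unfolding S_def[symmetric] by (simp add: ennreal_mult)
      thus ?thesis using s(2) by simp
    qed
    hence "summable (\<lambda>k. U (Suc k) x - U k x)" by (rule summable_of_weighted_squares)
    hence "convergent (\<lambda>n. \<Sum>k<n. U (Suc k) x - U k x)" by (simp add: summable_iff_convergent)
    hence "convergent (\<lambda>n. U n x - U 0 x)" by (simp add: sum_lessThan_telescope[of "\<lambda>k. U k x"])
    hence "convergent (\<lambda>n. (U n x - U 0 x) + U 0 x)" by (intro convergent_add convergent_const)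
    thus "convergent (\<lambda>k. U k x)" by simp
  qed
qed

text \<open>
  Riesz and Fischer: a subsequence of radii with geometrically small tails converges almost everywhere,
  and Fatou's lemma shows that the limit is the \<open>L\<^sup>2\<close> limit along all radii.
\<close>

lemma is_ext_exists:
  fixes F :: "real ^ 'n \<Rightarrow> complex"
  assumes F: "F \<in> L2_borel"
  obtains u where "is_ext F u" "u \<in> L2_borel"
proof -
  let ?C = "ennreal ((2*pi) ^ CARD('n))"
  note [measurable] = L2_borelD(1)[OF F]
  let ?tail = "\<lambda>R. sqn (\<lambda>x. trunc R F x - F x)"
  \<comment> \<open>Tails below \<open>(1/8) ^ k\<close> survive the weights \<open>2 ^ k\<close> of the fast Cauchy criterion with room to spare.\<close>
  have "\<exists>R. ?tail R < ennreal ((1/8) ^ k)" for k :: nat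
  proof -
    have "\<forall>\<^sub>F R in at_top. ?tail R < ennreal ((1/8) ^ k)"
      by (rule order_tendstoD(2)[OF trunc_tail[OF F]]) simp
    thus ?thesis by (auto simp: eventually_at_top_linorder)
  qed
  then obtain \<rho> where \<rho>: "\<And>k::nat. ?tail (\<rho> k) < ennreal ((1/8) ^ k)" by metis
  have dist: "sqn (\<lambda>x. fourier_ext (trunc R F) x - fourier_ext (trunc R' F) x) \<le> ?C * (2 * ?tail R + 2 * ?tail R')" for R R'
  proof -
    have "sqn (\<lambda>x. fourier_ext (trunc R F) x - fourier_ext (trunc R' F) x)
        = sqn (fourier_ext (\<lambda>x. trunc R F x - trunc R' F x))"
      by (intro arg_cong[where f = sqn] ext fourier_ext_diff[symmetric] L2_compact_integrable trunc_L2_compact F)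
    also have "\<dots> = ?C * sqn (\<lambda>x. trunc R F x - trunc R' F x)"
      by (intro plancherel L2_compact_diff trunc_L2_compact F)
    also have "sqn (\<lambda>x. trunc R F x - trunc R' F x) = sqn (\<lambda>x. (trunc R F x - F x) - (trunc R' F x - F x))" by simp
    also have "\<dots> \<le> 2 * ?tail R + 2 * ?tail R'" by (intro sqn_diff_le borel_measurable_lebesgueI) measurable
    finally show ?thesis by (simp add: mult_left_mono)
  qed
  define U where "U k = fourier_ext (trunc (\<rho> k) F)" for k
  have [measurable]: "U k \<in> borel_measurable borel" for k unfolding U_def by measurable
  have conv: "AE x in lborel. convergent (\<lambda>k. U k x)"
  proof (rule L2_fast_cauchy_limit)
    fix k
    have "sqn (\<lambda>x. U (Suc k) x - U k x) \<le> ?C * (2 * ?tail (\<rho> (Suc k)) + 2 * ?tail (\<rho> k))"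
      unfolding U_def by (rule dist)
    also have "\<dots> \<le> ?C * (2 * ennreal ((1/8) ^ k) + 2 * ennreal ((1/8) ^ k))"
    proof (intro mult_left_mono add_mono)
      have "ennreal ((1/8) ^ Suc k) \<le> ennreal ((1/8) ^ k)" by (intro ennreal_leI power_decreasing) auto
      thus "?tail (\<rho> (Suc k)) \<le> ennreal ((1/8) ^ k)" using \<rho>[of "Suc k"] by (meson less_imp_le order_trans)
      show "?tail (\<rho> k) \<le> ennreal ((1/8) ^ k)" using \<rho>[of k] by simp
    qed auto
    also have "\<dots> = ennreal (4 * (2*pi) ^ CARD('n)) * ennreal ((1/8) ^ k)"
    proof -
      have "c * (2 * a + 2 * a) = 4 * c * a" for a c :: ennreal
        unfolding distrib_right[symmetric] by (simp add: mult_ac)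
      thus ?thesis by (simp add: ennreal_mult)
    qed
    finally show "sqn (\<lambda>x. U (Suc k) x - U k x) \<le> ennreal (4 * (2*pi) ^ CARD('n)) * ennreal ((1/8) ^ k)" .
  qed auto
  define u where "u x = lim (\<lambda>k. U k x)" for x
  have [measurable]: "u \<in> borel_measurable borel" unfolding u_def by (rule borel_measurable_lim_metric) measurable
  have close: "sqn (\<lambda>x. fourier_ext (trunc R F) x - u x) \<le> ?C * (2 * ?tail R)" for R
  proof -
    have "sqn (\<lambda>x. fourier_ext (trunc R F) x - u x)
       = (\<integral>\<^sup>+x. liminf (\<lambda>k. ennreal ((cmod (fourier_ext (trunc R F) x - U k x))\<^sup>2)) \<partial>lborel)"
      unfolding sqn_lborel
    proof (rule nn_integral_cong_AE, use conv in eventually_elim)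
      case (elim x)
      have "(\<lambda>k. ennreal ((cmod (fourier_ext (trunc R F) x - U k x))\<^sup>2)) \<longlonglongrightarrow> ennreal ((cmod (fourier_ext (trunc R F) x - u x))\<^sup>2)"
        using elim unfolding u_def by (intro tendsto_ennrealI tendsto_intros) (simp add: convergent_LIMSEQ_iff)
      from lim_imp_Liminf[OF _ this] show ?case by simp
    qed
    also have "\<dots> \<le> liminf (\<lambda>k. sqn (\<lambda>x. fourier_ext (trunc R F) x - U k x))"
      unfolding sqn_lborel by (rule nn_integral_liminf) measurable
    also have "\<dots> \<le> liminf (\<lambda>k. ?C * (2 * ?tail R + 2 * ennreal ((1/8) ^ k)))"
    proof (intro Liminf_mono always_eventually allI)
      fix k
      have "sqn (\<lambda>x. fourier_ext (trunc R F) x - U k x) \<le> ?C * (2 * ?tail R + 2 * ?tail (\<rho> k))"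
        unfolding U_def by (rule dist)
      also have "\<dots> \<le> ?C * (2 * ?tail R + 2 * ennreal ((1/8) ^ k))"
        using \<rho>[of k] by (intro mult_left_mono add_mono) auto
      finally show "sqn (\<lambda>x. fourier_ext (trunc R F) x - U k x) \<le> ?C * (2 * ?tail R + 2 * ennreal ((1/8) ^ k))" .
    qed
    also have "\<dots> = ?C * (2 * ?tail R + 2 * ennreal 0)"
      by (intro lim_imp_Liminf ennreal_tendsto_cmult tendsto_add tendsto_const tendsto_ennrealI LIMSEQ_power_zero) auto
    finally show ?thesis by simp
  qed
  have fin: "sqn u < \<infinity>"
  proof -
    have t: "?tail (\<rho> 0) < \<infinity>" using \<rho>[of 0] by (rule order_less_trans) simp
    have "sqn u \<le> 2 * sqn (U 0) + 2 * sqn (\<lambda>x. U 0 x - u x)"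
      using sqn_diff_le[OF borel_measurable_lebesgueI borel_measurable_lebesgueI, of "U 0" "\<lambda>x. U 0 x - u x"] by simp
    also have "\<dots> \<le> 2 * (?C * sqn (trunc (\<rho> 0) F)) + 2 * (?C * (2 * ?tail (\<rho> 0)))"
      using close[of "\<rho> 0"] unfolding U_def by (subst plancherel[OF trunc_L2_compact[OF F]]) (intro add_mono mult_left_mono, auto)
    also have "\<dots> < \<infinity>"
      using L2_compactD(2)[OF trunc_L2_compact[OF F, of "\<rho> 0"]] t by (auto simp: ennreal_mult_less_top)
    finally show ?thesis .
  qed
  have "is_ext F u"
  proof (rule is_extI)
    show "u \<in> borel_measurable lebesgue" by (rule borel_measurable_lebesgueI) measurable
    have "((\<lambda>R. ?C * (2 * ?tail R)) \<longlongrightarrow> ?C * (2 * 0)) at_top"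
      by (intro ennreal_tendsto_cmult trunc_tail F) auto
    hence lim: "((\<lambda>R. ?C * (2 * ?tail R)) \<longlongrightarrow> 0) at_top" by simp
    show "((\<lambda>R. sqn (\<lambda>x. fourier_ext (trunc R F) x - u x)) \<longlongrightarrow> 0) at_top"
      by (rule tendsto_sandwich[OF _ _ tendsto_const lim]) (use close in auto)
  qed (rule fin)
  thus ?thesis using fin by (intro that[of u]) (auto simp: L2_borel_def)
qed

section \<open>Fourier inversion\<close>

lemma L2_product_integrable:
  fixes f g :: "real ^ 'n \<Rightarrow> complex"
  assumes f: "f \<in> L2_borel" and g: "g \<in> L2_borel"
  shows "integrable lborel (\<lambda>x. f x * g x)"
proof -
  note [measurable] = L2_borelD(1)[OF f] L2_borelD(1)[OF g]
  have sq: "integrable lborel (\<lambda>x. (cmod (h x))\<^sup>2)" if "h \<in> L2_borel" for h :: "real ^ 'n \<Rightarrow> complex"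
    using that L2_borelD[OF that] by (auto simp: integrable_iff_bounded sqn_lborel)
  show ?thesis
  proof (rule Bochner_Integration.integrable_bound)
    show "integrable lborel (\<lambda>x. (cmod (f x))\<^sup>2 + (cmod (g x))\<^sup>2)"
      by (intro Bochner_Integration.integrable_add sq f g)
    show "AE x in lborel. norm (f x * g x) \<le> norm ((cmod (f x))\<^sup>2 + (cmod (g x))\<^sup>2)"
    proof (intro AE_I2)
      fix x
      have "2 * (cmod (f x) * cmod (g x)) \<le> (cmod (f x))\<^sup>2 + (cmod (g x))\<^sup>2"
        using sum_squares_bound[of "cmod (f x)" "cmod (g x)"] by (simp add: mult_ac)
      moreover have "0 \<le> cmod (f x) * cmod (g x)" by simp
      ultimately have "cmod (f x) * cmod (g x) \<le> (cmod (f x))\<^sup>2 + (cmod (g x))\<^sup>2" by linarith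
      thus "norm (f x * g x) \<le> norm ((cmod (f x))\<^sup>2 + (cmod (g x))\<^sup>2)" by (simp add: norm_mult)
    qed
  qed measurable
qed

lemma L2_product_tendsto:
  fixes a :: "'i \<Rightarrow> real ^ 'n \<Rightarrow> complex"
  assumes a: "\<And>R. a R \<in> L2_borel" and a': "a' \<in> L2_borel" and b: "b \<in> L2_borel"
    and lim: "((\<lambda>R. sqn (\<lambda>x. a R x - a' x)) \<longlongrightarrow> 0) F"
  shows "((\<lambda>R. \<integral>x. a R x * b x \<partial>lborel) \<longlongrightarrow> (\<integral>x. a' x * b x \<partial>lborel)) F"
proof -
  note [measurable] = L2_borelD(1)[OF a] L2_borelD(1)[OF a'] L2_borelD(1)[OF b]
  have bound: "ennreal ((cmod ((\<integral>x. a R x * b x \<partial>lborel) - (\<integral>x. a' x * b x \<partial>lborel)))\<^sup>2) \<le> sqn b * sqn (\<lambda>x. a R x - a' x)" for R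
  proof -
    have "(\<integral>x. a R x * b x \<partial>lborel) - (\<integral>x. a' x * b x \<partial>lborel) = (\<integral>x. (a R x - a' x) * b x \<partial>lborel)"
      by (subst Bochner_Integration.integral_diff[symmetric])
         (auto intro!: L2_product_integrable a a' b simp: left_diff_distrib)
    hence "ennreal ((cmod ((\<integral>x. a R x * b x \<partial>lborel) - (\<integral>x. a' x * b x \<partial>lborel)))\<^sup>2)
       = (ennreal (norm (\<integral>x. (a R x - a' x) * b x \<partial>lborel)))\<^sup>2" by (simp add: ennreal_power)
    also have "\<dots> \<le> (\<integral>\<^sup>+x. ennreal (norm ((a R x - a' x) * b x)) \<partial>lborel)\<^sup>2"
      by (intro power_mono norm_integral_le_nn_integral) auto
    also have "(\<integral>\<^sup>+x. ennreal (norm ((a R x - a' x) * b x)) \<partial>lborel)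
       = (\<integral>\<^sup>+x. ennreal (cmod (a R x - a' x)) * ennreal (cmod (b x)) \<partial>lborel)"
      by (simp add: norm_mult ennreal_mult)
    also have "\<dots>\<^sup>2 \<le> (\<integral>\<^sup>+x. ennreal (cmod (a R x - a' x)) ^ 2 \<partial>lborel) * (\<integral>\<^sup>+x. ennreal (cmod (b x)) ^ 2 \<partial>lborel)"
      by (rule Cauchy_Schwarz_nn_integral) auto
    also have "\<dots> = sqn b * sqn (\<lambda>x. a R x - a' x)"
      by (simp add: sqn_lborel ennreal_power mult.commute)
    finally show ?thesis .
  qed
  have "((\<lambda>R. sqn b * sqn (\<lambda>x. a R x - a' x)) \<longlongrightarrow> sqn b * 0) F"
    using L2_borelD(2)[OF b] by (intro ennreal_tendsto_cmult lim) auto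
  hence lim0: "((\<lambda>R. sqn b * sqn (\<lambda>x. a R x - a' x)) \<longlongrightarrow> ennreal 0) F" by simp
  have "((\<lambda>R. ennreal ((cmod ((\<integral>x. a R x * b x \<partial>lborel) - (\<integral>x. a' x * b x \<partial>lborel)))\<^sup>2)) \<longlongrightarrow> ennreal 0) F"
    by (rule tendsto_sandwich[OF _ _ _ lim0, of "\<lambda>_. 0"]) (use bound in auto)
  hence "((\<lambda>R. (cmod ((\<integral>x. a R x * b x \<partial>lborel) - (\<integral>x. a' x * b x \<partial>lborel)))\<^sup>2) \<longlongrightarrow> 0) F"
    by (subst (asm) tendsto_ennreal_iff) auto
  hence "((\<lambda>R. sqrt ((cmod ((\<integral>x. a R x * b x \<partial>lborel) - (\<integral>x. a' x * b x \<partial>lborel)))\<^sup>2)) \<longlongrightarrow> sqrt 0) F"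
    by (rule tendsto_real_sqrt)
  hence "((\<lambda>R. (\<integral>x. a R x * b x \<partial>lborel) - (\<integral>x. a' x * b x \<partial>lborel)) \<longlongrightarrow> 0) F"
    by (simp add: tendsto_norm_zero_iff)
  thus ?thesis by (simp add: LIM_zero_iff)
qed

lemma fourier_ext_L2_borel: "f \<in> L2_compact \<Longrightarrow> fourier_ext f \<in> L2_borel"
  using is_extD(3)[OF is_ext_compact[of f]] L2_compactD(1)[of f] by (auto simp: L2_borel_def)

lemma L2_borel_cnj: "f \<in> L2_borel \<Longrightarrow> (\<lambda>x. cnj (f x)) \<in> L2_borel"
  by (auto simp: L2_borel_def sqn_lborel)

lemma L2_compact_cnj: "f \<in> L2_compact \<Longrightarrow> (\<lambda>x. cnj (f x)) \<in> L2_compact"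
  by (auto simp: L2_compact_def sqn_lborel)

lemma plancherel_polarised:
  fixes f g :: "real ^ 'n \<Rightarrow> complex"
  assumes f: "f \<in> L2_compact" and g: "g \<in> L2_compact"
  shows "(\<integral>x. fourier_ext f x * cnj (fourier_ext g x) \<partial>lborel) = (2*pi) ^ CARD('n) * (\<integral>x. f x * cnj (g x) \<partial>lborel)"
proof -
  let ?c = "(2*pi) ^ CARD('n)"
  have nrm: "(\<integral>x. (cmod (h x))\<^sup>2 \<partial>lborel) = enn2real (sqn h)" if "h \<in> L2_borel" for h :: "real ^ 'n \<Rightarrow> complex"
    unfolding sqn_lborel using L2_borelD(1)[OF that] by (intro integral_eq_nn_integral) auto
  have sq: "integrable lborel (\<lambda>x. (cmod (h x))\<^sup>2)" if "h \<in> L2_borel" for h :: "real ^ 'n \<Rightarrow> complex"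
    using that L2_borelD[OF that] by (auto simp: integrable_iff_bounded sqn_lborel)
  have plan: "(\<integral>x. (cmod (fourier_ext h x))\<^sup>2 \<partial>lborel) = ?c * (\<integral>x. (cmod (h x))\<^sup>2 \<partial>lborel)"
    if "h \<in> L2_compact" for h :: "real ^ 'n \<Rightarrow> complex"
    using nrm[OF fourier_ext_L2_borel[OF that]] nrm[OF L2_compact_borel[OF that]] plancherel[OF that]
    by (simp add: enn2real_mult)
  have re: "Re (\<integral>x. fourier_ext f x * cnj (fourier_ext h x) \<partial>lborel) = ?c * Re (\<integral>x. f x * cnj (h x) \<partial>lborel)"
    if h: "h \<in> L2_compact" for h
  proof -
    have pol: "Re (a * cnj b) = ((cmod (a + b))\<^sup>2 - (cmod (a - b))\<^sup>2) / 4" for a b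
      unfolding cmod_power2 by (simp add: power2_eq_square algebra_simps)
    have main: "Re (\<integral>x. a x * cnj (b x) \<partial>lborel) = ((\<integral>x. (cmod (a x + b x))\<^sup>2 \<partial>lborel) - (\<integral>x. (cmod (a x - b x))\<^sup>2 \<partial>lborel)) / 4"
      if a: "a \<in> L2_borel" and b: "b \<in> L2_borel" for a b :: "real ^ 'n \<Rightarrow> complex"
    proof -
      have "Re (\<integral>x. a x * cnj (b x) \<partial>lborel) = (\<integral>x. Re (a x * cnj (b x)) \<partial>lborel)"
        by (intro integral_Re[symmetric] L2_product_integrable L2_borel_cnj a b)
      also have "\<dots> = ((\<integral>x. (cmod (a x + b x))\<^sup>2 \<partial>lborel) - (\<integral>x. (cmod (a x - b x))\<^sup>2 \<partial>lborel)) / 4"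
        unfolding pol integral_divide_zero
        by (subst Bochner_Integration.integral_diff) (auto intro!: sq L2_borel_add L2_borel_diff a b)
      finally show ?thesis .
    qed
    have ints: "integrable lborel f" "integrable lborel h" by (intro L2_compact_integrable f h)+
    have "Re (\<integral>x. fourier_ext f x * cnj (fourier_ext h x) \<partial>lborel)
       = ((\<integral>x. (cmod (fourier_ext (\<lambda>x. f x + h x) x))\<^sup>2 \<partial>lborel) - (\<integral>x. (cmod (fourier_ext (\<lambda>x. f x - h x) x))\<^sup>2 \<partial>lborel)) / 4"
      by (simp add: fourier_ext_add[OF ints] fourier_ext_diff[OF ints] main[OF fourier_ext_L2_borel[OF f] fourier_ext_L2_borel[OF h]])
    also have "\<dots> = ?c * Re (\<integral>x. f x * cnj (h x) \<partial>lborel)"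
      unfolding plan[OF L2_compact_add[OF f h]] plan[OF L2_compact_diff[OF f h]] main[OF L2_compact_borel[OF f] L2_compact_borel[OF h]]
      by (simp add: algebra_simps)
    finally show ?thesis .
  qed
  have *: "(\<integral>x. F x * cnj (\<i> * G x) \<partial>lborel) = - \<i> * (\<integral>x. F x * cnj (G x) \<partial>lborel)" for F G :: "real ^ 'n \<Rightarrow> complex"
    by (subst Bochner_Integration.integral_mult_right_zero[symmetric]) (simp add: mult_ac)
  show ?thesis
    using re[OF g] re[OF L2_compact_cmult[OF g, of \<i>]]
    unfolding fourier_ext_cmult *
    by (simp add: complex_eq_iff del: complex_cnj_mult)
qed

lemma sqn_trunc_eq_0I: "(\<integral>x. d x * (indicator (cball 0 k) x * cnj (d x)) \<partial>lborel) = 0 \<Longrightarrow> d \<in> L2_borel \<Longrightarrow> sqn (trunc k d) = 0"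
proof -
  assume 0: "(\<integral>x. d x * (indicator (cball 0 k) x * cnj (d x)) \<partial>lborel) = 0" and d: "d \<in> L2_borel"
  note [measurable] = L2_borelD(1)[OF d]
  have t: "trunc k d \<in> L2_borel" by (intro L2_compact_borel trunc_L2_compact d)
  have int: "integrable lborel (\<lambda>x. (cmod (trunc k d x))\<^sup>2)"
    using L2_borelD[OF t] by (auto simp: integrable_iff_bounded sqn_lborel)
  have "d x * (indicator (cball 0 k) x * cnj (d x)) = of_real ((cmod (trunc k d x))\<^sup>2)" for x
    by (auto simp: trunc_def indicator_def complex_norm_square[symmetric])
  hence "(\<integral>x. (cmod (trunc k d x))\<^sup>2 \<partial>lborel) = 0" using 0 by (simp add: integral_complex_of_real del: of_real_power)
  moreover have "sqn (trunc k d) = ennreal (\<integral>x. (cmod (trunc k d x))\<^sup>2 \<partial>lborel)"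
    unfolding sqn_lborel by (rule nn_integral_eq_integral[OF int]) auto
  ultimately show ?thesis by simp
qed

lemma L2_reflect: "f \<in> L2_borel \<Longrightarrow> (\<lambda>x. f (- x)) \<in> L2_borel"
  by (auto simp: L2_borel_def sqn_reflect)

lemma L2_compact_reflect:
  assumes "f \<in> L2_compact" shows "(\<lambda>x. f (- x)) \<in> L2_compact"
proof -
  obtain R where "\<And>x. norm x > R \<Longrightarrow> f x = 0" using assms by (auto simp: L2_compact_def)
  thus ?thesis using L2_compactD[OF assms] by (intro L2_compactI[of _ R]) (auto simp: sqn_reflect)
qed

lemma integral_reflect:
  fixes f :: "real ^ 'n \<Rightarrow> complex"
  assumes "f \<in> borel_measurable borel"
  shows "(\<integral>x. f (- x) \<partial>lborel) = (\<integral>x. f x \<partial>lborel)"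
  using lborel_scale(1)[of "-1" f 0] assms by simp

lemma fourier_ext_reflect:
  assumes [measurable]: "f \<in> borel_measurable borel"
  shows "fourier_ext (\<lambda>x. f (- x)) x = fourier_ext f (- x)"
  unfolding fourier_ext_def using integral_reflect[of "\<lambda>\<xi>. cis (- x \<bullet> \<xi>) * f \<xi>"] by simp

text \<open>
  An isometry composed with its adjoint is the identity. Tested against \<open>H\<close> of bounded support, the
  multiplication formula moves the second transform to \<open>H\<close>, and the polarised Plancherel identity
  removes both.
\<close>

theorem fourier_inversion:
  fixes F :: "real ^ 'n \<Rightarrow> complex"
  assumes F: "F \<in> L2_borel" and u: "u \<in> L2_borel" and w: "w \<in> L2_borel"
    and Fu: "is_ext F u" and uw: "is_ext u w"
  shows "AE \<xi> in lborel. w (- \<xi>) = (2*pi) ^ CARD('n) * F \<xi>"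
proof -
  let ?c = "complex_of_real ((2*pi) ^ CARD('n))"
  note [measurable] = L2_borelD(1)[OF F] L2_borelD(1)[OF u] L2_borelD(1)[OF w]
  have weak: "(\<integral>\<xi>. w (- \<xi>) * H \<xi> \<partial>lborel) = (\<integral>\<xi>. (?c * F \<xi>) * H \<xi> \<partial>lborel)" if H: "H \<in> L2_compact" for H
  proof -
    note [measurable] = L2_compactD(1)[OF H]
    define Hr where "Hr = (\<lambda>x. H (- x))"
    have Hr: "Hr \<in> L2_compact" unfolding Hr_def by (rule L2_compact_reflect[OF H])
    note [measurable] = L2_compactD(1)[OF Hr]
    have Hb: "H \<in> L2_borel" "Hr \<in> L2_borel" by (intro L2_compact_borel H Hr)+
    have EHr: "fourier_ext Hr \<in> L2_borel" by (rule fourier_ext_L2_borel[OF Hr])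
    have EHr_eq: "fourier_ext Hr x = cnj (fourier_ext (\<lambda>x. cnj (H x)) x)" for x
      unfolding fourier_ext_cnj Hr_def by (simp add: fourier_ext_reflect)
    have t1: "((\<lambda>R. \<integral>x. fourier_ext (trunc R u) x * Hr x \<partial>lborel) \<longlongrightarrow> (\<integral>x. w x * Hr x \<partial>lborel)) at_top"
      by (intro L2_product_tendsto fourier_ext_L2_borel trunc_L2_compact u w Hb is_extD(4)[OF uw])
    have t2: "((\<lambda>R. \<integral>x. trunc R u x * fourier_ext Hr x \<partial>lborel) \<longlongrightarrow> (\<integral>x. u x * fourier_ext Hr x \<partial>lborel)) at_top"
      by (intro L2_product_tendsto L2_compact_borel trunc_L2_compact u EHr trunc_tail)
    have "(\<integral>x. fourier_ext (trunc R u) x * Hr x \<partial>lborel) = (\<integral>x. trunc R u x * fourier_ext Hr x \<partial>lborel)" for R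
      using multiplication_formula[OF L2_compact_integrable[OF Hr] L2_compact_integrable[OF trunc_L2_compact[OF u]]]
      by (simp add: mult.commute)
    hence eq1: "(\<integral>x. w x * Hr x \<partial>lborel) = (\<integral>x. u x * fourier_ext Hr x \<partial>lborel)"
      using tendsto_unique[OF _ t1] t2 by simp
    have t3: "((\<lambda>R. \<integral>x. fourier_ext (trunc R F) x * fourier_ext Hr x \<partial>lborel) \<longlongrightarrow> (\<integral>x. u x * fourier_ext Hr x \<partial>lborel)) at_top"
      by (intro L2_product_tendsto fourier_ext_L2_borel trunc_L2_compact u F EHr is_extD(4)[OF Fu])
    have t4: "((\<lambda>R. ?c * (\<integral>x. trunc R F x * H x \<partial>lborel)) \<longlongrightarrow> ?c * (\<integral>x. F x * H x \<partial>lborel)) at_top"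
      by (intro tendsto_mult tendsto_const L2_product_tendsto L2_compact_borel trunc_L2_compact F H trunc_tail)
    have "(\<integral>x. fourier_ext (trunc R F) x * fourier_ext Hr x \<partial>lborel) = ?c * (\<integral>x. trunc R F x * H x \<partial>lborel)" for R
      using plancherel_polarised[OF trunc_L2_compact[OF F] L2_compact_cnj[OF H], of R] by (simp add: EHr_eq)
    hence eq2: "(\<integral>x. u x * fourier_ext Hr x \<partial>lborel) = ?c * (\<integral>x. F x * H x \<partial>lborel)"
      using tendsto_unique[OF _ t3] t4 by simp
    have "(\<integral>\<xi>. w (- \<xi>) * H \<xi> \<partial>lborel) = (\<integral>x. w x * Hr x \<partial>lborel)"
      using integral_reflect[of "\<lambda>x. w x * Hr x"] by (simp add: Hr_def)
    also have "\<dots> = ?c * (\<integral>x. F x * H x \<partial>lborel)" unfolding eq1 eq2 ..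
    also have "\<dots> = (\<integral>\<xi>. (?c * F \<xi>) * H \<xi> \<partial>lborel)"
      by (subst Bochner_Integration.integral_mult_right_zero[symmetric]) (simp add: mult_ac)
    finally show ?thesis .
  qed
  define d where "d = (\<lambda>\<xi>. w (- \<xi>) - ?c * F \<xi>)"
  have cF: "(\<lambda>\<xi>. ?c * F \<xi>) \<in> L2_borel" by (rule L2_borel_bounded_mult[OF F, of _ "norm ?c"]) auto
  have wr: "(\<lambda>\<xi>. w (- \<xi>)) \<in> L2_borel" by (rule L2_reflect[OF w])
  have d: "d \<in> L2_borel" unfolding d_def by (intro L2_borel_diff cF wr)
  note [measurable] = L2_borelD(1)[OF d]
  \<comment> \<open>The defect itself, conjugated and cut off to a ball, is an admissible test function.\<close>
  have "sqn (trunc (real k) d) = 0" for k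
  proof (rule sqn_trunc_eq_0I[OF _ d])
    have H: "(\<lambda>x. indicator (cball 0 (real k)) x * cnj (d x)) \<in> L2_compact"
      using trunc_L2_compact[OF L2_borel_cnj[OF d]] by (simp add: trunc_def)
    have "(\<integral>x. d x * (indicator (cball 0 (real k)) x * cnj (d x)) \<partial>lborel)
      = (\<integral>x. w (- x) * (indicator (cball 0 (real k)) x * cnj (d x)) \<partial>lborel)
      - (\<integral>x. (?c * F x) * (indicator (cball 0 (real k)) x * cnj (d x)) \<partial>lborel)"
      by (subst (1) d_def, subst left_diff_distrib, rule Bochner_Integration.integral_diff)
         (intro L2_product_integrable L2_compact_borel[OF H] wr cF)+
    thus "(\<integral>x. d x * (indicator (cball 0 (real k)) x * cnj (d x)) \<partial>lborel) = 0"
      using weak[OF H] by simp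
  qed
  hence "AE x in lborel. trunc (real k) d x = 0" for k
    using sqn_zero_AE[of "trunc (real k) d"] by (simp add: AE_completion_iff borel_measurable_lebesgueI)
  hence "AE x in lborel. \<forall>k. trunc (real k) d x = 0" by (simp add: AE_all_countable)
  thus ?thesis
  proof eventually_elim
    case (elim x)
    obtain k where "norm x \<le> real k" using real_arch_simple by blast
    with elim[rule_format, of k] have "d x = 0" by (simp add: trunc_def indicator_def)
    thus ?case by (simp add: d_def)
  qed
qed

text \<open>
  The underlying measure is Lebesgue measure, which is complete, whereas Fubini's theorem is applied
  to Borel functions; the next lemmas change between the two.
\<close>

lemma borel_version:
  fixes f :: "real ^ 'n \<Rightarrow> complex"
  assumes f: "f \<in> L2_space"
  obtains g where "g \<in> L2_borel" "AE x in lborel. f x = g x"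
proof -
  have m: "f \<in> borel_measurable lebesgue" using f by (simp add: L2_space_def)
  have "(\<lambda>x. Re (f x)) \<in> borel_measurable (completion lborel)" using m by measurable
  from completion_ex_borel_measurable_real[OF this]
  obtain a where a: "a \<in> borel_measurable lborel" "AE x in lborel. Re (f x) = a x" by blast
  have "(\<lambda>x. Im (f x)) \<in> borel_measurable (completion lborel)" using m by measurable
  from completion_ex_borel_measurable_real[OF this]
  obtain b where b: "b \<in> borel_measurable lborel" "AE x in lborel. Im (f x) = b x" by blast
  define g where "g x = Complex (a x) (b x)" for x
  have gm: "g \<in> borel_measurable borel"
  proof -
    have "(\<lambda>x. of_real (a x) + \<i> * of_real (b x)) \<in> borel_measurable borel" using a b by simp
    also have "(\<lambda>x. of_real (a x) + \<i> * of_real (b x)) = g" by (auto simp: g_def complex_eq_iff)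
    finally show ?thesis .
  qed
  have ae: "AE x in lborel. f x = g x" using a(2) b(2) by eventually_elim (simp add: g_def complex_eq_iff)
  have "sqn g = sqn f" using sqn_cong_AE[OF ae] by simp
  hence "sqn g < \<infinity>" using f by (simp add: L2_space_def)
  with gm ae show ?thesis by (intro that[of g]) (auto simp: L2_borel_def)
qed

lemma ident_lebesgue_borel: "(\<lambda>x. x) \<in> borel_measurable (lebesgue :: 'a :: euclidean_space measure)"
  by (rule borel_measurable_lebesgueI) simp

lemma truncated_integral_eq:
  fixes f :: "real ^ 'n \<Rightarrow> complex"
  assumes [measurable]: "g \<in> borel_measurable borel" "f \<in> borel_measurable lebesgue" and ae: "AE x in lborel. f x = g x"
    and [measurable]: "\<theta> \<in> borel_measurable borel"
  shows "(LINT x:cball 0 R|lebesgue. cis (\<theta> x) * f x) = (\<integral>x. cis (\<theta> x) * trunc R g x \<partial>lborel)"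
proof -
  have bm: "(\<lambda>x. indicat_real (cball 0 R) x *\<^sub>R (cis (\<theta> x) * g x)) \<in> borel_measurable borel"
    by measurable
  note [measurable] = ident_lebesgue_borel
  have "(LINT x:cball 0 R|lebesgue. cis (\<theta> x) * f x) = (\<integral>x. indicator (cball 0 R) x *\<^sub>R (cis (\<theta> x) * g x) \<partial>lebesgue)"
    unfolding set_lebesgue_integral_def
  proof (rule integral_cong_AE)
    show "AE x in lebesgue. indicat_real (cball 0 R) x *\<^sub>R (cis (\<theta> x) * f x) = indicat_real (cball 0 R) x *\<^sub>R (cis (\<theta> x) * g x)"
      using AE_completion[OF ae] by eventually_elim simp
  qed measurable
  also have "\<dots> = (\<integral>x. indicator (cball 0 R) x *\<^sub>R (cis (\<theta> x) * g x) \<partial>lborel)"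
    by (rule integral_completion) (use bm in simp)
  also have "\<dots> = (\<integral>x. cis (\<theta> x) * trunc R g x \<partial>lborel)"
    by (intro Bochner_Integration.integral_cong refl) (auto simp: trunc_def indicator_def)
  finally show ?thesis .
qed

lemma L2_borel_cmult: "f \<in> L2_borel \<Longrightarrow> (\<lambda>x. c * f x) \<in> L2_borel"
  by (rule L2_borel_bounded_mult[of _ _ "cmod c"]) auto

text \<open>
  The forward transform is the reflected and normalised Fourier integral, so the choice made in
  \<open>fourier_L2\<close> is among the limits of the latter.
\<close>

lemma fourier_L2_AE:
  fixes f g w :: "real ^ 'n \<Rightarrow> complex"
  assumes f: "f \<in> L2_space" and g: "g \<in> L2_borel" and fg: "AE x in lborel. f x = g x"
    and gw: "is_ext g w" and w: "w \<in> L2_borel"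
  shows "AE \<xi> in lebesgue. fourier_L2 f \<xi> = (1 / (2 * pi) ^ CARD('n)) *\<^sub>R w (- \<xi>)"
    and "fourier_L2 f \<in> L2_space"
proof -
  let ?c = "1 / (2 * pi) ^ CARD('n)"
  let ?G = "\<lambda>R \<xi>. ?c *\<^sub>R (LINT x:cball 0 R|lebesgue. cis (- (x \<bullet> \<xi>)) * f x)"
  note [measurable] = L2_borelD(1)[OF g] L2_borelD(1)[OF w]
  have fm: "f \<in> borel_measurable lebesgue" using f by (simp add: L2_space_def)
  have G: "?G R = (\<lambda>\<xi>. of_real ?c * fourier_ext (trunc R g) (- \<xi>))" for R
    by (subst truncated_integral_eq[OF _ fm fg]) (auto simp: fourier_ext_def inner_commute scaleR_conv_of_real)
  have Gm: "?G R \<in> borel_measurable lebesgue" for R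
    unfolding G by (rule borel_measurable_lebesgueI) measurable
  have wr: "(\<lambda>\<xi>. of_real ?c * w (- \<xi>)) \<in> L2_borel" by (intro L2_borel_cmult L2_reflect w)
  have lim: "L2_limit ?G (\<lambda>\<xi>. of_real ?c * w (- \<xi>))"
    unfolding L2_limit_def
  proof
    show "(\<lambda>\<xi>. of_real ?c * w (- \<xi>)) \<in> L2_space" by (rule L2_borel_space[OF wr])
    have "sqn (\<lambda>\<xi>. ?G R \<xi> - of_real ?c * w (- \<xi>)) = ennreal ((cmod (of_real ?c))\<^sup>2) * sqn (\<lambda>\<xi>. fourier_ext (trunc R g) \<xi> - w \<xi>)" for R
    proof -
      have "sqn (\<lambda>\<xi>. ?G R \<xi> - of_real ?c * w (- \<xi>)) = sqn (\<lambda>\<xi>. of_real ?c * (fourier_ext (trunc R g) (- \<xi>) - w (- \<xi>)))"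
        using fun_cong[OF G] by (simp only: right_diff_distrib)
      also have "\<dots> = ennreal ((cmod (of_real ?c))\<^sup>2) * sqn (\<lambda>\<xi>. fourier_ext (trunc R g) (- \<xi>) - w (- \<xi>))"
        by (rule sqn_cmult) measurable
      also have "sqn (\<lambda>\<xi>. fourier_ext (trunc R g) (- \<xi>) - w (- \<xi>)) = sqn (\<lambda>\<xi>. fourier_ext (trunc R g) \<xi> - w \<xi>)"
        by (rule sqn_reflect) measurable
      finally show ?thesis .
    qed
    moreover have "((\<lambda>R. ennreal ((cmod (of_real ?c))\<^sup>2) * sqn (\<lambda>\<xi>. fourier_ext (trunc R g) \<xi> - w \<xi>)) \<longlongrightarrow> ennreal ((cmod (of_real ?c))\<^sup>2) * 0) at_top"
      by (intro ennreal_tendsto_cmult is_extD(4)[OF gw]) auto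
    ultimately show "((\<lambda>R. sqn (\<lambda>\<xi>. ?G R \<xi> - of_real ?c * w (- \<xi>))) \<longlongrightarrow> 0) at_top" by simp
  qed
  have some: "L2_limit ?G (fourier_L2 f)" unfolding fourier_L2_def by (rule someI[of "L2_limit ?G", OF lim])
  show "fourier_L2 f \<in> L2_space" using some by (simp add: L2_limit_def)
  show "AE \<xi> in lebesgue. fourier_L2 f \<xi> = ?c *\<^sub>R w (- \<xi>)"
    using L2_limit_unique[OF some lim Gm] by (simp add: scaleR_conv_of_real)
qed

theorem fourier_L2_surj:
  fixes F :: "real ^ 'n \<Rightarrow> complex"
  assumes F: "F \<in> L2_borel"
  obtains f where "f \<in> L2_borel" "is_ext F f" "AE \<xi> in lebesgue. fourier_L2 f \<xi> = F \<xi>"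
proof -
  obtain u where u: "is_ext F u" "u \<in> L2_borel" by (rule is_ext_exists[OF F])
  obtain w where w: "is_ext u w" "w \<in> L2_borel" by (rule is_ext_exists[OF u(2)])
  have "AE \<xi> in lebesgue. fourier_L2 u \<xi> = (1 / (2 * pi) ^ CARD('n)) *\<^sub>R w (- \<xi>)"
    by (rule fourier_L2_AE(1)[OF L2_borel_space[OF u(2)] u(2) _ w]) simp
  moreover have "AE \<xi> in lebesgue. w (- \<xi>) = (2*pi) ^ CARD('n) * F \<xi>"
    by (rule AE_completion[OF fourier_inversion[OF F u(2) w(2) u(1) w(1)]])
  ultimately have "AE \<xi> in lebesgue. fourier_L2 u \<xi> = F \<xi>"
    by eventually_elim (simp add: scaleR_conv_of_real)
  thus ?thesis using u that by blast
qed

text \<open>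
  Inversion in the other order follows by reflection, as the forward and the inverse transform differ
  only by a reflection and a factor.
\<close>

theorem fourier_L2_inverse:
  fixes f :: "real ^ 'n \<Rightarrow> complex"
  assumes f: "f \<in> L2_space"
  obtains F where "F \<in> L2_borel" "AE \<xi> in lebesgue. fourier_L2 f \<xi> = F \<xi>" "is_ext F f"
    "fourier_L2 f \<in> L2_space"
proof -
  let ?c = "complex_of_real (1 / (2 * pi) ^ CARD('n))"
  obtain g where g: "g \<in> L2_borel" "AE x in lborel. f x = g x" by (rule borel_version[OF f])
  obtain w where w: "is_ext g w" "w \<in> L2_borel" by (rule is_ext_exists[OF g(1)])
  obtain v where v: "is_ext w v" "v \<in> L2_borel" by (rule is_ext_exists[OF w(2)])
  note [measurable] = L2_borelD(1)[OF g(1)] L2_borelD(1)[OF w(2)] L2_borelD(1)[OF v(2)]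
  have fm[measurable]: "f \<in> borel_measurable lebesgue" using f by (simp add: L2_space_def)
  define F where "F = (\<lambda>\<xi>. ?c * w (- \<xi>))"
  have F: "F \<in> L2_borel" unfolding F_def by (intro L2_borel_cmult L2_reflect w)
  note [measurable] = L2_borelD(1)[OF F]
  have inv: "AE x in lborel. v (- x) = (2*pi) ^ CARD('n) * g x"
    by (rule fourier_inversion[OF g(1) w(2) v(2) w(1) v(1)])
  have "is_ext F (\<lambda>x. ?c * v (- x))"
  proof (rule is_extI)
    have L: "(\<lambda>x. ?c * v (- x)) \<in> L2_borel" by (intro L2_borel_cmult L2_reflect v)
    show "(\<lambda>x. ?c * v (- x)) \<in> borel_measurable lebesgue" using L2_borelD(1)[OF L] by (rule borel_measurable_lebesgueI)
    show "sqn (\<lambda>x. ?c * v (- x)) < \<infinity>" by (rule L2_borelD(2)[OF L])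
    have "sqn (\<lambda>x. fourier_ext (trunc R F) x - ?c * v (- x)) = ennreal ((cmod ?c)\<^sup>2) * sqn (\<lambda>x. fourier_ext (trunc R w) x - v x)" for R
    proof -
      have "trunc R F = (\<lambda>\<xi>. ?c * trunc R w (- \<xi>))" by (auto simp: F_def trunc_def indicator_def)
      hence "fourier_ext (trunc R F) x = ?c * fourier_ext (trunc R w) (- x)" for x
        by (simp only: fourier_ext_cmult) (subst fourier_ext_reflect, measurable)
      hence "sqn (\<lambda>x. fourier_ext (trunc R F) x - ?c * v (- x)) = sqn (\<lambda>x. ?c * (fourier_ext (trunc R w) (- x) - v (- x)))"
        by (simp add: right_diff_distrib)
      also have "\<dots> = ennreal ((cmod ?c)\<^sup>2) * sqn (\<lambda>x. fourier_ext (trunc R w) (- x) - v (- x))"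
        by (rule sqn_cmult) measurable
      also have "sqn (\<lambda>x. fourier_ext (trunc R w) (- x) - v (- x)) = sqn (\<lambda>x. fourier_ext (trunc R w) x - v x)"
        by (rule sqn_reflect) measurable
      finally show ?thesis .
    qed
    moreover have "((\<lambda>R. ennreal ((cmod ?c)\<^sup>2) * sqn (\<lambda>x. fourier_ext (trunc R w) x - v x)) \<longlongrightarrow> ennreal ((cmod ?c)\<^sup>2) * 0) at_top"
      by (intro ennreal_tendsto_cmult is_extD(4)[OF v(1)]) auto
    ultimately show "((\<lambda>R. sqn (\<lambda>x. fourier_ext (trunc R F) x - ?c * v (- x))) \<longlongrightarrow> 0) at_top" by simp
  qed
  hence Ff: "is_ext F f"
  proof (rule is_ext_cong_AE)
    have "AE x in lborel. ?c * v (- x) = f x"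
      using inv g(2) by eventually_elim simp
    thus "AE x in lebesgue. ?c * v (- x) = f x" by (rule AE_completion)
  qed (auto intro: fm)
  have "AE \<xi> in lebesgue. fourier_L2 f \<xi> = F \<xi>"
    using fourier_L2_AE(1)[OF f g w] by (simp add: F_def scaleR_conv_of_real)
  moreover have "fourier_L2 f \<in> L2_space" by (rule fourier_L2_AE(2)[OF f g w])
  ultimately show ?thesis using F Ff that by blast
qed

theorem propagator_is_ext:
  fixes f :: "real ^ 'n \<Rightarrow> complex"
  assumes F: "F \<in> L2_borel" and ae: "AE \<xi> in lebesgue. fourier_L2 f \<xi> = F \<xi>"
    and m: "fourier_L2 f \<in> L2_space" and [measurable]: "P \<in> borel_measurable borel"
  shows "is_ext (\<lambda>\<xi>. cis (t * P \<xi>) * F \<xi>) (propagator P t f)"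
proof -
  let ?G = "\<lambda>R x. LINT \<xi>:cball 0 R|lebesgue. cis (x \<bullet> \<xi> + t * P \<xi>) * fourier_L2 f \<xi>"
  note [measurable] = L2_borelD(1)[OF F]
  have fm: "fourier_L2 f \<in> borel_measurable lebesgue" using m by (simp add: L2_space_def)
  have ae': "AE \<xi> in lborel. fourier_L2 f \<xi> = F \<xi>" using ae by (simp add: AE_completion_iff)
  have cF: "(\<lambda>\<xi>. cis (t * P \<xi>) * F \<xi>) \<in> L2_borel" by (rule L2_borel_bounded_mult[OF F, of _ 1]) auto
  have G: "?G R = fourier_ext (trunc R (\<lambda>\<xi>. cis (t * P \<xi>) * F \<xi>))" for R
  proof
    fix x
    have "?G R x = (\<integral>\<xi>. cis (x \<bullet> \<xi> + t * P \<xi>) * trunc R F \<xi> \<partial>lborel)"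
      by (rule truncated_integral_eq[OF _ fm ae']) measurable
    also have "\<dots> = fourier_ext (trunc R (\<lambda>\<xi>. cis (t * P \<xi>) * F \<xi>)) x"
      unfolding fourier_ext_def trunc_def
      by (intro Bochner_Integration.integral_cong refl) (simp add: cis_mult[symmetric] mult_ac)
    finally show "?G R x = fourier_ext (trunc R (\<lambda>\<xi>. cis (t * P \<xi>) * F \<xi>)) x" .
  qed
  obtain u where u: "is_ext (\<lambda>\<xi>. cis (t * P \<xi>) * F \<xi>) u" by (rule is_ext_exists[OF cF])
  hence "L2_limit ?G u" unfolding is_ext_def G .
  hence "L2_limit ?G (propagator P t f)" unfolding propagator_def by (rule someI[of "L2_limit ?G"])
  thus ?thesis unfolding is_ext_def G .
qed

section \<open>Chaining in time\<close>

text \<open>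
  With \<open>y = q ^ i / X\<close> the summand is at most the increment of \<open>y \<mapsto> c y / (1 + y)\<close> from \<open>y\<close> to \<open>q y\<close>, where
  \<open>c\<close> is the right-hand side. This function takes values between 0 and \<open>c\<close>, and the sum telescopes.
\<close>

lemma two_sided_geometric_sum:
  fixes q X :: real
  assumes q: "q > 1" and X: "X > 0"
  shows "(\<Sum>i<n. min (q ^ i / X) (X / q ^ i)) \<le> 2 * (q + 1) / (q - 1)"
proof -
  let ?c = "2 * (q + 1) / (q - 1)"
  let ?\<Psi> = "\<lambda>i. ?c * ((q ^ i / X) / (1 + q ^ i / X))"
  have step: "min y (1 / y) \<le> ?c * (q * y / (1 + q * y)) - ?c * (y / (1 + y))" if y: "y > 0" for y
  proof -
    have "q * y / (1 + q * y) - y / (1 + y) = y * (q - 1) / ((1 + y) * (1 + q * y))"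
      using y q by (simp add: divide_simps) (simp add: algebra_simps add_pos_pos add_nonneg_eq_0_iff)
    hence "?c * (q * y / (1 + q * y)) - ?c * (y / (1 + y)) = ?c * (y * (q - 1) / ((1 + y) * (1 + q * y)))"
      by (simp only: right_diff_distrib[symmetric])
    also have "\<dots> = 2 * (q + 1) * y / ((1 + y) * (1 + q * y))"
      using q by simp
    finally have eq: "?c * (q * y / (1 + q * y)) - ?c * (y / (1 + y)) = 2 * (q + 1) * y / ((1 + y) * (1 + q * y))" .
    have pos: "(1 + y) * (1 + q * y) > 0" using y q by (intro mult_pos_pos add_pos_pos) auto
    show ?thesis
    proof (cases "y \<le> 1")
      case True
      have "(1 + y) * (1 + q * y) \<le> 2 * (1 + q)"
        using True y q by (intro mult_mono) auto
      hence "y * ((1 + y) * (1 + q * y)) \<le> y * (2 * (1 + q))" using y by (intro mult_left_mono) auto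
      hence "y \<le> 2 * (q + 1) * y / ((1 + y) * (1 + q * y))"
        using pos by (simp add: pos_le_divide_eq mult_ac add_ac)
      thus ?thesis unfolding eq by simp
    next
      case False
      have "(1 + y) * (1 + q * y) \<le> (2 * y) * ((1 + q) * y)"
        using False y q by (intro mult_mono) (auto simp: algebra_simps)
      hence "1 / y \<le> 2 * (q + 1) * y / ((1 + y) * (1 + q * y))"
        using pos y by (simp add: divide_simps) (simp add: algebra_simps)
      thus ?thesis unfolding eq by simp
    qed
  qed
  have "(\<Sum>i<n. min (q ^ i / X) (X / q ^ i)) \<le> (\<Sum>i<n. ?\<Psi> (Suc i) - ?\<Psi> i)"
  proof (intro sum_mono)
    fix i
    show "min (q ^ i / X) (X / q ^ i) \<le> ?\<Psi> (Suc i) - ?\<Psi> i"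
      using step[of "q ^ i / X"] X q by simp
  qed
  also have "\<dots> = ?\<Psi> n - ?\<Psi> 0" by (rule sum_lessThan_telescope)
  also have "\<dots> \<le> ?\<Psi> n" using q X by simp
  also have "\<dots> \<le> ?c * 1"
  proof (intro mult_left_mono)
    have "q ^ n / X \<ge> 0" using q X by simp
    thus "(q ^ n / X) / (1 + q ^ n / X) \<le> 1" by (simp only: divide_le_eq_1) linarith
  qed (use q in auto)
  finally show ?thesis by simp
qed

lemma two_sided_geometric_suminf:
  fixes q X :: real
  assumes "q > 1" "X > 0"
  shows "(\<Sum>i. ennreal (min (q ^ i / X) (X / q ^ i))) \<le> ennreal (2 * (q + 1) / (q - 1))"
proof (rule suminf_le_const)
  fix n
  have "(\<Sum>i<n. ennreal (min (q ^ i / X) (X / q ^ i))) = ennreal (\<Sum>i<n. min (q ^ i / X) (X / q ^ i))"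
    using assms by (intro sum_ennreal) auto
  also have "\<dots> \<le> ennreal (2 * (q + 1) / (q - 1))"
    by (intro ennreal_leI two_sided_geometric_sum assms)
  finally show "(\<Sum>i<n. ennreal (min (q ^ i / X) (X / q ^ i))) \<le> ennreal (2 * (q + 1) / (q - 1))" .
qed auto

text \<open>
  Approximate \<open>t\<close> from below by multiples \<open>\<tau> i\<close> of \<open>b / 2 ^ i\<close>. Consecutive approximations agree or are
  neighbours on the finer grid, so each increment is one of the finitely many summands on level \<open>i\<close>,
  whatever \<open>t\<close> is. The Cauchy-Schwarz inequality with weights \<open>p i\<close> sums the levels.
\<close>

lemma dyadic_chaining:
  fixes v :: "real \<Rightarrow> complex" and p :: "nat \<Rightarrow> real"
  assumes cont: "continuous_on UNIV v" and b: "b > 0" and t: "0 \<le> t" "t \<le> b"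
    and p: "\<And>i. p i > 0" and S: "\<And>n. (\<Sum>i<n. p i) \<le> S"
  shows "ennreal ((cmod (v t - v 0))\<^sup>2) \<le> ennreal S * (\<Sum>i. ennreal (1 / p i) *
     (\<Sum>m<2^i. ennreal ((cmod (v (real (Suc m) * b / 2 ^ i) - v (real m * b / 2 ^ i)))\<^sup>2)))"
proof -
  define D where "D i = (\<Sum>m<2^i. (cmod (v (real (Suc m) * b / 2 ^ i) - v (real m * b / 2 ^ i)))\<^sup>2)" for i :: nat
  \<comment> \<open>The endpoint \<open>t = b\<close> is allowed: then \<open>k i = 2 ^ i\<close> on every level, and all jumps vanish except
    the one from time 0 to \<open>\<tau> 0 = b\<close>.\<close>
  define k where "k i = nat \<lfloor>2 ^ i * (t / b)\<rfloor>" for i :: nat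
  define \<tau> where "\<tau> i = real (k i) * b / 2 ^ i" for i
  have D0: "D i \<ge> 0" for i unfolding D_def by (intro sum_nonneg) auto
  have k_bounds: "real (k i) \<le> 2 ^ i * (t / b)" "2 ^ i * (t / b) < real (k i) + 1" for i
    unfolding k_def using t b by (auto simp: nat_less_real_le of_nat_nat)
  have kle: "k i \<le> 2 ^ i" for i
  proof -
    have "real (k i) \<le> 2 ^ i * 1" using k_bounds(1)[of i] t b
      by (elim order_trans) (intro mult_left_mono, auto)
    thus ?thesis by (simp flip: of_nat_le_iff)
  qed
  have jump: "cmod (v (real (Suc m) * b / 2 ^ i) - v (real m * b / 2 ^ i)) \<le> sqrt (D i)" if "m < 2 ^ i" for m i
  proof (rule real_le_rsqrt)
    show "(cmod (v (real (Suc m) * b / 2 ^ i) - v (real m * b / 2 ^ i)))\<^sup>2 \<le> D i"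
      unfolding D_def using that by (intro member_le_sum) auto
  qed
  have base: "cmod (v (\<tau> 0) - v 0) \<le> sqrt (D 0)"
  proof (cases "k 0 = 0")
    case True thus ?thesis using D0[of 0] by (simp add: \<tau>_def)
  next
    case False
    hence "k 0 = 1" using kle[of 0] by simp
    thus ?thesis using jump[of 0 0] by (simp add: \<tau>_def)
  qed
  have step: "cmod (v (\<tau> (Suc i)) - v (\<tau> i)) \<le> sqrt (D (Suc i))" for i
  proof -
    have "k (Suc i) = 2 * k i \<or> k (Suc i) = Suc (2 * k i)"
      using k_bounds[of i] k_bounds[of "Suc i"] by simp linarith
    moreover have \<tau>i: "\<tau> i = real (2 * k i) * b / 2 ^ Suc i" by (simp add: \<tau>_def)
    ultimately show ?thesis
    proof (elim disjE)
      assume "k (Suc i) = 2 * k i"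
      hence "\<tau> (Suc i) = \<tau> i" unfolding \<tau>i by (simp add: \<tau>_def)
      thus ?thesis using D0 by simp
    next
      assume *: "k (Suc i) = Suc (2 * k i)"
      hence "2 * k i < 2 ^ Suc i" using kle[of "Suc i"] by linarith
      from jump[OF this] show ?thesis unfolding \<tau>i unfolding \<tau>_def * .
    qed
  qed
  have chain: "cmod (v (\<tau> n) - v 0) \<le> (\<Sum>i<Suc n. sqrt (D i))" for n
  proof (induction n)
    case 0 thus ?case using base by simp
  next
    case (Suc n)
    have "cmod (v (\<tau> (Suc n)) - v 0) \<le> cmod (v (\<tau> (Suc n)) - v (\<tau> n)) + cmod (v (\<tau> n) - v 0)"
      using norm_triangle_ineq[of "v (\<tau> (Suc n)) - v (\<tau> n)" "v (\<tau> n) - v 0"] by simp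
    thus ?case using step[of n] Suc by simp
  qed
  have bound: "ennreal ((cmod (v (\<tau> n) - v 0))\<^sup>2) \<le> ennreal S * (\<Sum>i. ennreal (1 / p i) * ennreal (D i))" for n
  proof -
    have "(cmod (v (\<tau> n) - v 0))\<^sup>2 \<le> (\<Sum>i<Suc n. sqrt (D i))\<^sup>2"
      by (intro power_mono chain) auto
    also have "\<dots> = (\<Sum>i<Suc n. sqrt (p i) * sqrt (D i / p i))\<^sup>2"
      using p by (intro arg_cong[where f = "\<lambda>x. x\<^sup>2"] sum.cong refl)
         (simp add: real_sqrt_divide less_imp_neq[OF p, symmetric])
    also have "\<dots> \<le> (\<Sum>i<Suc n. (sqrt (p i))\<^sup>2) * (\<Sum>i<Suc n. (sqrt (D i / p i))\<^sup>2)"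
      by (rule Cauchy_Schwarz_ineq_sum)
    also have "\<dots> = (\<Sum>i<Suc n. p i) * (\<Sum>i<Suc n. D i / p i)"
      using p D0 by (simp add: less_imp_le)
    also have "\<dots> \<le> S * (\<Sum>i<Suc n. D i / p i)"
      using p D0 by (intro mult_right_mono S sum_nonneg) (auto simp: less_imp_le)
    finally have "ennreal ((cmod (v (\<tau> n) - v 0))\<^sup>2) \<le> ennreal (S * (\<Sum>i<Suc n. D i / p i))"
      by (rule ennreal_leI)
    also have "\<dots> = ennreal S * ennreal (\<Sum>i<Suc n. D i / p i)"
      using S[of 0] p D0 by (intro ennreal_mult sum_nonneg) (auto simp: less_imp_le)
    also have "ennreal (\<Sum>i<Suc n. D i / p i) = (\<Sum>i<Suc n. ennreal (D i / p i))"
      using p D0 by (intro sum_ennreal[symmetric]) (auto simp: less_imp_le)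
    also have "\<dots> = (\<Sum>i<Suc n. ennreal (1 / p i) * ennreal (D i))"
      using p D0 by (intro sum.cong refl) (simp add: ennreal_mult[symmetric] less_imp_le)
    also have "\<dots> \<le> (\<Sum>i. ennreal (1 / p i) * ennreal (D i))"
      by (rule sum_le_suminf) auto
    finally show ?thesis by (simp add: mult_left_mono)
  qed
  have "(\<lambda>n. \<tau> n) \<longlonglongrightarrow> t"
  proof (rule LIMSEQ_I)
    fix r :: real assume r: "r > 0"
    obtain n0 where n0: "(1/2::real) ^ n0 < r / b"
      using real_arch_pow_inv[of "r / b" "1/2"] r b by auto
    have "norm (\<tau> n - t) < r" if "n \<ge> n0" for n
    proof -
      have "norm (\<tau> n - t) \<le> b * (1/2) ^ n"
      proof -
        have "\<tau> n - t = (b / 2 ^ n) * (real (k n) - 2 ^ n * (t / b))"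
          using b by (simp add: \<tau>_def field_simps)
        hence "norm (\<tau> n - t) = (b / 2 ^ n) * \<bar>real (k n) - 2 ^ n * (t / b)\<bar>"
          using b by (simp add: abs_mult)
        also have "\<dots> \<le> (b / 2 ^ n) * 1"
          using k_bounds[of n] b by (intro mult_left_mono) (auto simp: abs_le_iff)
        finally show ?thesis by (simp add: power_divide)
      qed
      also have "\<dots> \<le> b * (1/2) ^ n0" using b that by (intro mult_left_mono power_decreasing) auto
      also have "\<dots> < r" using n0 b by (simp add: field_simps)
      finally show ?thesis .
    qed
    thus "\<exists>no. \<forall>n\<ge>no. norm (\<tau> n - t) < r" by blast
  qed
  hence "(\<lambda>n. v (\<tau> n)) \<longlonglongrightarrow> v t"
    using cont by (intro continuous_on_tendsto_compose[OF cont]) auto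
  hence "(\<lambda>n. ennreal ((cmod (v (\<tau> n) - v 0))\<^sup>2)) \<longlonglongrightarrow> ennreal ((cmod (v t - v 0))\<^sup>2)"
    by (intro tendsto_ennrealI tendsto_intros)
  hence "ennreal ((cmod (v t - v 0))\<^sup>2) \<le> ennreal S * (\<Sum>i. ennreal (1 / p i) * ennreal (D i))"
    by (rule LIMSEQ_le_const2) (use bound in auto)
  also have "(\<lambda>i. ennreal (D i)) = (\<lambda>i. \<Sum>m<2^i. ennreal ((cmod (v (real (Suc m) * b / 2 ^ i) - v (real m * b / 2 ^ i)))\<^sup>2))"
    unfolding D_def by (subst sum_ennreal) auto
  finally show ?thesis by (simp add: D_def sum_ennreal)
qed

lemma cis_diff_bound: "(cmod (cis \<alpha> - cis \<beta>))\<^sup>2 \<le> min 4 ((\<alpha> - \<beta>)\<^sup>2)"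
proof -
  have "cmod (cis \<alpha> - cis \<beta>) \<le> 2" using norm_triangle_ineq4[of "cis \<alpha>" "cis \<beta>"] by simp
  from power_mono[OF this, of 2] have 1: "(cmod (cis \<alpha> - cis \<beta>))\<^sup>2 \<le> 4" by simp
  have "(cmod (cis \<alpha> - cis \<beta>))\<^sup>2 = 2 - 2 * cos (\<alpha> - \<beta>)"
    unfolding cmod_power2 cos_diff using sin_cos_squared_add[of \<alpha>] sin_cos_squared_add[of \<beta>]
    by (simp add: power2_eq_square algebra_simps)
  also have "\<dots> = 4 * (sin ((\<alpha> - \<beta>) / 2))\<^sup>2"
    using cos_double_sin[of "(\<alpha> - \<beta>) / 2"] by (simp only: mult_2 field_sum_of_halves)
  also have "\<dots> \<le> 4 * ((\<alpha> - \<beta>) / 2)\<^sup>2"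
    using abs_sin_x_le_abs_x[of "(\<alpha> - \<beta>) / 2"] by (intro mult_left_mono) (simp_all only: abs_le_square_iff)
  also have "\<dots> = (\<alpha> - \<beta>)\<^sup>2" by (simp add: power_divide)
  finally show ?thesis using 1 by simp
qed

text \<open>
  The weights peak at the level \<open>2 ^ i = A\<close> and decay on both sides of it, so that they are summable
  uniformly in \<open>A\<close> and cost no logarithm.
\<close>

definition chain_weight :: "real \<Rightarrow> nat \<Rightarrow> real" where
  "chain_weight A i = min (sqrt 2 ^ i / sqrt A) (sqrt A / sqrt 2 ^ i)"

definition geo_const :: real where "geo_const = 2 * (sqrt 2 + 1) / (sqrt 2 - 1)"

lemma geo_const_pos: "geo_const > 0"
  unfolding geo_const_def by (intro divide_pos_pos mult_pos_pos add_pos_pos) auto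

text \<open>
  On level \<open>i\<close> there are \<open>2 ^ i\<close> increments, each with the multiplier \<open>min 4 ((B / 2 ^ i)\<^sup>2)\<close>; their
  product peaks at \<open>2 ^ i = B\<close>. The weight there exceeds 1 by the factor \<open>sqrt (A / B)\<close>, which turns
  the cost \<open>B\<close> into \<open>sqrt (A * B)\<close>. In the application \<open>A = b * R\<^sup>2\<close> and \<open>B = b * (norm \<xi>)\<^sup>2\<close>.
\<close>

lemma chain_multiplier_sum:
  assumes A: "A > 0" and B: "0 \<le> B" "B \<le> A"
  shows "(\<Sum>i. ennreal (1 / chain_weight A i * 2 ^ i * min 4 ((B / 2 ^ i)\<^sup>2))) \<le> ennreal (8 * geo_const * sqrt (A * B))"
proof (cases "B = 0")
  case True thus ?thesis by simp
next
  case False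
  define \<gamma> \<beta> where "\<gamma> = sqrt A" and "\<beta> = sqrt B"
  have pos: "\<gamma> > 0" "\<beta> > 0" "\<beta> \<le> \<gamma>" using A B False by (auto simp: \<gamma>_def \<beta>_def)
  have B2: "B = \<beta>\<^sup>2" using B by (simp add: \<beta>_def)
  have summand_le: "1 / chain_weight A i * 2 ^ i * min 4 ((B / 2 ^ i)\<^sup>2) \<le> 8 * \<gamma> * \<beta> * min (sqrt 2 ^ i / \<beta>) (\<beta> / sqrt 2 ^ i)" for i
  proof -
    define \<alpha> where "\<alpha> = sqrt 2 ^ i"
    have a: "\<alpha> > 0" by (simp add: \<alpha>_def)
    have two: "(2::real) ^ i = \<alpha>\<^sup>2" unfolding \<alpha>_def by (simp add: power2_eq_square power_mult_distrib[symmetric])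
    have w: "1 / chain_weight A i \<le> \<alpha> / \<gamma> + \<gamma> / \<alpha>"
      using pos a unfolding chain_weight_def \<alpha>_def[symmetric] \<gamma>_def[symmetric] by (auto simp: min_def)
    have "1 / chain_weight A i * 2 ^ i * min 4 ((B / 2 ^ i)\<^sup>2) \<le> (\<alpha> / \<gamma> + \<gamma> / \<alpha>) * \<alpha>\<^sup>2 * min 4 ((\<beta>\<^sup>2 / \<alpha>\<^sup>2)\<^sup>2)"
      unfolding two B2 by (intro mult_right_mono w) auto
    also have "\<dots> \<le> 8 * \<gamma> * \<beta> * min (\<alpha> / \<beta>) (\<beta> / \<alpha>)"
    proof (cases "\<alpha> \<le> \<beta>")
      case True
      have "(\<alpha> / \<gamma> + \<gamma> / \<alpha>) * \<alpha>\<^sup>2 * min 4 ((\<beta>\<^sup>2 / \<alpha>\<^sup>2)\<^sup>2) \<le> (\<alpha> / \<gamma> + \<gamma> / \<alpha>) * \<alpha>\<^sup>2 * 4"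
        using a pos by (intro mult_left_mono) auto
      also have "\<dots> = 4 * (\<alpha> * \<alpha>\<^sup>2 / \<gamma> + \<gamma> * \<alpha>)" using a pos by (simp add: field_simps power2_eq_square)
      also have "\<dots> \<le> 4 * (\<alpha> * \<gamma> + \<gamma> * \<alpha>)"
      proof -
        have "\<alpha>\<^sup>2 \<le> \<gamma>\<^sup>2" using True pos a by (intro power_mono) auto
        hence "\<alpha> * \<alpha>\<^sup>2 / \<gamma> \<le> \<alpha> * \<gamma>\<^sup>2 / \<gamma>" using a pos by (intro divide_right_mono mult_left_mono) auto
        thus ?thesis using pos by (simp add: power2_eq_square)
      qed
      also have "\<dots> = 8 * \<gamma> * \<beta> * (\<alpha> / \<beta>)" using pos by simp
      also have "\<alpha> / \<beta> = min (\<alpha> / \<beta>) (\<beta> / \<alpha>)"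
      proof -
        have "\<alpha> / \<beta> \<le> 1" "1 \<le> \<beta> / \<alpha>" using True a pos by auto
        thus ?thesis by simp
      qed
      finally show ?thesis .
    next
      case False
      have "(\<alpha> / \<gamma> + \<gamma> / \<alpha>) * \<alpha>\<^sup>2 * min 4 ((\<beta>\<^sup>2 / \<alpha>\<^sup>2)\<^sup>2) \<le> (\<alpha> / \<gamma> + \<gamma> / \<alpha>) * \<alpha>\<^sup>2 * (\<beta>\<^sup>2 / \<alpha>\<^sup>2)\<^sup>2"
        using a pos by (intro mult_left_mono) auto
      also have "\<dots> = \<beta>\<^sup>2 * \<beta>\<^sup>2 / (\<gamma> * \<alpha>) + \<gamma> * \<beta>\<^sup>2 / \<alpha> * (\<beta>\<^sup>2 / \<alpha>\<^sup>2)"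
        using a pos by (simp add: field_simps power2_eq_square)
      also have "\<dots> \<le> \<beta>\<^sup>2 * \<gamma>\<^sup>2 / (\<gamma> * \<alpha>) + \<gamma> * \<beta>\<^sup>2 / \<alpha> * 1"
        using False a pos by (intro add_mono divide_right_mono mult_left_mono power_mono) (auto intro!: power_mono)
      also have "\<dots> = 2 * \<gamma> * \<beta>\<^sup>2 / \<alpha>" using a pos by (simp add: field_simps power2_eq_square)
      also have "\<dots> \<le> 8 * \<gamma> * \<beta>\<^sup>2 / \<alpha>" using a pos by (intro divide_right_mono mult_right_mono) auto
      also have "\<dots> = 8 * \<gamma> * \<beta> * (\<beta> / \<alpha>)" by (simp add: power2_eq_square)
      also have "\<beta> / \<alpha> = min (\<alpha> / \<beta>) (\<beta> / \<alpha>)"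
      proof -
        have "1 \<le> \<alpha> / \<beta>" "\<beta> / \<alpha> \<le> 1" using False a pos by auto
        thus ?thesis by simp
      qed
      finally show ?thesis .
    qed
    finally show ?thesis unfolding \<alpha>_def .
  qed
  have "(\<Sum>i. ennreal (1 / chain_weight A i * 2 ^ i * min 4 ((B / 2 ^ i)\<^sup>2)))
      \<le> (\<Sum>i. ennreal (8 * \<gamma> * \<beta>) * ennreal (min (sqrt 2 ^ i / \<beta>) (\<beta> / sqrt 2 ^ i)))"
  proof (rule suminf_le)
    fix i
    have "ennreal (1 / chain_weight A i * 2 ^ i * min 4 ((B / 2 ^ i)\<^sup>2)) \<le> ennreal (8 * \<gamma> * \<beta> * min (sqrt 2 ^ i / \<beta>) (\<beta> / sqrt 2 ^ i))"
      by (rule ennreal_leI[OF summand_le])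
    also have "\<dots> = ennreal (8 * \<gamma> * \<beta>) * ennreal (min (sqrt 2 ^ i / \<beta>) (\<beta> / sqrt 2 ^ i))"
      using pos by (intro ennreal_mult) auto
    finally show "ennreal (1 / chain_weight A i * 2 ^ i * min 4 ((B / 2 ^ i)\<^sup>2)) \<le> ennreal (8 * \<gamma> * \<beta>) * ennreal (min (sqrt 2 ^ i / \<beta>) (\<beta> / sqrt 2 ^ i))" .
  qed auto
  also have "\<dots> = ennreal (8 * \<gamma> * \<beta>) * (\<Sum>i. ennreal (min (sqrt 2 ^ i / \<beta>) (\<beta> / sqrt 2 ^ i)))"
    by (rule ennreal_suminf_cmult)
  also have "\<dots> \<le> ennreal (8 * \<gamma> * \<beta>) * ennreal geo_const"
    unfolding geo_const_def using pos by (intro mult_left_mono two_sided_geometric_suminf) auto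
  also have "\<dots> = ennreal (8 * geo_const * sqrt (A * B))"
    using pos geo_const_pos unfolding \<gamma>_def \<beta>_def
    by (subst ennreal_mult[symmetric]) (auto simp: real_sqrt_mult mult_ac)
  finally show ?thesis .
qed

abbreviation evolve :: "(real ^ 'n \<Rightarrow> real) \<Rightarrow> real \<Rightarrow> (real ^ 'n \<Rightarrow> complex) \<Rightarrow> real ^ 'n \<Rightarrow> complex" where
  "evolve P t G \<equiv> fourier_ext (\<lambda>\<xi>. cis (t * P \<xi>) * G \<xi>)"

lemma fourier_ext_time_continuous:
  fixes G :: "real ^ 'n \<Rightarrow> complex"
  assumes G: "integrable lborel G" and [measurable]: "P \<in> borel_measurable borel"
  shows "continuous_on UNIV (\<lambda>t. evolve P t G x)"
proof -
  have [measurable]: "G \<in> borel_measurable borel" using G by auto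
  have "(\<lambda>n. fourier_ext (\<lambda>\<xi>. cis (X n * P \<xi>) * G \<xi>) x) \<longlonglongrightarrow> fourier_ext (\<lambda>\<xi>. cis (a * P \<xi>) * G \<xi>) x"
    if X: "X \<longlonglongrightarrow> a" for X a
    unfolding fourier_ext_def
  proof (rule integral_dominated_convergence)
    show "integrable lborel (\<lambda>\<xi>. cmod (G \<xi>))" using G by simp
    show "AE \<xi> in lborel. (\<lambda>n. cis (x \<bullet> \<xi>) * (cis (X n * P \<xi>) * G \<xi>)) \<longlonglongrightarrow> cis (x \<bullet> \<xi>) * (cis (a * P \<xi>) * G \<xi>)"
      by (intro AE_I2 tendsto_intros X)
  qed (auto simp: norm_mult)
  thus ?thesis by (auto simp: continuous_on_sequentially comp_def)
qed

text \<open>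
  For frequencies up to \<open>R\<close> the maximum over a time interval of length \<open>b\<close> costs \<open>b * R * norm \<xi>\<close>.
  It is essential that the cost is smaller at lower frequencies: a bound by \<open>b * R\<^sup>2\<close> for all of them
  would not be summable over the time scales.
\<close>

lemma low_frequency_maximal:
  fixes G :: "real ^ 'n \<Rightarrow> complex"
  assumes G: "G \<in> L2_compact" and supp: "\<And>\<xi>. norm \<xi> > R \<Longrightarrow> G \<xi> = 0"
    and b: "b > 0" and R: "R > 0"
    and P[measurable]: "P \<in> borel_measurable borel" and P_le: "\<And>\<xi>. \<bar>P \<xi>\<bar> \<le> (norm \<xi>)\<^sup>2"
  obtains X where "X \<in> borel_measurable borel"
    "\<And>t x. 0 \<le> t \<Longrightarrow> t \<le> b \<Longrightarrow>
       ennreal ((cmod (evolve P t G x - fourier_ext G x))\<^sup>2) \<le> X x"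
    "(\<integral>\<^sup>+x. X x \<partial>lborel) \<le> ennreal ((2*pi) ^ CARD('n) * 8 * geo_const\<^sup>2) *
       (\<integral>\<^sup>+\<xi>. ennreal (b * R * norm \<xi> * (cmod (G \<xi>))\<^sup>2) \<partial>lborel)"
proof -
  let ?C = "ennreal ((2*pi) ^ CARD('n))"
  define A where "A = b * R\<^sup>2"
  have A: "A > 0" using b R by (simp add: A_def)
  note [measurable] = L2_compactD(1)[OF G]
  define p where "p = chain_weight A"
  have p: "p i > 0" for i using A by (auto simp: p_def chain_weight_def)
  have psum: "(\<Sum>i<n. p i) \<le> geo_const" for n
    unfolding p_def chain_weight_def geo_const_def using A by (intro two_sided_geometric_sum) auto
  define v where "v t = evolve P t G" for t
  define X where "X x = ennreal geo_const * (\<Sum>i. ennreal (1 / p i) *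
     (\<Sum>m<2^i. ennreal ((cmod (v (real (Suc m) * b / 2 ^ i) x - v (real m * b / 2 ^ i) x))\<^sup>2)))" for x
  have [measurable]: "v t \<in> borel_measurable borel" for t unfolding v_def by measurable
  have X: "X \<in> borel_measurable borel" unfolding X_def by measurable
  have bound: "ennreal ((cmod (evolve P t G x - fourier_ext G x))\<^sup>2) \<le> X x"
    if "0 \<le> t" "t \<le> b" for t x
  proof -
    have "ennreal ((cmod (v t x - v 0 x))\<^sup>2) \<le> X x"
      unfolding X_def
      by (rule dyadic_chaining[OF _ b that p psum, of "\<lambda>t. v t x"])
         (unfold v_def, intro fourier_ext_time_continuous L2_compact_integrable G P)
    thus ?thesis by (simp add: v_def)
  qed
  have cG: "(\<lambda>\<xi>. cis (t * P \<xi>) * G \<xi>) \<in> L2_compact" for t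
    by (rule L2_compact_bounded_mult[OF G, of _ 1]) auto
  have inc: "(\<integral>\<^sup>+x. ennreal ((cmod (v (real (Suc m) * b / 2 ^ i) x - v (real m * b / 2 ^ i) x))\<^sup>2) \<partial>lborel)
     \<le> ?C * (\<integral>\<^sup>+\<xi>. ennreal (min 4 ((b * (norm \<xi>)\<^sup>2 / 2 ^ i)\<^sup>2) * (cmod (G \<xi>))\<^sup>2) \<partial>lborel)" for m i
  proof -
    let ?t = "real (Suc m) * b / 2 ^ i" and ?t' = "real m * b / 2 ^ i"
    have "(\<integral>\<^sup>+x. ennreal ((cmod (v ?t x - v ?t' x))\<^sup>2) \<partial>lborel)
      = sqn (fourier_ext (\<lambda>\<xi>. cis (?t * P \<xi>) * G \<xi> - cis (?t' * P \<xi>) * G \<xi>))"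
      unfolding sqn_lborel v_def
      by (subst fourier_ext_diff[OF L2_compact_integrable[OF cG] L2_compact_integrable[OF cG]]) simp
    also have "\<dots> = ?C * sqn (\<lambda>\<xi>. cis (?t * P \<xi>) * G \<xi> - cis (?t' * P \<xi>) * G \<xi>)"
      by (intro plancherel L2_compact_diff cG)
    also have "\<dots> \<le> ?C * (\<integral>\<^sup>+\<xi>. ennreal (min 4 ((b * (norm \<xi>)\<^sup>2 / 2 ^ i)\<^sup>2) * (cmod (G \<xi>))\<^sup>2) \<partial>lborel)"
      unfolding sqn_lborel
    proof (intro mult_left_mono nn_integral_mono ennreal_leI)
      fix \<xi>
      have "(cmod (cis (?t * P \<xi>) * G \<xi> - cis (?t' * P \<xi>) * G \<xi>))\<^sup>2 = (cmod (cis (?t * P \<xi>) - cis (?t' * P \<xi>)))\<^sup>2 * (cmod (G \<xi>))\<^sup>2"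
        unfolding left_diff_distrib[symmetric] by (simp add: norm_mult power_mult_distrib)
      also have "\<dots> \<le> min 4 ((?t * P \<xi> - ?t' * P \<xi>)\<^sup>2) * (cmod (G \<xi>))\<^sup>2"
        by (intro mult_right_mono cis_diff_bound) auto
      also have "?t * P \<xi> - ?t' * P \<xi> = b * P \<xi> / 2 ^ i" by (simp add: field_simps)
      also have "(b * P \<xi> / 2 ^ i)\<^sup>2 \<le> (b * (norm \<xi>)\<^sup>2 / 2 ^ i)\<^sup>2"
        unfolding abs_le_square_iff[symmetric]
        using b P_le[of \<xi>] by (simp add: abs_mult divide_right_mono)
      finally show "(cmod (cis (?t * P \<xi>) * G \<xi> - cis (?t' * P \<xi>) * G \<xi>))\<^sup>2 \<le> min 4 ((b * (norm \<xi>)\<^sup>2 / 2 ^ i)\<^sup>2) * (cmod (G \<xi>))\<^sup>2"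
        by (simp add: mult_right_mono min_le_iff_disj)
    qed auto
    finally show ?thesis .
  qed
  have "(\<integral>\<^sup>+x. X x \<partial>lborel) = ennreal geo_const * (\<Sum>i. ennreal (1 / p i) *
     (\<Sum>m<2^i. \<integral>\<^sup>+x. ennreal ((cmod (v (real (Suc m) * b / 2 ^ i) x - v (real m * b / 2 ^ i) x))\<^sup>2) \<partial>lborel))"
    unfolding X_def by (simp add: nn_integral_cmult nn_integral_suminf nn_integral_sum del: sum_ennreal)
  also have "\<dots> \<le> ennreal geo_const * (\<Sum>i. ennreal (1 / p i) *
     (\<Sum>m<(2::nat)^i. ?C * (\<integral>\<^sup>+\<xi>. ennreal (min 4 ((b * (norm \<xi>)\<^sup>2 / 2 ^ i)\<^sup>2) * (cmod (G \<xi>))\<^sup>2) \<partial>lborel)))"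
    by (intro mult_left_mono suminf_le sum_mono inc) auto
  also have "\<dots> = ennreal geo_const * (\<Sum>i. ?C * (\<integral>\<^sup>+\<xi>. ennreal (1 / p i * 2 ^ i * min 4 ((b * (norm \<xi>)\<^sup>2 / 2 ^ i)\<^sup>2)) * ennreal ((cmod (G \<xi>))\<^sup>2) \<partial>lborel))"
  proof -
    have "ennreal (1 / p i) * (\<Sum>m<(2::nat)^i. ?C * (\<integral>\<^sup>+\<xi>. ennreal (min 4 ((b * (norm \<xi>)\<^sup>2 / 2 ^ i)\<^sup>2) * (cmod (G \<xi>))\<^sup>2) \<partial>lborel))
       = ?C * (\<integral>\<^sup>+\<xi>. ennreal (1 / p i * 2 ^ i * min 4 ((b * (norm \<xi>)\<^sup>2 / 2 ^ i)\<^sup>2)) * ennreal ((cmod (G \<xi>))\<^sup>2) \<partial>lborel)" for i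
    proof -
      have "(\<integral>\<^sup>+\<xi>. ennreal (1 / p i * 2 ^ i * min 4 ((b * (norm \<xi>)\<^sup>2 / 2 ^ i)\<^sup>2)) * ennreal ((cmod (G \<xi>))\<^sup>2) \<partial>lborel)
        = (\<integral>\<^sup>+\<xi>. ennreal (1 / p i * 2 ^ i) * ennreal (min 4 ((b * (norm \<xi>)\<^sup>2 / 2 ^ i)\<^sup>2) * (cmod (G \<xi>))\<^sup>2) \<partial>lborel)"
        using p[of i] by (intro nn_integral_cong) (simp add: ennreal_mult[symmetric] mult_ac less_imp_le)
      also have "\<dots> = ennreal (1 / p i * 2 ^ i) * (\<integral>\<^sup>+\<xi>. ennreal (min 4 ((b * (norm \<xi>)\<^sup>2 / 2 ^ i)\<^sup>2) * (cmod (G \<xi>))\<^sup>2) \<partial>lborel)"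
        by (rule nn_integral_cmult) measurable
      also have "ennreal (1 / p i * 2 ^ i) = ennreal (1 / p i) * 2 ^ i"
        using p[of i] by (subst ennreal_mult) (auto simp: ennreal_power[symmetric] less_imp_le)
      finally show ?thesis by (simp add: mult_ac)
    qed
    thus ?thesis by simp
  qed
  also have "\<dots> = ennreal geo_const * (?C * (\<integral>\<^sup>+\<xi>. (\<Sum>i. ennreal (1 / p i * 2 ^ i * min 4 ((b * (norm \<xi>)\<^sup>2 / 2 ^ i)\<^sup>2))) * ennreal ((cmod (G \<xi>))\<^sup>2) \<partial>lborel))"
  proof -
    have "(\<lambda>\<xi>. ennreal (1 / p i * 2 ^ i * min 4 ((b * (norm \<xi>)\<^sup>2 / 2 ^ i)\<^sup>2)) * ennreal ((cmod (G \<xi>))\<^sup>2)) \<in> borel_measurable lborel" for i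
      by measurable
    thus ?thesis
      by (subst ennreal_suminf_cmult, subst nn_integral_suminf[symmetric]) (assumption, simp only: ennreal_suminf_multc)
  qed
  also have "\<dots> \<le> ennreal geo_const * (?C * (\<integral>\<^sup>+\<xi>. ennreal (8 * geo_const) * ennreal (b * R * norm \<xi> * (cmod (G \<xi>))\<^sup>2) \<partial>lborel))"
  proof (intro mult_left_mono nn_integral_mono)
    fix \<xi> :: "real ^ 'n"
    show "(\<Sum>i. ennreal (1 / p i * 2 ^ i * min 4 ((b * (norm \<xi>)\<^sup>2 / 2 ^ i)\<^sup>2))) * ennreal ((cmod (G \<xi>))\<^sup>2)
       \<le> ennreal (8 * geo_const) * ennreal (b * R * norm \<xi> * (cmod (G \<xi>))\<^sup>2)"
    proof (cases "norm \<xi> > R")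
      case True thus ?thesis using supp[OF True] by simp
    next
      case False
      define B where "B = b * (norm \<xi>)\<^sup>2"
      have B: "0 \<le> B" "B \<le> A" unfolding A_def B_def using b False by (auto intro!: mult_left_mono power_mono)
      have "sqrt (A * B) = b * R * norm \<xi>"
        by (rule real_sqrt_unique) (use b R in \<open>auto simp: A_def B_def power2_eq_square\<close>)
      with chain_multiplier_sum[OF A B]
      have "(\<Sum>i. ennreal (1 / p i * 2 ^ i * min 4 ((b * (norm \<xi>)\<^sup>2 / 2 ^ i)\<^sup>2))) \<le> ennreal (8 * geo_const * (b * R * norm \<xi>))"
        unfolding p_def B_def by simp
      from mult_right_mono[OF this, of "ennreal ((cmod (G \<xi>))\<^sup>2)"]
      show ?thesis using b R geo_const_pos by (simp add: ennreal_mult[symmetric] mult_ac)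
    qed
  qed auto
  also have "\<dots> = ennreal ((2*pi) ^ CARD('n) * 8 * geo_const\<^sup>2) *
       (\<integral>\<^sup>+\<xi>. ennreal (b * R * norm \<xi> * (cmod (G \<xi>))\<^sup>2) \<partial>lborel)"
  proof -
    have "ennreal ((2*pi) ^ CARD('n) * 8 * geo_const\<^sup>2) = ennreal geo_const * (?C * ennreal (8 * geo_const))"
      using geo_const_pos by (simp add: ennreal_mult[symmetric] power2_eq_square mult_ac)
    thus ?thesis by (subst nn_integral_cmult) (auto simp: mult_ac)
  qed
  finally show ?thesis using that X bound by blast
qed

lemma suminf_finite_tendsto_0:
  fixes y :: "nat \<Rightarrow> ennreal"
  assumes "(\<Sum>k. y k) < \<infinity>"
  shows "y \<longlonglongrightarrow> 0"
proof -
  have fin: "y k < \<infinity>" for k using ennreal_le_suminf[of y k] assms by (rule order_le_less_trans)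
  have eq: "y k = ennreal (enn2real (y k))" for k using fin[of k] by simp
  have "(\<Sum>k. ennreal (enn2real (y k))) \<noteq> top" using assms eq by simp
  hence "summable (\<lambda>k. enn2real (y k))" by (intro summable_suminf_not_top) auto
  hence "(\<lambda>k. enn2real (y k)) \<longlonglongrightarrow> 0" by (rule summable_LIMSEQ_zero)
  hence "(\<lambda>k. ennreal (enn2real (y k))) \<longlonglongrightarrow> ennreal 0" by (rule tendsto_ennrealI)
  thus ?thesis using eq by simp
qed

lemma AE_tendsto_0_of_summable_integrals:
  fixes Y :: "nat \<Rightarrow> 'a \<Rightarrow> ennreal"
  assumes "\<And>k. Y k \<in> borel_measurable M" and "(\<Sum>k. \<integral>\<^sup>+x. Y k x \<partial>M) < \<infinity>"
  shows "AE x in M. (\<lambda>k. Y k x) \<longlonglongrightarrow> 0"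
  using nn_integral_suminf_finite_AE[OF assms] by eventually_elim (rule suminf_finite_tendsto_0)

lemma ennreal_two_four:
  assumes "c \<ge> 0"
  shows "2 * (ennreal c * (4 * x)) = ennreal (8 * c) * x"
proof -
  have "2 * (ennreal c * (4 * x)) = (2 * 4) * (ennreal c * x)" by (simp only: mult_ac)
  also have "(2::ennreal) * 4 = 8" by simp
  also have "8 * (ennreal c * x) = ennreal (8 * c) * x"
    using assms by (simp add: ennreal_mult mult.assoc)
  finally show ?thesis .
qed

section \<open>The weak-type condition suffices\<close>

text \<open>
  For band-limited \<open>A\<close> the evolution is an absolutely convergent integral, defined at every point. The
  remainder is controlled only in norm, and its representative \<open>h\<close> may depend on \<open>\<tau>\<close> arbitrarily.
\<close>

lemma propagator_split:
  fixes F A :: "real ^ 'n \<Rightarrow> complex"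
  assumes P[measurable]: "P \<in> borel_measurable borel"
    and F: "F \<in> L2_borel" and FAE: "AE \<xi> in lebesgue. fourier_L2 f \<xi> = F \<xi>"
    and fm: "fourier_L2 f \<in> L2_space" and Ff: "is_ext F f" and A: "A \<in> L2_compact"
  obtains h where "h \<in> L2_borel"
    "sqn h \<le> ennreal (8 * (2*pi) ^ CARD('n)) * sqn (\<lambda>\<xi>. F \<xi> - A \<xi>)"
    "AE x in lebesgue. propagator P \<tau> f x - f x = (evolve P \<tau> A x - fourier_ext A x) + h x"
proof -
  let ?C = "ennreal ((2*pi) ^ CARD('n))"
  define m where "m \<xi> = cis (\<tau> * P \<xi>) - 1" for \<xi>
  define T where "T \<xi> = F \<xi> - A \<xi>" for \<xi>
  have T: "T \<in> L2_borel" unfolding T_def by (intro L2_borel_diff F L2_compact_borel A)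
  have [measurable]: "m \<in> borel_measurable borel" unfolding m_def by measurable
  have m2: "cmod (m \<xi>) \<le> 2" for \<xi> unfolding m_def using norm_triangle_ineq4[of "cis (\<tau> * P \<xi>)" 1] by simp
  have mT: "(\<lambda>\<xi>. m \<xi> * T \<xi>) \<in> L2_borel" by (rule L2_borel_bounded_mult[OF T, of _ 2]) (auto simp: m2)
  obtain h where h: "is_ext (\<lambda>\<xi>. m \<xi> * T \<xi>) h" "h \<in> L2_borel" by (rule is_ext_exists[OF mT])
  have "sqn h \<le> 2 * (?C * sqn (\<lambda>\<xi>. m \<xi> * T \<xi>))" by (rule is_ext_norm[OF h(1) mT])
  also have "sqn (\<lambda>\<xi>. m \<xi> * T \<xi>) \<le> sqn (\<lambda>\<xi>. 2 * T \<xi>)"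
    using m2 by (intro sqn_mono) (auto simp: norm_mult intro!: mult_right_mono)
  also have "sqn (\<lambda>\<xi>. 2 * T \<xi>) = 4 * sqn T" using L2_borelD(1)[OF T] by (subst sqn_cmult) auto
  also have "2 * (?C * (4 * sqn T)) = ennreal (8 * (2*pi) ^ CARD('n)) * sqn T"
    by (rule ennreal_two_four) simp
  finally have bound: "sqn h \<le> ennreal (8 * (2*pi) ^ CARD('n)) * sqn T" by (simp add: mult_left_mono)
  have cF: "(\<lambda>\<xi>. cis (\<tau> * P \<xi>) * F \<xi>) \<in> L2_borel" by (rule L2_borel_bounded_mult[OF F, of _ 1]) auto
  have cA: "(\<lambda>\<xi>. cis (\<tau> * P \<xi>) * A \<xi>) \<in> L2_compact" by (rule L2_compact_bounded_mult[OF A, of _ 1]) auto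
  have e1: "is_ext (\<lambda>\<xi>. cis (\<tau> * P \<xi>) * F \<xi> - F \<xi>) (\<lambda>x. propagator P \<tau> f x - f x)"
    by (intro is_ext_diff propagator_is_ext F FAE fm P Ff cF)
  have e2: "is_ext (\<lambda>\<xi>. cis (\<tau> * P \<xi>) * A \<xi> - A \<xi>) (\<lambda>x. evolve P \<tau> A x - fourier_ext A x)"
    by (intro is_ext_diff is_ext_compact L2_compact_borel cA A)
  have "is_ext (\<lambda>\<xi>. (cis (\<tau> * P \<xi>) * F \<xi> - F \<xi>) - (cis (\<tau> * P \<xi>) * A \<xi> - A \<xi>))
     (\<lambda>x. (propagator P \<tau> f x - f x) - (evolve P \<tau> A x - fourier_ext A x))"
    by (intro is_ext_diff[OF e1 e2] L2_borel_diff L2_compact_borel cF F cA A)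
  also have "(\<lambda>\<xi>. (cis (\<tau> * P \<xi>) * F \<xi> - F \<xi>) - (cis (\<tau> * P \<xi>) * A \<xi> - A \<xi>)) = (\<lambda>\<xi>. m \<xi> * T \<xi>)"
    by (auto simp: m_def T_def algebra_simps)
  finally have "AE x in lebesgue. (propagator P \<tau> f x - f x) - (evolve P \<tau> A x - fourier_ext A x) = h x"
    by (rule is_ext_unique[OF _ h(1) L2_borelD(1)[OF mT]])
  hence "AE x in lebesgue. propagator P \<tau> f x - f x = (evolve P \<tau> A x - fourier_ext A x) + h x"
    by eventually_elim (simp add: algebra_simps)
  thus ?thesis using h(2) bound unfolding T_def by (intro that)
qed

definition dyadic_block :: "(nat \<Rightarrow> real) \<Rightarrow> nat \<Rightarrow> nat set" where
  "dyadic_block t l = {n. (1/2) ^ Suc l < t n \<and> t n \<le> (1/2) ^ l}"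

lemma dyadic_block_exists:
  assumes "0 < t n" "t n < 1"
  obtains l where "n \<in> dyadic_block t l"
proof -
  obtain l0 where l0: "(1/2::real) ^ Suc l0 < t n"
  proof -
    obtain k where "(1/2::real) ^ k < t n" using real_arch_pow_inv[OF assms(1), of "1/2"] by auto
    moreover have "(1/2::real) ^ Suc k \<le> (1/2) ^ k" by simp
    ultimately show ?thesis using that[of k] by linarith
  qed
  define l where "l = (LEAST l. (1/2::real) ^ Suc l < t n)"
  have 1: "(1/2::real) ^ Suc l < t n" unfolding l_def by (rule LeastI[of _ l0]) (rule l0)
  have 2: "t n \<le> (1/2) ^ l"
  proof (cases l)
    case 0 thus ?thesis using assms by simp
  next
    case (Suc k)
    hence "\<not> (1/2::real) ^ Suc k < t n" using not_less_Least[of k "\<lambda>l. (1/2::real) ^ Suc l < t n"] unfolding l_def by auto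
    thus ?thesis using Suc by simp
  qed
  show ?thesis using that 1 2 by (auto simp: dyadic_block_def)
qed

lemma weak_ell_dyadic_block:
  assumes "t \<in> weak_ell r"
  obtains K where "K \<ge> 0" "\<And>l. finite (dyadic_block t l)"
    "\<And>l. real (card (dyadic_block t l)) \<le> K * 2 powr (r * real l)"
proof -
  have fin: "finite {n. t n > b}" if "b > 0" for b using assms that by (auto simp: weak_ell_def)
  obtain K where K: "\<And>b. b > 0 \<Longrightarrow> b powr r * real (card {n. t n > b}) \<le> K"
    using assms unfolding weak_ell_def bdd_above_def by auto
  have sub: "dyadic_block t l \<subseteq> {n. t n > (1/2) ^ Suc l}" for l by (auto simp: dyadic_block_def)
  have f: "finite (dyadic_block t l)" for l by (rule finite_subset[OF sub fin]) simp
  have "real (card (dyadic_block t l)) \<le> (max K 0 * 2 powr r) * 2 powr (r * real l)" for l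
  proof -
    let ?b = "(1/2::real) ^ Suc l"
    have b: "?b powr r = 2 powr (- r * real (Suc l))"
    proof -
      have e: "?b = 2 powr (- real (Suc l))"
        by (simp only: powr_minus_divide powr_realpow[of 2, OF zero_less_numeral] power_one_over)
      show ?thesis unfolding e powr_powr by (simp add: algebra_simps)
    qed
    have "real (card (dyadic_block t l)) \<le> real (card {n. t n > ?b})"
      by (intro of_nat_mono card_mono fin sub) simp
    also have "\<dots> = 2 powr (r * real (Suc l)) * (?b powr r * real (card {n. t n > ?b}))"
      unfolding b by (simp add: mult.assoc[symmetric] powr_add[symmetric])
    also have "\<dots> \<le> 2 powr (r * real (Suc l)) * max K 0"
      using K[of ?b] by (intro mult_left_mono) auto
    also have "\<dots> = (max K 0 * 2 powr r) * 2 powr (r * real l)"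
      by (simp add: powr_add distrib_left mult_ac)
    finally show ?thesis .
  qed
  thus ?thesis using f that[of "max K 0 * 2 powr r"] by auto
qed

text \<open>
  The critical radius for times of size \<open>b = (1/2) ^ l\<close>: it satisfies \<open>b * R\<^sup>2 = b powr (- r) = R powr (2 * s)\<close>.
\<close>

definition block_radius :: "real \<Rightarrow> nat \<Rightarrow> real" where
  "block_radius s l = 2 powr (real l / (2 * (1 - s)))"

text \<open>
  The cost of block \<open>l\<close> at frequencies of size \<open>x\<close>: that of \<open>low_frequency_maximal\<close> below the critical
  radius, the number of times in the block above it.
\<close>

definition block_multiplier :: "real \<Rightarrow> real \<Rightarrow> real \<Rightarrow> nat \<Rightarrow> real \<Rightarrow> real" where
  "block_multiplier s L K l x = (if x \<le> block_radius s l then L * ((1/2) ^ l * block_radius s l * x)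
     else K * 2 powr (s / (1 - s) * real l))"

lemma block_multiplier_measurable [measurable]: "block_multiplier s L K l \<in> borel_measurable borel"
  unfolding block_multiplier_def[abs_def] by measurable

text \<open>
  Relative to \<open>x powr (2 * s)\<close>, block \<open>l\<close> costs \<open>(x / R) powr (1 - 2 * s)\<close> below and \<open>(R / x) powr (2 * s)\<close>
  above the critical radius \<open>R\<close>. Both exponents are positive as \<open>0 < s < 1/2\<close>, so the sum over
  \<open>l\<close> is a two-sided geometric series.
\<close>

lemma block_frequency_sum:
  fixes s K L :: real
  assumes s: "0 < s" "s < 1/2" and K: "K \<ge> 0" and L: "L \<ge> 0"
  obtains M where "M \<ge> 0" "\<And>x. x \<ge> 0 \<Longrightarrow>
    (\<Sum>l. ennreal (block_multiplier s L K l x)) \<le> ennreal (M * x powr (2 * s))"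
proof -
  define R where "R = block_radius s"
  note R_eq = R_def block_radius_def
  \<comment> \<open>The smaller of the two decay exponents serves on both sides.\<close>
  define \<theta> where "\<theta> = min (2 * s) (1 - 2 * s)"
  have th: "\<theta> > 0" "\<theta> \<le> 2 * s" "\<theta> \<le> 1 - 2 * s" using s by (auto simp: \<theta>_def)
  define q where "q = 2 powr (\<theta> / (2 * (1 - s)))"
  have q: "q > 1" unfolding q_def using th s by simp
  define g where "g = 2 * (q + 1) / (q - 1)"
  have g: "g \<ge> 0" using q by (simp add: g_def)
  have Rpos: "R l > 0" for l by (simp add: R_eq)
  have half: "(1/2) ^ l = R l powr (- 2 * (1 - s))" for l
  proof -
    have "a / (2 * d) * (- 2 * d) = - a" if "d \<noteq> 0" for a d :: real using that by simp
    from this[of "1 - s" "real l"] have "R l powr (- 2 * (1 - s)) = 2 powr (- real l)"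
      using s by (simp only: R_eq powr_powr)
    also have "\<dots> = (1/2) ^ l" by (simp only: powr_minus_divide powr_realpow[of 2, OF zero_less_numeral] power_one_over)
    finally show ?thesis by simp
  qed
  have cnt: "2 powr (s / (1 - s) * real l) = R l powr (2 * s)" for l
  proof -
    have "a / (2 * d) * (2 * b) = b / d * a" if "d \<noteq> 0" for a b d :: real using that by (simp add: field_simps)
    from this[of "1 - s" "real l" s] show ?thesis using s by (simp only: R_eq powr_powr)
  qed
  have qR: "q ^ l = R l powr \<theta>" for l
  proof -
    have "q ^ l = q powr real l" using q by (intro powr_realpow[symmetric]) simp
    thus ?thesis by (simp add: q_def R_eq powr_powr mult.commute)
  qed
  have main: "(\<Sum>l. ennreal (block_multiplier s L K l x))
     \<le> ennreal ((K + L) * g * x powr (2 * s))" if x0: "x \<ge> 0" for x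
  proof (cases "x = 0")
    case True
    thus ?thesis using Rpos[THEN less_imp_le] by (simp add: block_multiplier_def flip: R_def)
  next
    case False
    hence x: "x > 0" using x0 by simp
    have summand_le: "block_multiplier s L K l x
       \<le> (K + L) * x powr (2 * s) * min (q ^ l / x powr \<theta>) (x powr \<theta> / q ^ l)" for l
    proof -
      define y where "y = R l / x"
      have y: "y > 0" using x Rpos[of l] by (simp add: y_def)
      have Ry: "R l = x * y" using x by (simp add: y_def)
      have m: "min (q ^ l / x powr \<theta>) (x powr \<theta> / q ^ l) = min (y powr \<theta>) (y powr (- \<theta>))"
        unfolding qR y_def using x Rpos[of l] by (simp add: powr_divide powr_minus_divide)
      show ?thesis
      proof (cases "x \<le> R l")
        case True
        hence y1: "y \<ge> 1" using x by (simp add: y_def)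
        have "(1/2) ^ l * R l * x = (x * y) powr (- 2 * (1 - s)) * (x * y) * x" unfolding half Ry ..
        also have "\<dots> = x powr (- 2 * (1 - s)) * y powr (- 2 * (1 - s)) * (x powr 1 * y powr 1) * x powr 1"
          using x y by (simp add: powr_mult)
        also have "\<dots> = (x powr (- 2 * (1 - s)) * x powr 1 * x powr 1) * (y powr (- 2 * (1 - s)) * y powr 1)"
          by (simp only: mult_ac)
        also have "\<dots> = x powr (2 * s) * y powr (- (1 - 2 * s))"
          by (simp only: powr_add[symmetric]) (simp add: algebra_simps)
        also have "\<dots> \<le> x powr (2 * s) * y powr (- \<theta>)"
          using y1 th by (intro mult_left_mono powr_mono) auto
        also have "y powr (- \<theta>) = min (y powr \<theta>) (y powr (- \<theta>))"
        proof -
          have "y powr (- \<theta>) \<le> y powr \<theta>" using y1 th by (intro powr_mono) auto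
          thus ?thesis by simp
        qed
        finally have "(1/2) ^ l * R l * x \<le> x powr (2 * s) * min (y powr \<theta>) (y powr (- \<theta>))" .
        hence "L * ((1/2) ^ l * R l * x) \<le> (K + L) * (x powr (2 * s) * min (y powr \<theta>) (y powr (- \<theta>)))"
          by (rule mult_mono[rotated]) (use K L x Rpos[of l] in auto)
        thus ?thesis using True unfolding m block_multiplier_def R_def[symmetric] by (simp add: mult.assoc)
      next
        case False
        hence y1: "y \<le> 1" using x by (simp add: y_def)
        have "2 powr (s / (1 - s) * real l) = x powr (2 * s) * y powr (2 * s)"
          unfolding cnt Ry using x y by (simp add: powr_mult)
        also have "\<dots> \<le> x powr (2 * s) * y powr \<theta>"
          using y y1 th by (intro mult_left_mono powr_mono') auto
        also have "y powr \<theta> = min (y powr \<theta>) (y powr (- \<theta>))"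
        proof -
          have "y powr \<theta> \<le> y powr (- \<theta>)" using y y1 th by (intro powr_mono') auto
          thus ?thesis by simp
        qed
        finally have "2 powr (s / (1 - s) * real l) \<le> x powr (2 * s) * min (y powr \<theta>) (y powr (- \<theta>))" .
        hence "K * 2 powr (s / (1 - s) * real l) \<le> (K + L) * (x powr (2 * s) * min (y powr \<theta>) (y powr (- \<theta>)))"
          using K L by (intro mult_mono) auto
        thus ?thesis using False unfolding m block_multiplier_def R_def[symmetric] by (simp add: mult.assoc)
      qed
    qed
    have "(\<Sum>l. ennreal (block_multiplier s L K l x))
       \<le> (\<Sum>l. ennreal ((K + L) * x powr (2 * s)) * ennreal (min (q ^ l / x powr \<theta>) (x powr \<theta> / q ^ l)))"
    proof (rule suminf_le)
      fix l
      show "ennreal (block_multiplier s L K l x)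
        \<le> ennreal ((K + L) * x powr (2 * s)) * ennreal (min (q ^ l / x powr \<theta>) (x powr \<theta> / q ^ l))"
        using ennreal_leI[OF summand_le[of l]] by (subst ennreal_mult[symmetric]) (use K L q in auto)
    qed auto
    also have "\<dots> = ennreal ((K + L) * x powr (2 * s)) * (\<Sum>l. ennreal (min (q ^ l / x powr \<theta>) (x powr \<theta> / q ^ l)))"
      by (rule ennreal_suminf_cmult)
    also have "\<dots> \<le> ennreal ((K + L) * x powr (2 * s)) * ennreal g"
      unfolding g_def using q x by (intro mult_left_mono two_sided_geometric_suminf) auto
    also have "\<dots> = ennreal ((K + L) * g * x powr (2 * s))"
      using K L g by (subst ennreal_mult[symmetric]) (auto simp: mult_ac)
    finally show ?thesis .
  qed
  show ?thesis
  proof (rule that)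
    show "(K + L) * g \<ge> 0" using K L g by simp
  qed (rule main)
qed

text \<open>
  \<open>Y l\<close> majorises the squared deviation from \<open>f\<close> at all times of block \<open>l\<close>.
\<close>

theorem convergence_of_weak_ell:
  fixes P :: "real ^ 'n \<Rightarrow> real" and f :: "real ^ 'n \<Rightarrow> complex"
  assumes P[measurable]: "P \<in> borel_measurable borel" and P_le: "\<And>\<xi>. \<bar>P \<xi>\<bar> \<le> (norm \<xi>)\<^sup>2"
    and s: "0 < s" "s < 1/2"
    and t01: "\<And>n. t n \<in> {0<..<1}" and t0: "t \<longlonglongrightarrow> 0" and tw: "t \<in> weak_ell (s / (1 - s))"
    and f: "f \<in> sobolev_space s"
  shows "AE x in lebesgue. (\<lambda>n. propagator P (t n) f x) \<longlonglongrightarrow> f x"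
proof -
  let ?C = "ennreal ((2*pi) ^ CARD('n))"
  let ?r = "s / (1 - s)"
  have fL: "f \<in> L2_space" using f by (simp add: sobolev_space_def)
  obtain F where F: "F \<in> L2_borel" and FAE: "AE \<xi> in lebesgue. fourier_L2 f \<xi> = F \<xi>"
    and Ff: "is_ext F f" and fm: "fourier_L2 f \<in> L2_space"
    by (rule fourier_L2_inverse[OF fL])
  note [measurable] = L2_borelD(1)[OF F]
  have sob: "(\<integral>\<^sup>+ \<xi>. ennreal ((1 + (norm \<xi>)\<^sup>2) powr s * (cmod (F \<xi>))\<^sup>2) \<partial>lborel) < \<infinity>"
  proof -
    have "(\<integral>\<^sup>+ \<xi>. ennreal ((1 + (norm \<xi>)\<^sup>2) powr s * (cmod (F \<xi>))\<^sup>2) \<partial>lborel)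
      = (\<integral>\<^sup>+ \<xi>. ennreal ((1 + (norm \<xi>)\<^sup>2) powr s * (cmod (F \<xi>))\<^sup>2) \<partial>lebesgue)"
      by (simp add: nn_integral_completion)
    also have "\<dots> = (\<integral>\<^sup>+ \<xi>. ennreal ((1 + (norm \<xi>)\<^sup>2) powr s * (cmod (fourier_L2 f \<xi>))\<^sup>2) \<partial>lebesgue)"
      by (rule nn_integral_cong_AE) (use FAE in eventually_elim, simp)
    also have "\<dots> < \<infinity>" using f by (simp add: sobolev_space_def)
    finally show ?thesis .
  qed
  obtain K where K: "K \<ge> 0" and fin: "\<And>l. finite (dyadic_block t l)"
    and card: "\<And>l. real (card (dyadic_block t l)) \<le> K * 2 powr (?r * real l)"
    using weak_ell_dyadic_block[OF tw] by blast
  define R where "R = block_radius s"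
  have Rpos: "R l > 0" for l by (simp add: R_def block_radius_def)
  define G where "G l = trunc (R l) F" for l
  \<comment> \<open>The frequencies of block \<open>l\<close> above the critical radius.\<close>
  define H where "H l = (\<lambda>\<xi>. F \<xi> - G l \<xi>)" for l
  have G: "G l \<in> L2_compact" for l unfolding G_def by (rule trunc_L2_compact[OF F])
  have H: "H l \<in> L2_borel" for l unfolding H_def by (intro L2_borel_diff F L2_compact_borel G)
  note [measurable] = L2_compactD(1)[OF G] L2_borelD(1)[OF H]
  define K0 where "K0 = (2*pi) ^ CARD('n) * 8 * geo_const\<^sup>2"
  have K0: "K0 \<ge> 0" using geo_const_pos by (auto simp: K0_def)
  define Q where "Q l X \<longleftrightarrow> X \<in> borel_measurable borel \<and>
    (\<forall>\<tau> x. 0 \<le> \<tau> \<longrightarrow> \<tau> \<le> (1/2)^l \<longrightarrow>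
       ennreal ((cmod (evolve P \<tau> (G l) x - fourier_ext (G l) x))\<^sup>2) \<le> X x) \<and>
    (\<integral>\<^sup>+x. X x \<partial>lborel) \<le> ennreal K0 * (\<integral>\<^sup>+\<xi>. ennreal ((1/2)^l * R l * norm \<xi> * (cmod (G l \<xi>))\<^sup>2) \<partial>lborel)" for l X
  have "\<exists>X. Q l X" for l
  proof -
    have supp: "G l \<xi> = 0" if "norm \<xi> > R l" for \<xi> using that by (simp add: G_def trunc_def indicator_def)
    have pos: "(1/2::real) ^ l > 0" by simp
    show ?thesis
      by (rule low_frequency_maximal[OF G[of l] supp pos Rpos[of l] P P_le]) (auto simp: K0_def Q_def)
  qed
  then obtain X where "\<And>l. Q l (X l)" by metis
  hence Xm: "\<And>l. X l \<in> borel_measurable borel"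
    and X: "\<And>l \<tau> x. 0 \<le> \<tau> \<Longrightarrow> \<tau> \<le> (1/2)^l \<Longrightarrow>
       ennreal ((cmod (evolve P \<tau> (G l) x - fourier_ext (G l) x))\<^sup>2) \<le> X l x"
    and Xi: "\<And>l. (\<integral>\<^sup>+x. X l x \<partial>lborel) \<le> ennreal K0 * (\<integral>\<^sup>+\<xi>. ennreal ((1/2)^l * R l * norm \<xi> * (cmod (G l \<xi>))\<^sup>2) \<partial>lborel)"
    by (auto simp: Q_def)
  note [measurable] = Xm
  define good where "good n l h \<longleftrightarrow> h \<in> L2_borel \<and>
    sqn h \<le> ennreal (8 * (2*pi) ^ CARD('n)) * sqn (H l) \<and>
    (AE x in lebesgue. propagator P (t n) f x - f x = (evolve P (t n) (G l) x - fourier_ext (G l) x) + h x)" for n l h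
  have "\<exists>h. good n l h" for n l
    by (rule propagator_split[OF P F FAE fm Ff G[of l], of "t n"]) (auto simp: good_def H_def)
  then obtain h where "\<And>n l. good n l (h n l)" by metis
  hence hL: "\<And>n l. h n l \<in> L2_borel"
    and sqnh: "\<And>n l. sqn (h n l) \<le> ennreal (8 * (2*pi) ^ CARD('n)) * sqn (H l)"
    and split: "\<And>n l. AE x in lebesgue. propagator P (t n) f x - f x
      = (evolve P (t n) (G l) x - fourier_ext (G l) x) + h n l x"
    by (auto simp: good_def)
  note [measurable] = L2_borelD(1)[OF hL]
  define Y where "Y l x = 2 * X l x + 2 * (\<Sum>n\<in>dyadic_block t l. ennreal ((cmod (h n l x))\<^sup>2))" for l x
  have [measurable]: "Y l \<in> borel_measurable borel" for l unfolding Y_def by measurable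
  define L1 where "L1 = 2 * K0"
  define K1 where "K1 = 16 * (2*pi) ^ CARD('n) * K"
  have L1: "L1 \<ge> 0" and K1: "K1 \<ge> 0" using K0 K by (auto simp: L1_def K1_def)
  have Yint: "(\<integral>\<^sup>+x. Y l x \<partial>lborel) \<le> (\<integral>\<^sup>+\<xi>. ennreal (block_multiplier s L1 K1 l (norm \<xi>)) * ennreal ((cmod (F \<xi>))\<^sup>2) \<partial>lborel)" for l
  proof -
    have "(\<integral>\<^sup>+x. Y l x \<partial>lborel) = 2 * (\<integral>\<^sup>+x. X l x \<partial>lborel) + 2 * (\<Sum>n\<in>dyadic_block t l. sqn (h n l))"
      unfolding Y_def sqn_lborel by (simp add: nn_integral_add nn_integral_cmult nn_integral_sum del: sum_ennreal)
    also have "\<dots> \<le> 2 * (ennreal K0 * (\<integral>\<^sup>+\<xi>. ennreal ((1/2)^l * R l * norm \<xi> * (cmod (G l \<xi>))\<^sup>2) \<partial>lborel))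
      + 2 * (\<Sum>n\<in>dyadic_block t l. ennreal (8 * (2*pi) ^ CARD('n)) * sqn (H l))"
      by (intro add_mono mult_left_mono Xi sum_mono sqnh) auto
    also have "(\<Sum>n\<in>dyadic_block t l. ennreal (8 * (2*pi) ^ CARD('n)) * sqn (H l))
       = ennreal (real (card (dyadic_block t l))) * (ennreal (8 * (2*pi) ^ CARD('n)) * sqn (H l))"
      by (simp add: ennreal_of_nat_eq_real_of_nat)
    also have "\<dots> \<le> ennreal (K * 2 powr (?r * real l)) * (ennreal (8 * (2*pi) ^ CARD('n)) * sqn (H l))"
      by (intro mult_right_mono ennreal_leI card) auto
    also have "2 * (ennreal K0 * (\<integral>\<^sup>+\<xi>. ennreal ((1/2)^l * R l * norm \<xi> * (cmod (G l \<xi>))\<^sup>2) \<partial>lborel))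
      = (\<integral>\<^sup>+\<xi>. ennreal (L1 * ((1/2)^l * R l * norm \<xi>)) * ennreal ((cmod (G l \<xi>))\<^sup>2) \<partial>lborel)"
    proof -
      have "(\<integral>\<^sup>+\<xi>. ennreal (L1 * ((1/2)^l * R l * norm \<xi>)) * ennreal ((cmod (G l \<xi>))\<^sup>2) \<partial>lborel)
         = (\<integral>\<^sup>+\<xi>. ennreal (2 * K0) * ennreal ((1/2)^l * R l * norm \<xi> * (cmod (G l \<xi>))\<^sup>2) \<partial>lborel)"
        using K0 Rpos[of l] by (intro nn_integral_cong) (simp add: L1_def ennreal_mult[symmetric] mult_ac less_imp_le)
      also have "\<dots> = ennreal (2 * K0) * (\<integral>\<^sup>+\<xi>. ennreal ((1/2)^l * R l * norm \<xi> * (cmod (G l \<xi>))\<^sup>2) \<partial>lborel)"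
        by (rule nn_integral_cmult) measurable
      finally show ?thesis using K0 by (simp add: ennreal_mult mult.assoc)
    qed
    also have "2 * (ennreal (K * 2 powr (?r * real l)) * (ennreal (8 * (2*pi) ^ CARD('n)) * sqn (H l)))
      = (\<integral>\<^sup>+\<xi>. ennreal (K1 * 2 powr (?r * real l)) * ennreal ((cmod (H l \<xi>))\<^sup>2) \<partial>lborel)"
    proof -
      have "ennreal (K1 * 2 powr (?r * real l)) = 2 * (ennreal (K * 2 powr (?r * real l)) * ennreal (8 * (2*pi) ^ CARD('n)))"
      proof -
        have "2 * (ennreal (K * 2 powr (?r * real l)) * ennreal (8 * (2*pi) ^ CARD('n)))
          = ennreal (2 * (K * 2 powr (?r * real l) * (8 * (2*pi) ^ CARD('n))))"
        proof -
          have "2 * (ennreal a * ennreal b) = ennreal (2 * (a * b))" if "a \<ge> 0" "b \<ge> 0" for a b :: real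
            using that by (simp add: ennreal_mult)
          from this[of "K * 2 powr (?r * real l)" "8 * (2*pi) ^ CARD('n)"] show ?thesis using K by simp
        qed
        also have "2 * (K * 2 powr (?r * real l) * (8 * (2*pi) ^ CARD('n))) = K1 * 2 powr (?r * real l)"
          by (simp add: K1_def)
        finally show ?thesis by simp
      qed
      moreover have "(\<integral>\<^sup>+\<xi>. ennreal (K1 * 2 powr (?r * real l)) * ennreal ((cmod (H l \<xi>))\<^sup>2) \<partial>lborel)
         = ennreal (K1 * 2 powr (?r * real l)) * sqn (H l)"
        unfolding sqn_lborel by (rule nn_integral_cmult) measurable
      ultimately show ?thesis by (simp add: mult.assoc)
    qed
    also have "(\<integral>\<^sup>+\<xi>. ennreal (L1 * ((1/2)^l * R l * norm \<xi>)) * ennreal ((cmod (G l \<xi>))\<^sup>2) \<partial>lborel)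
       + (\<integral>\<^sup>+\<xi>. ennreal (K1 * 2 powr (?r * real l)) * ennreal ((cmod (H l \<xi>))\<^sup>2) \<partial>lborel)
      = (\<integral>\<^sup>+\<xi>. ennreal (L1 * ((1/2)^l * R l * norm \<xi>)) * ennreal ((cmod (G l \<xi>))\<^sup>2)
           + ennreal (K1 * 2 powr (?r * real l)) * ennreal ((cmod (H l \<xi>))\<^sup>2) \<partial>lborel)"
      by (rule nn_integral_add[symmetric]) measurable
    also have "\<dots> = (\<integral>\<^sup>+\<xi>. ennreal (block_multiplier s L1 K1 l (norm \<xi>)) * ennreal ((cmod (F \<xi>))\<^sup>2) \<partial>lborel)"
      by (intro nn_integral_cong) (auto simp: G_def H_def trunc_def indicator_def block_multiplier_def R_def)
    finally show ?thesis by (simp add: add_left_mono mult_left_mono)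
  qed
  obtain M where M: "M \<ge> 0" and Mb: "\<And>x. x \<ge> 0 \<Longrightarrow>
    (\<Sum>l. ennreal (block_multiplier s L1 K1 l x)) \<le> ennreal (M * x powr (2 * s))"
    by (rule block_frequency_sum[OF s K1 L1]) blast
  have "(\<Sum>l. \<integral>\<^sup>+x. Y l x \<partial>lborel) \<le> (\<Sum>l. \<integral>\<^sup>+\<xi>. ennreal (block_multiplier s L1 K1 l (norm \<xi>)) * ennreal ((cmod (F \<xi>))\<^sup>2) \<partial>lborel)"
    by (intro suminf_le Yint) auto
  also have "\<dots> = (\<integral>\<^sup>+\<xi>. (\<Sum>l. ennreal (block_multiplier s L1 K1 l (norm \<xi>))) * ennreal ((cmod (F \<xi>))\<^sup>2) \<partial>lborel)"
  proof -
    have "(\<lambda>\<xi>. ennreal (block_multiplier s L1 K1 l (norm \<xi>)) * ennreal ((cmod (F \<xi>))\<^sup>2)) \<in> borel_measurable lborel" for l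
      by measurable
    thus ?thesis
      by (subst nn_integral_suminf[symmetric]) (assumption, simp only: ennreal_suminf_multc)
  qed
  also have "\<dots> \<le> (\<integral>\<^sup>+\<xi>. ennreal M * ennreal ((1 + (norm \<xi>)\<^sup>2) powr s * (cmod (F \<xi>))\<^sup>2) \<partial>lborel)"
  proof (intro nn_integral_mono)
    fix \<xi> :: "real ^ 'n"
    have "(norm \<xi>) powr (2 * s) = ((norm \<xi>)\<^sup>2) powr s"
      by (cases "\<xi> = 0") (auto simp: powr_powr simp flip: powr_numeral)
    also have "\<dots> \<le> (1 + (norm \<xi>)\<^sup>2) powr s" using s by (intro powr_mono2) auto
    finally have "ennreal (M * norm \<xi> powr (2 * s)) \<le> ennreal (M * (1 + (norm \<xi>)\<^sup>2) powr s)"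
      using M by (intro ennreal_leI mult_left_mono)
    from order_trans[OF Mb[OF norm_ge_zero] this] have "(\<Sum>l. ennreal (block_multiplier s L1 K1 l (norm \<xi>))) \<le> ennreal (M * (1 + (norm \<xi>)\<^sup>2) powr s)" .
    from mult_right_mono[OF this, of "ennreal ((cmod (F \<xi>))\<^sup>2)"]
    show "(\<Sum>l. ennreal (block_multiplier s L1 K1 l (norm \<xi>))) * ennreal ((cmod (F \<xi>))\<^sup>2) \<le> ennreal M * ennreal ((1 + (norm \<xi>)\<^sup>2) powr s * (cmod (F \<xi>))\<^sup>2)"
      using M by (simp add: ennreal_mult mult_ac)
  qed
  also have "\<dots> = ennreal M * (\<integral>\<^sup>+\<xi>. ennreal ((1 + (norm \<xi>)\<^sup>2) powr s * (cmod (F \<xi>))\<^sup>2) \<partial>lborel)"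
    by (rule nn_integral_cmult) measurable
  also have "\<dots> < \<infinity>" using sob by (simp add: ennreal_mult_less_top)
  finally have Ysum: "(\<Sum>l. \<integral>\<^sup>+x. Y l x \<partial>lborel) < \<infinity>" .
  have Y0: "AE x in lebesgue. (\<lambda>l. Y l x) \<longlonglongrightarrow> 0"
    by (rule AE_completion[OF AE_tendsto_0_of_summable_integrals[OF _ Ysum]]) measurable
  have "AE x in lebesgue. \<forall>n l. propagator P (t n) f x - f x
      = (evolve P (t n) (G l) x - fourier_ext (G l) x) + h n l x"
    using split by (simp add: AE_all_countable)
  with Y0 show ?thesis
  proof eventually_elim
    case (elim x)
    have bd: "ennreal ((cmod (propagator P (t n) f x - f x))\<^sup>2) \<le> Y l x" if n: "n \<in> dyadic_block t l" for n l
    proof -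
      let ?a = "evolve P (t n) (G l) x - fourier_ext (G l) x" and ?b = "h n l x"
      have "(cmod (?a + ?b))\<^sup>2 \<le> (cmod ?a + cmod ?b)\<^sup>2" by (intro power_mono norm_triangle_ineq) auto
      also have "\<dots> \<le> 2 * (cmod ?a)\<^sup>2 + 2 * (cmod ?b)\<^sup>2"
        using sum_squares_bound[of "cmod ?a" "cmod ?b"] by (simp add: power2_sum)
      finally have "ennreal ((cmod (?a + ?b))\<^sup>2) \<le> ennreal (2 * (cmod ?a)\<^sup>2 + 2 * (cmod ?b)\<^sup>2)" by (rule ennreal_leI)
      also have "\<dots> = 2 * ennreal ((cmod ?a)\<^sup>2) + 2 * ennreal ((cmod ?b)\<^sup>2)"
        by (simp add: ennreal_mult)
      also have "\<dots> \<le> Y l x"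
        unfolding Y_def
      proof (intro add_mono mult_left_mono X)
        show "0 \<le> t n" "t n \<le> (1/2) ^ l" using n t01[of n] by (auto simp: dyadic_block_def)
        have "ennreal ((cmod (h n l x))\<^sup>2) = (\<Sum>n\<in>{n}. ennreal ((cmod (h n l x))\<^sup>2))" by simp
        also have "\<dots> \<le> (\<Sum>n\<in>dyadic_block t l. ennreal ((cmod (h n l x))\<^sup>2))"
          using n fin by (intro sum_mono2) auto
        finally show "ennreal ((cmod (h n l x))\<^sup>2) \<le> (\<Sum>n\<in>dyadic_block t l. ennreal ((cmod (h n l x))\<^sup>2))" .
      qed auto
      finally show ?thesis using elim(2) by simp
    qed
    show ?case
    proof (rule LIMSEQ_I)
      fix e :: real assume e: "e > 0"
      have "\<forall>\<^sub>F l in sequentially. Y l x < ennreal (e\<^sup>2)" using elim(1) e by (intro order_tendstoD(2)) auto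
      then obtain L where L: "\<And>l. l \<ge> L \<Longrightarrow> Y l x < ennreal (e\<^sup>2)" by (auto simp: eventually_sequentially)
      have "\<forall>\<^sub>F n in sequentially. t n < (1/2) ^ L" using t0 by (intro order_tendstoD(2)) auto
      then obtain n0 where n0: "\<And>n. n \<ge> n0 \<Longrightarrow> t n < (1/2) ^ L" by (auto simp: eventually_sequentially)
      have "norm (propagator P (t n) f x - f x) < e" if n: "n \<ge> n0" for n
      proof -
        obtain l where l: "n \<in> dyadic_block t l" using dyadic_block_exists[of t n] t01[of n] by auto
        have "(1/2::real) ^ Suc l < (1/2) ^ L" using l n0[OF n] by (auto simp: dyadic_block_def)
        hence "L < Suc l" using power_decreasing[of "Suc l" L "1/2::real"] by (cases "Suc l \<le> L") auto
        hence "Y l x < ennreal (e\<^sup>2)" by (intro L) simp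
        with bd[OF l] have "ennreal ((cmod (propagator P (t n) f x - f x))\<^sup>2) < ennreal (e\<^sup>2)" by (rule order_le_less_trans)
        hence "(cmod (propagator P (t n) f x - f x))\<^sup>2 < e\<^sup>2" by (simp add: ennreal_less_iff)
        thus ?thesis using e by (simp add: power2_less_imp_less)
      qed
      thus "\<exists>no. \<forall>n\<ge>no. norm (propagator P (t n) f x - f x) < e" by blast
    qed
  qed
qed

section \<open>Resonant trains of spikes\<close>

text \<open>
  The discrete form of \<open>y' \<le> - e y powr (1 + r)\<close>: along such a sequence \<open>t n powr (- r)\<close> grows at least
  linearly, which bounds the number of \<open>t n\<close> above a given level.
\<close>

lemma weak_ell_if_gaps_large:
  fixes t :: "nat \<Rightarrow> real"
  assumes t01: "\<And>n. t n \<in> {0<..<1}" and t0: "t \<longlonglongrightarrow> 0" and r: "r > 0" and e: "e > 0"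
    and gap: "\<And>n. n \<ge> n0 \<Longrightarrow> t n - t (Suc n) \<ge> e * t n powr (1 + r)"
  shows "t \<in> weak_ell r"
proof -
  have pos: "t n > 0" "t n < 1" for n using t01[of n] by auto
  have step: "t (Suc n) powr (- r) \<ge> t n powr (- r) + r * e" if n: "n \<ge> n0" for n
  proof -
    \<comment> \<open>The relative decrease in one step is at least \<open>u\<close>, and \<open>(1 - u) powr (- r) \<ge> 1 + r * u\<close>.\<close>
    define u where "u = e * t n powr r"
    have tu: "t (Suc n) \<le> t n * (1 - u)"
      using gap[OF n] pos(1)[of n] by (simp add: u_def powr_add algebra_simps)
    have u0: "u > 0" using e pos(1)[of n] by (simp add: u_def)
    have u1: "u < 1"
    proof (rule ccontr)
      assume "\<not> u < 1"
      hence "t n * (1 - u) \<le> 0" using pos(1)[of n] by (intro mult_nonneg_nonpos) auto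
      thus False using tu pos(1)[of "Suc n"] by linarith
    qed
    have "1 + r * u \<le> (1 - u) powr (- r)"
    proof -
      have "ln (1 - u) \<le> - u" using ln_le_minus_one[of "1 - u"] u1 by simp
      hence "r * u \<le> r * (- ln (1 - u))" using r by (intro mult_left_mono) auto
      hence "r * u \<le> - r * ln (1 - u)" by simp
      also have "1 + (- r * ln (1 - u)) \<le> exp (- r * ln (1 - u))" by (rule exp_ge_add_one_self)
      ultimately show ?thesis using u1 by (simp add: powr_def)
    qed
    hence "t n powr (- r) * (1 + r * u) \<le> t n powr (- r) * (1 - u) powr (- r)" by (intro mult_left_mono) auto
    also have "\<dots> = (t n * (1 - u)) powr (- r)" by (rule powr_mult[symmetric])
    also have "\<dots> \<le> t (Suc n) powr (- r)" using tu pos[of "Suc n"] r by (intro powr_mono2') auto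
    finally have "t n powr (- r) * (1 + r * u) \<le> t (Suc n) powr (- r)" .
    moreover have "t n powr (- r) * (1 + r * u) = t n powr (- r) + r * e"
    proof -
      have "t n powr (- r) * t n powr r = 1" using pos(1)[of n] by (simp flip: powr_add)
      hence "r * e * (t n powr (- r) * t n powr r) = r * e" by simp
      thus ?thesis unfolding u_def distrib_left by (simp only: mult_ac mult_1_right)
    qed
    ultimately show ?thesis by simp
  qed
  have lin: "t (n0 + k) powr (- r) \<ge> r * e * real k" for k
  proof (induction k)
    case (Suc k) thus ?case using step[of "n0 + k"] by (simp add: algebra_simps)
  qed simp
  have sub: "{n. t n > b} \<subseteq> {..n0 + nat \<lfloor>b powr (- r) / (r * e)\<rfloor>}" if b: "b > 0" for b
  proof
    fix n assume "n \<in> {n. t n > b}"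
    hence n: "t n > b" by simp
    show "n \<in> {..n0 + nat \<lfloor>b powr (- r) / (r * e)\<rfloor>}"
    proof (cases "n \<le> n0")
      case False
      then obtain k where k: "n = n0 + k" by (metis le_add_diff_inverse nat_le_linear)
      have "r * e * real k \<le> t n powr (- r)" using lin[of k] k by simp
      also have "\<dots> \<le> b powr (- r)" using n b r by (intro powr_mono2') auto
      finally have "real k \<le> b powr (- r) / (r * e)" using r e by (simp add: field_simps)
      hence "k \<le> nat \<lfloor>b powr (- r) / (r * e)\<rfloor>" by (simp add: le_nat_floor)
      thus ?thesis using k by simp
    qed simp
  qed
  show ?thesis
    unfolding weak_ell_def
  proof (intro CollectI conjI allI impI)
    fix b :: real assume "b > 0"
    from finite_subset[OF sub[OF this]] show "finite {n. t n > b}" by simp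
  next
    show "bdd_above ((\<lambda>b. b powr r * real (card {n. t n > b})) ` {0<..})"
    proof (rule bdd_aboveI2)
      fix b :: real assume "b \<in> {0<..}"
      hence b: "b > 0" by simp
      show "b powr r * real (card {n. t n > b}) \<le> real (n0 + 1) + 1 / (r * e)"
      proof (cases "b < 1")
        case True
        have "card {n. t n > b} \<le> Suc (n0 + nat \<lfloor>b powr (- r) / (r * e)\<rfloor>)"
          using card_mono[OF _ sub[OF b]] by simp
        hence "real (card {n. t n > b}) \<le> real (n0 + 1) + real (nat \<lfloor>b powr (- r) / (r * e)\<rfloor>)" by linarith
        also have "real (nat \<lfloor>b powr (- r) / (r * e)\<rfloor>) \<le> b powr (- r) / (r * e)" using r e by simp
        finally have "b powr r * real (card {n. t n > b}) \<le> b powr r * (real (n0 + 1) + b powr (- r) / (r * e))"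
          by (simp add: mult_left_mono)
        also have "\<dots> = b powr r * real (n0 + 1) + 1 / (r * e)"
        proof -
          have "b powr r * b powr (- r) = 1" using b by (simp flip: powr_add)
          thus ?thesis unfolding distrib_left times_divide_eq_right by simp
        qed
        also have "b powr r * real (n0 + 1) \<le> 1 * real (n0 + 1)"
          using True b r by (intro mult_right_mono powr_le1) auto
        finally show ?thesis by simp
      next
        case False
        have "\<not> t n > b" for n using pos(2)[of n] False by linarith
        hence "{n. t n > b} = {}" by auto
        thus ?thesis using r e by simp
      qed
    qed
  qed
qed

text \<open>
  The target \<open>\<sigma>\<close> may be smaller than all times that are used; then the last time is close enough, as it
  is itself at most \<open>d\<close>. This keeps the set of times finite.
\<close>

lemma hitting_time:
  fixes t :: "nat \<Rightarrow> real"
  assumes pos: "\<And>n. t n > 0" and dec: "decseq t" and gap: "\<And>n. n \<ge> n0 \<Longrightarrow> t n - t (Suc n) \<le> d"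
    and n1: "n1 \<ge> n0" "t n1 \<le> d" and \<sigma>: "0 < \<sigma>" "\<sigma> \<le> t n0"
  obtains n where "n \<in> {n0..n1}" "\<bar>t n - \<sigma>\<bar> \<le> d"
proof (cases "\<sigma> \<le> t n1")
  case True
  have "\<bar>t n1 - \<sigma>\<bar> \<le> d" using True \<sigma> n1 by auto
  thus ?thesis using n1 that by auto
next
  case False
  have "\<exists>n\<in>{n0..<n1}. t (Suc n) < \<sigma> \<and> \<sigma> \<le> t n"
  proof (rule ccontr)
    assume *: "\<not> (\<exists>n\<in>{n0..<n1}. t (Suc n) < \<sigma> \<and> \<sigma> \<le> t n)"
    have "\<sigma> \<le> t (n0 + k)" if "n0 + k \<le> n1" for k
      using that
    proof (induction k)
      case (Suc k)
      hence "\<sigma> \<le> t (n0 + k)" "n0 + k \<in> {n0..<n1}" by auto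
      with * have "\<not> t (Suc (n0 + k)) < \<sigma>" by blast
      thus ?case by simp
    qed (use \<sigma> in simp)
    from this[of "n1 - n0"] show False using False n1 by simp
  qed
  then obtain n where n: "n \<in> {n0..<n1}" "t (Suc n) < \<sigma>" "\<sigma> \<le> t n" by blast
  have "\<bar>t n - \<sigma>\<bar> \<le> d" using n gap[of n] by auto
  thus ?thesis using n that[of n] by auto
qed

lemma nonelliptic_symbol_measurable [measurable]: "nonelliptic_symbol i j \<epsilon> \<in> borel_measurable borel"
  unfolding nonelliptic_symbol_def by (intro borel_measurable_continuous_onI continuous_intros)

lemma sum_split_two:
  fixes g :: "'n :: finite \<Rightarrow> real"
  assumes "i \<noteq> j"
  shows "(\<Sum>k\<in>UNIV. g k) = g i + g j + (\<Sum>k\<in>UNIV - {i, j}. g k)"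
proof -
  have "(\<Sum>k\<in>UNIV. g k) = g i + (\<Sum>k\<in>UNIV - {i}. g k)" by (rule sum.remove) auto
  also have "(\<Sum>k\<in>UNIV - {i}. g k) = g j + (\<Sum>k\<in>UNIV - {i} - {j}. g k)" using assms by (intro sum.remove) auto
  also have "UNIV - {i} - {j} = UNIV - {i, j}" by auto
  finally show ?thesis by simp
qed

lemma nonelliptic_symbol_le:
  fixes \<xi> :: "real ^ 'n"
  assumes ij: "i \<noteq> j" and eps: "\<And>k. k \<notin> {i, j} \<Longrightarrow> \<epsilon> k \<in> {-1, 1}"
  shows "\<bar>nonelliptic_symbol i j \<epsilon> \<xi>\<bar> \<le> (norm \<xi>)\<^sup>2"
proof -
  have "\<bar>\<Sum>k\<in>UNIV - {i, j}. \<epsilon> k * (\<xi> $ k)\<^sup>2\<bar> \<le> (\<Sum>k\<in>UNIV - {i, j}. \<bar>\<epsilon> k * (\<xi> $ k)\<^sup>2\<bar>)"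
    by (rule sum_abs)
  also have "\<dots> = (\<Sum>k\<in>UNIV - {i, j}. (\<xi> $ k)\<^sup>2)"
    using eps by (intro sum.cong refl) (force simp: abs_mult)
  finally have "\<bar>nonelliptic_symbol i j \<epsilon> \<xi>\<bar> \<le> (\<xi> $ i)\<^sup>2 + (\<xi> $ j)\<^sup>2 + (\<Sum>k\<in>UNIV - {i, j}. (\<xi> $ k)\<^sup>2)"
    unfolding nonelliptic_symbol_def by (smt (verit) zero_le_power2)
  also have "\<dots> = (\<Sum>k\<in>UNIV. (\<xi> $ k)\<^sup>2)" by (rule sum_split_two[OF ij, symmetric])
  also have "\<dots> = (norm \<xi>)\<^sup>2"
    by (subst power2_norm_eq_inner) (simp add: inner_vec_def power2_eq_square)
  finally show ?thesis .
qed

text \<open>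
  The point of the plane of the coordinates \<open>i\<close> and \<open>j\<close> with \<open>\<xi>\<^sub>i - \<xi>\<^sub>j = \<zeta>\<close> and \<open>\<xi>\<^sub>i + \<xi>\<^sub>j = \<eta>\<close>.
\<close>

definition lattice_point :: "'n \<Rightarrow> 'n \<Rightarrow> real \<Rightarrow> real \<Rightarrow> real ^ 'n" where
  "lattice_point i j \<zeta> \<eta> = axis i ((\<zeta> + \<eta>) / 2) + axis j ((\<eta> - \<zeta>) / 2)"

lemma lattice_point_components:
  assumes "i \<noteq> j"
  shows "lattice_point i j \<zeta> \<eta> $ i = (\<zeta> + \<eta>) / 2" "lattice_point i j \<zeta> \<eta> $ j = (\<eta> - \<zeta>) / 2"
    "k \<notin> {i, j} \<Longrightarrow> lattice_point i j \<zeta> \<eta> $ k = 0"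
  using assms by (auto simp: lattice_point_def axis_def)

text \<open>
  Near the isotropic line only the terms \<open>\<zeta> * \<eta>\<close> and those linear in \<open>\<theta>\<close> are large.
\<close>

lemma nonelliptic_symbol_shift:
  assumes ij: "i \<noteq> j"
  shows "nonelliptic_symbol i j \<epsilon> (lattice_point i j \<zeta> \<eta> + \<theta>)
     = \<zeta> * \<eta> + \<zeta> * (\<theta> $ i + \<theta> $ j) + \<eta> * (\<theta> $ i - \<theta> $ j) + nonelliptic_symbol i j \<epsilon> \<theta>"
proof -
  have "(\<Sum>k\<in>UNIV - {i, j}. \<epsilon> k * ((lattice_point i j \<zeta> \<eta> + \<theta>) $ k)\<^sup>2) = (\<Sum>k\<in>UNIV - {i, j}. \<epsilon> k * (\<theta> $ k)\<^sup>2)"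
    using lattice_point_components[OF ij] by (intro sum.cong) auto
  thus ?thesis
    unfolding nonelliptic_symbol_def
    by (simp add: lattice_point_components[OF ij] power2_eq_square field_simps)
qed

lemma inner_lattice_point:
  "x \<bullet> lattice_point i j \<zeta> \<eta> = \<zeta> * ((x $ i - x $ j) / 2) + \<eta> * ((x $ i + x $ j) / 2)"
  by (simp add: lattice_point_def inner_add_right inner_axis field_simps)

lemma norm_axis_real: "norm (axis i a :: real ^ 'n) = \<bar>a\<bar>"
  by (simp add: norm_eq_sqrt_inner inner_axis_axis)

lemma norm_lattice_point_le:
  assumes "\<zeta> \<ge> 0" "\<eta> \<ge> 0"
  shows "norm (lattice_point i j \<zeta> \<eta>) \<le> \<zeta> + \<eta>"
proof -
  have "norm (lattice_point i j \<zeta> \<eta>) \<le> norm (axis i ((\<zeta> + \<eta>) / 2)) + norm (axis j ((\<eta> - \<zeta>) / 2))"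
    unfolding lattice_point_def by (rule norm_triangle_ineq)
  also have "\<dots> = \<bar>(\<zeta> + \<eta>) / 2\<bar> + \<bar>(\<eta> - \<zeta>) / 2\<bar>" by (simp only: norm_axis_real)
  also have "\<dots> \<le> \<zeta> + \<eta>" using assms by (auto simp: abs_if field_simps)
  finally show ?thesis .
qed

text \<open>
  Small balls around equally spaced points of an isotropic line. Each summand alone would evolve into a
  function of constant modulus near the origin; the sum interferes constructively exactly on the spikes.
\<close>

definition lattice_bump :: "'n \<Rightarrow> 'n \<Rightarrow> real \<Rightarrow> real \<Rightarrow> nat \<Rightarrow> real \<Rightarrow> real ^ 'n \<Rightarrow> complex" where
  "lattice_bump i j \<mu> \<kappa> M \<rho> \<xi> = of_real (1 / real M) * (\<Sum>m<M. indicator (cball (lattice_point i j \<mu> (real m * \<kappa>)) \<rho>) \<xi>)"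

lemma lattice_bump_measurable [measurable]: "lattice_bump i j \<mu> \<kappa> M \<rho> \<in> borel_measurable borel"
  unfolding lattice_bump_def[abs_def] by measurable

lemma lattice_bump_disjoint:
  assumes ij: "i \<noteq> j" and \<kappa>: "\<kappa> > 4 * \<rho>"
    and "\<xi> \<in> cball (lattice_point i j \<mu> (real m * \<kappa>)) \<rho>" "\<xi> \<in> cball (lattice_point i j \<mu> (real m' * \<kappa>)) \<rho>"
  shows "m = m'"
proof (rule ccontr)
  assume "m \<noteq> m'"
  define \<eta> where "\<eta> v = v $ i + v $ j" for v :: "real ^ 'a"
  have eta: "\<bar>\<eta> \<xi> - real m * \<kappa>\<bar> \<le> 2 * \<rho>" if "\<xi> \<in> cball (lattice_point i j \<mu> (real m * \<kappa>)) \<rho>" for m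
  proof -
    let ?v = "\<xi> - lattice_point i j \<mu> (real m * \<kappa>)"
    have n: "norm ?v \<le> \<rho>" using that by (simp add: dist_norm norm_minus_commute)
    have "\<eta> \<xi> - real m * \<kappa> = ?v $ i + ?v $ j"
      by (simp add: \<eta>_def lattice_point_components[OF ij] field_simps)
    thus ?thesis using component_le_norm_cart[of ?v i] component_le_norm_cart[of ?v j] n by linarith
  qed
  have "\<bar>real m * \<kappa> - real m' * \<kappa>\<bar> \<le> 4 * \<rho>" using eta[OF assms(3)] eta[OF assms(4)] by linarith
  hence *: "\<bar>real m - real m'\<bar> * \<bar>\<kappa>\<bar> \<le> 4 * \<rho>" by (simp add: left_diff_distrib[symmetric] abs_mult)
  have "\<bar>real m - real m'\<bar> \<ge> 1" using \<open>m \<noteq> m'\<close> by linarith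
  hence "1 * \<bar>\<kappa>\<bar> \<le> \<bar>real m - real m'\<bar> * \<bar>\<kappa>\<bar>" by (rule mult_right_mono) simp
  thus False using * \<kappa> by linarith
qed

lemma lattice_bump_square:
  assumes ij: "i \<noteq> j" and \<kappa>: "\<kappa> > 4 * \<rho>"
  shows "ennreal ((cmod (lattice_bump i j \<mu> \<kappa> M \<rho> \<xi>))\<^sup>2)
    = ennreal (1 / (real M)\<^sup>2) * (\<Sum>m<M. indicator (cball (lattice_point i j \<mu> (real m * \<kappa>)) \<rho>) \<xi>)"
proof (cases "\<exists>m<M. \<xi> \<in> cball (lattice_point i j \<mu> (real m * \<kappa>)) \<rho>")
  case True
  then obtain m where m: "m < M" "\<xi> \<in> cball (lattice_point i j \<mu> (real m * \<kappa>)) \<rho>" by blast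
  have mem: "\<xi> \<in> cball (lattice_point i j \<mu> (real m' * \<kappa>)) \<rho> \<longleftrightarrow> m' = m" for m'
    using lattice_bump_disjoint[OF ij \<kappa> m(2)] m(2) by metis
  have "(\<Sum>m'<M. indicator (cball (lattice_point i j \<mu> (real m' * \<kappa>)) \<rho>) \<xi>) = (1::complex)"
    using m(1) by (simp only: indicator_def mem of_bool_def) simp
  moreover have "(\<Sum>m'<M. indicator (cball (lattice_point i j \<mu> (real m' * \<kappa>)) \<rho>) \<xi>) = (1::ennreal)"
    using m(1) by (simp only: indicator_def mem of_bool_def) simp
  ultimately show ?thesis unfolding lattice_bump_def by (simp add: norm_divide power_divide)
next
  case False
  hence mem: "\<xi> \<notin> cball (lattice_point i j \<mu> (real m' * \<kappa>)) \<rho>" if "m' \<in> {..<M}" for m'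
    using that by blast
  have "(\<Sum>m'<M. indicator (cball (lattice_point i j \<mu> (real m' * \<kappa>)) \<rho>) \<xi>) = (0::complex)"
    by (intro sum.neutral ballI) (use mem in \<open>auto simp: indicator_def\<close>)
  moreover have "(\<Sum>m'<M. indicator (cball (lattice_point i j \<mu> (real m' * \<kappa>)) \<rho>) \<xi>) = (0::ennreal)"
    by (intro sum.neutral ballI) (use mem in \<open>auto simp: indicator_def\<close>)
  ultimately show ?thesis unfolding lattice_bump_def by simp
qed

text \<open>
  The balls are disjoint, so \<open>M\<close> of them with amplitude \<open>1 / M\<close> have squared norm of the order \<open>1 / M\<close>.
\<close>

lemma lattice_bump_weighted_norm:
  fixes W :: "real ^ 'n \<Rightarrow> real"
  assumes ij: "i \<noteq> j" and \<kappa>: "\<kappa> > 4 * \<rho>" and M: "M > 0" and [measurable]: "W \<in> borel_measurable borel"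
    and W: "\<And>m \<xi>. m < M \<Longrightarrow> \<xi> \<in> cball (lattice_point i j \<mu> (real m * \<kappa>)) \<rho> \<Longrightarrow> W \<xi> \<le> B" and B: "B \<ge> 0"
  shows "(\<integral>\<^sup>+\<xi>. ennreal (W \<xi> * (cmod (lattice_bump i j \<mu> \<kappa> M \<rho> \<xi>))\<^sup>2) \<partial>lborel)
     \<le> ennreal (B / real M * measure lborel (cball 0 \<rho> :: (real ^ 'n) set))"
proof -
  let ?Q = "\<lambda>m. cball (lattice_point i j \<mu> (real m * \<kappa>)) \<rho> :: (real ^ 'n) set"
  let ?V = "measure lborel (cball 0 \<rho> :: (real ^ 'n) set)"
  have vol: "emeasure lborel (?Q m) = ennreal ?V" for m
  proof -
    have "(+) (- lattice_point i j \<mu> (real m * \<kappa>)) -` cball 0 \<rho> = ?Q m"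
      by (auto simp: dist_norm norm_minus_commute)
    hence "emeasure lborel (?Q m) = emeasure (distr lborel borel ((+) (- lattice_point i j \<mu> (real m * \<kappa>)))) (cball 0 \<rho>)"
      by (subst emeasure_distr) auto
    also have "\<dots> = emeasure lborel (cball 0 \<rho> :: (real ^ 'n) set)" by (simp add: lborel_distr_plus)
    also have "\<dots> = ennreal ?V"
      using emeasure_bounded_finite[of "cball 0 \<rho> :: (real ^ 'n) set"] by (simp add: emeasure_eq_ennreal_measure)
    finally show ?thesis .
  qed
  have "(\<integral>\<^sup>+\<xi>. ennreal (W \<xi> * (cmod (lattice_bump i j \<mu> \<kappa> M \<rho> \<xi>))\<^sup>2) \<partial>lborel)
     \<le> (\<integral>\<^sup>+\<xi>. ennreal (B / (real M)\<^sup>2) * (\<Sum>m<M. indicator (?Q m) \<xi>) \<partial>lborel)"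
  proof (rule nn_integral_mono)
    fix \<xi>
    show "ennreal (W \<xi> * (cmod (lattice_bump i j \<mu> \<kappa> M \<rho> \<xi>))\<^sup>2) \<le> ennreal (B / (real M)\<^sup>2) * (\<Sum>m<M. indicator (?Q m) \<xi>)"
    proof (cases "\<exists>m<M. \<xi> \<in> ?Q m")
      case True
      hence "W \<xi> \<le> B" using W by blast
      hence "ennreal (W \<xi> * (cmod (lattice_bump i j \<mu> \<kappa> M \<rho> \<xi>))\<^sup>2) \<le> ennreal (B * (cmod (lattice_bump i j \<mu> \<kappa> M \<rho> \<xi>))\<^sup>2)"
        by (intro ennreal_leI mult_right_mono) auto
      also have "\<dots> = ennreal B * ennreal ((cmod (lattice_bump i j \<mu> \<kappa> M \<rho> \<xi>))\<^sup>2)" using B by (intro ennreal_mult) auto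
      also have "\<dots> = ennreal B * ennreal (1 / (real M)\<^sup>2) * (\<Sum>m<M. indicator (?Q m) \<xi>)"
        unfolding lattice_bump_square[OF ij \<kappa>] by (simp add: mult.assoc)
      also have "ennreal B * ennreal (1 / (real M)\<^sup>2) = ennreal (B / (real M)\<^sup>2)" using B by (subst ennreal_mult[symmetric]) auto
      finally show ?thesis .
    next
      case False
      hence "lattice_bump i j \<mu> \<kappa> M \<rho> \<xi> = 0" by (auto simp: lattice_bump_def indicator_def)
      thus ?thesis by simp
    qed
  qed
  also have "\<dots> = ennreal (B / (real M)\<^sup>2) * (\<Sum>m<M. emeasure lborel (?Q m))"
    by (simp add: nn_integral_cmult nn_integral_sum)
  also have "\<dots> = ennreal (B / (real M)\<^sup>2) * ennreal (real M * ?V)"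
    unfolding vol by (simp add: ennreal_of_nat_eq_real_of_nat ennreal_mult)
  also have "\<dots> = ennreal (B / real M * ?V)"
    using B M by (subst ennreal_mult[symmetric]) (auto simp: power2_eq_square)
  finally show ?thesis .
qed

lemma lattice_bump_L2_compact:
  fixes i j :: "'n :: finite"
  assumes ij: "i \<noteq> j" and \<kappa>: "\<kappa> > 4 * \<rho>" and M: "M > 0"
  shows "lattice_bump i j \<mu> \<kappa> M \<rho> \<in> L2_compact"
proof (rule L2_compactI[of _ "Max ((\<lambda>m. norm (lattice_point i j \<mu> (real m * \<kappa>)) + \<rho>) ` {..<M})"])
  show "lattice_bump i j \<mu> \<kappa> M \<rho> \<in> borel_measurable borel" by measurable
  have "sqn (lattice_bump i j \<mu> \<kappa> M \<rho>) = (\<integral>\<^sup>+\<xi>. ennreal (1 * (cmod (lattice_bump i j \<mu> \<kappa> M \<rho> \<xi>))\<^sup>2) \<partial>lborel)"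
    by (simp add: sqn_lborel)
  also have "\<dots> \<le> ennreal (1 / real M * measure lborel (cball 0 \<rho> :: (real ^ 'n) set))"
    by (rule lattice_bump_weighted_norm[OF ij \<kappa> M]) auto
  also have "\<dots> < \<infinity>" by simp
  finally show "sqn (lattice_bump i j \<mu> \<kappa> M \<rho>) < \<infinity>" .
next
  fix \<xi> :: "real ^ 'n"
  assume *: "norm \<xi> > Max ((\<lambda>m. norm (lattice_point i j \<mu> (real m * \<kappa>)) + \<rho>) ` {..<M})"
  have "indicator (cball (lattice_point i j \<mu> (real m * \<kappa>)) \<rho>) \<xi> = (0::complex)" if "m < M" for m
  proof -
    have "norm (lattice_point i j \<mu> (real m * \<kappa>)) + \<rho> \<le> Max ((\<lambda>m. norm (lattice_point i j \<mu> (real m * \<kappa>)) + \<rho>) ` {..<M})"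
      using that by (intro Max_ge) auto
    hence "norm (lattice_point i j \<mu> (real m * \<kappa>)) + \<rho> < norm \<xi>" using * by linarith
    moreover have "norm \<xi> \<le> norm (lattice_point i j \<mu> (real m * \<kappa>)) + dist (lattice_point i j \<mu> (real m * \<kappa>)) \<xi>"
      using norm_triangle_sub[of \<xi> "lattice_point i j \<mu> (real m * \<kappa>)"] by (simp add: dist_norm norm_minus_commute)
    ultimately show ?thesis by (auto simp: indicator_def)
  qed
  thus "lattice_bump i j \<mu> \<kappa> M \<rho> \<xi> = 0" by (simp add: lattice_bump_def)
qed

lemma cos_ge_half:
  fixes \<psi> :: real
  assumes "\<bar>\<psi>\<bar> \<le> 1" shows "cos \<psi> \<ge> 1 / 2"
proof -
  have "cos (pi / 3) \<le> cos \<bar>\<psi>\<bar>" using assms pi_gt3 by (subst cos_mono_le_eq) auto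
  thus ?thesis by (simp add: cos_60)
qed

text \<open>
  After removing the common phase, which depends on \<open>x\<close> only, all contributions lie in the half plane
  of real part at least \<open>1/2\<close>, so nothing cancels.
\<close>

lemma lattice_bump_lower_bound:
  fixes x :: "real ^ 'n" and i j :: 'n
  assumes ij: "i \<noteq> j" and M: "M > 0" and P: "P = nonelliptic_symbol i j \<epsilon>"
    and phase: "\<And>m \<theta>. m < M \<Longrightarrow> norm \<theta> \<le> \<rho> \<Longrightarrow>
      \<exists>k::int. \<bar>x \<bullet> \<theta> + real m * \<kappa> * ((x $ i + x $ j) / 2 + \<tau> * \<mu>) - 2 * pi * of_int k
        + \<tau> * (\<mu> * (\<theta> $ i + \<theta> $ j) + real m * \<kappa> * (\<theta> $ i - \<theta> $ j) + P \<theta>)\<bar> \<le> 1"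
  shows "measure lborel (cball 0 \<rho> :: (real ^ 'n) set) / 2
     \<le> cmod (evolve P \<tau> (lattice_bump i j \<mu> \<kappa> M \<rho>) x)"
proof -
  have [measurable]: "P \<in> borel_measurable borel" unfolding P by measurable
  let ?Q = "\<lambda>m. cball (lattice_point i j \<mu> (real m * \<kappa>)) \<rho> :: (real ^ 'n) set"
  let ?V = "measure lborel (cball 0 \<rho> :: (real ^ 'n) set)"
  let ?z = "\<mu> * ((x $ i - x $ j) / 2)"
  have fin: "emeasure lborel (cball 0 \<rho> :: (real ^ 'n) set) < \<infinity>" by (rule emeasure_bounded_finite) simp
  have indc: "integrable lborel (indicator (cball c \<rho>) :: real ^ 'n \<Rightarrow> complex)" for c
  proof -
    have "integrable lborel (\<lambda>x. indicat_real (cball c \<rho>) x *\<^sub>R (1::complex))"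
      by (intro integrable_indicator emeasure_bounded_finite) auto
    moreover have "(\<lambda>x. indicat_real (cball c \<rho>) x *\<^sub>R (1::complex)) = indicator (cball c \<rho>)" by (auto simp: indicator_def)
    ultimately show ?thesis by simp
  qed
  define \<psi> where "\<psi> m \<theta> = x \<bullet> \<theta> + real m * \<kappa> * ((x $ i + x $ j) / 2 + \<tau> * \<mu>)
        + \<tau> * (\<mu> * (\<theta> $ i + \<theta> $ j) + real m * \<kappa> * (\<theta> $ i - \<theta> $ j) + P \<theta>)" for m \<theta>
  have [measurable]: "\<psi> m \<in> borel_measurable borel" for m
    unfolding \<psi>_def by (intro borel_measurable_add borel_measurable_times borel_measurable_diff)
      (auto intro: borel_measurable_continuous_onI continuous_intros)
  have int1: "integrable lborel (\<lambda>\<xi>. cis (x \<bullet> \<xi>) * (cis (\<tau> * P \<xi>) * indicator (?Q m) \<xi>))" for m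
    by (intro integrable_cis_mult indc) auto
  have piece: "(\<integral>\<xi>. cis (x \<bullet> \<xi>) * (cis (\<tau> * P \<xi>) * indicator (?Q m) \<xi>) \<partial>lborel)
      = cis ?z * (\<integral>\<theta>. cis (\<psi> m \<theta>) * indicator (cball 0 \<rho>) \<theta> \<partial>lborel)" for m
  proof -
    let ?c = "lattice_point i j \<mu> (real m * \<kappa>)"
    have "(\<integral>\<xi>. cis (x \<bullet> \<xi>) * (cis (\<tau> * P \<xi>) * indicator (?Q m) \<xi>) \<partial>lborel)
       = (\<integral>\<theta>. cis (x \<bullet> (?c + \<theta>)) * (cis (\<tau> * P (?c + \<theta>)) * indicator (?Q m) (?c + \<theta>)) \<partial>lborel)"
      using lborel_scale(1)[of 1 "\<lambda>\<xi>. cis (x \<bullet> \<xi>) * (cis (\<tau> * P \<xi>) * indicator (?Q m) \<xi>)" ?c] by simp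
    also have "\<dots> = (\<integral>\<theta>. cis ?z * (cis (\<psi> m \<theta>) * indicator (cball 0 \<rho>) \<theta>) \<partial>lborel)"
    proof (intro Bochner_Integration.integral_cong refl)
      fix \<theta>
      have "x \<bullet> (?c + \<theta>) + \<tau> * P (?c + \<theta>) = ?z + \<psi> m \<theta>"
        unfolding P nonelliptic_symbol_shift[OF ij] inner_add_right inner_lattice_point \<psi>_def
        by (simp add: algebra_simps)
      hence "cis (x \<bullet> (?c + \<theta>)) * cis (\<tau> * P (?c + \<theta>)) = cis ?z * cis (\<psi> m \<theta>)" by (simp only: cis_mult)
      moreover have "indicator (?Q m) (?c + \<theta>) = (indicator (cball 0 \<rho>) \<theta> :: complex)"
        by (auto simp: indicator_def dist_norm)
      ultimately show "cis (x \<bullet> (?c + \<theta>)) * (cis (\<tau> * P (?c + \<theta>)) * indicator (?Q m) (?c + \<theta>))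
         = cis ?z * (cis (\<psi> m \<theta>) * indicator (cball 0 \<rho>) \<theta>)"
        by (simp only: mult.assoc[symmetric])
    qed
    also have "\<dots> = cis ?z * (\<integral>\<theta>. cis (\<psi> m \<theta>) * indicator (cball 0 \<rho>) \<theta> \<partial>lborel)" by simp
    finally show ?thesis .
  qed
  have "evolve P \<tau> (lattice_bump i j \<mu> \<kappa> M \<rho>) x
     = (\<integral>\<xi>. of_real (1 / real M) * (\<Sum>m<M. cis (x \<bullet> \<xi>) * (cis (\<tau> * P \<xi>) * indicator (?Q m) \<xi>)) \<partial>lborel)"
    unfolding fourier_ext_def lattice_bump_def
    by (intro Bochner_Integration.integral_cong refl) (simp add: sum_distrib_left mult_ac)
  also have "\<dots> = of_real (1 / real M) * (\<Sum>m<M. \<integral>\<xi>. cis (x \<bullet> \<xi>) * (cis (\<tau> * P \<xi>) * indicator (?Q m) \<xi>) \<partial>lborel)"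
    using int1 by (simp add: Bochner_Integration.integral_sum del: Bochner_Integration.integral_divide_zero)
  also have "\<dots> = cis ?z * (of_real (1 / real M) * (\<Sum>m<M. \<integral>\<theta>. cis (\<psi> m \<theta>) * indicator (cball 0 \<rho>) \<theta> \<partial>lborel))"
    unfolding piece sum_distrib_left[symmetric] by (simp only: mult_ac)
  finally have "cmod (evolve P \<tau> (lattice_bump i j \<mu> \<kappa> M \<rho>) x)
     = cmod (of_real (1 / real M) * (\<Sum>m<M. \<integral>\<theta>. cis (\<psi> m \<theta>) * indicator (cball 0 \<rho>) \<theta> \<partial>lborel))"
    by (simp only: norm_mult norm_cis mult_1)
  also have "\<dots> \<ge> Re (of_real (1 / real M) * (\<Sum>m<M. \<integral>\<theta>. cis (\<psi> m \<theta>) * indicator (cball 0 \<rho>) \<theta> \<partial>lborel))"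
    by (rule complex_Re_le_cmod)
  also have "Re (of_real (1 / real M) * (\<Sum>m<M. \<integral>\<theta>. cis (\<psi> m \<theta>) * indicator (cball 0 \<rho>) \<theta> \<partial>lborel))
     = 1 / real M * (\<Sum>m<M. Re (\<integral>\<theta>. cis (\<psi> m \<theta>) * indicator (cball 0 \<rho>) \<theta> \<partial>lborel))"
    by (simp only: Re_complex_of_real Im_complex_of_real times_complex.sel Re_sum)
  also have "\<dots> \<ge> 1 / real M * (\<Sum>m<M. ?V / 2)"
  proof (intro mult_left_mono sum_mono)
    fix m assume m: "m \<in> {..<M}"
    have "Re (\<integral>\<theta>. cis (\<psi> m \<theta>) * indicator (cball 0 \<rho>) \<theta> \<partial>lborel) = (\<integral>\<theta>. Re (cis (\<psi> m \<theta>) * indicator (cball 0 \<rho>) \<theta>) \<partial>lborel)"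
      by (intro integral_Re[symmetric] integrable_cis_mult indc) measurable
    also have "\<dots> \<ge> (\<integral>\<theta>. 1 / 2 * indicat_real (cball 0 \<rho>) \<theta> \<partial>(lborel :: (real ^ 'n) measure))"
    proof (rule Bochner_Integration.integral_mono)
      show "integrable lborel (\<lambda>\<theta>. 1 / 2 * indicat_real (cball 0 \<rho>) (\<theta> :: real ^ 'n))" using fin by (intro integrable_mult_right integrable_real_indicator) auto
      show "integrable lborel (\<lambda>\<theta>. Re (cis (\<psi> m \<theta>) * indicator (cball 0 \<rho>) \<theta>))"
        by (intro integrable_Re integrable_cis_mult indc) measurable
      fix \<theta> :: "real ^ 'n"
      show "1 / 2 * indicat_real (cball 0 \<rho>) \<theta> \<le> Re (cis (\<psi> m \<theta>) * indicator (cball 0 \<rho>) \<theta>)"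
      proof (cases "norm \<theta> \<le> \<rho>")
        case True
        then obtain k :: int where k: "\<bar>\<psi> m \<theta> - 2 * pi * of_int k\<bar> \<le> 1"
          using phase[of m \<theta>] m unfolding \<psi>_def by (auto simp: algebra_simps)
        have "cos (\<psi> m \<theta>) = cos (\<psi> m \<theta> - 2 * pi * of_int k)" by (simp add: cos_diff)
        also have "\<dots> \<ge> 1 / 2" by (rule cos_ge_half[OF k])
        finally show ?thesis using True by simp
      qed simp
    qed
    also have "(\<integral>\<theta>. 1 / 2 * indicat_real (cball 0 \<rho>) \<theta> \<partial>(lborel :: (real ^ 'n) measure)) = ?V / 2" by simp
    finally show "?V / 2 \<le> Re (\<integral>\<theta>. cis (\<psi> m \<theta>) * indicator (cball 0 \<rho>) \<theta> \<partial>lborel)" .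
  qed simp
  also have "1 / real M * (\<Sum>m<M. ?V / 2) = ?V / 2" using M by simp
  finally show ?thesis .
qed

text \<open>
  Let \<open>b = t n\<close> for one of the late indices with a small gap. The period of the train in
  \<open>(x $ i + x $ j) / 2\<close> is \<open>2 * pi / \<kappa> = \<mu> * b\<close>, the distance travelled up to time \<open>b\<close>, so each point is passed by a spike
  during \<open>(0, b]\<close>. Three conditions restrict \<open>M\<close>: the frequencies are to have size \<open>\<mu>\<close>, whence
  \<open>\<mu>\<^sup>2 = M / b\<close>; the variation of the phase over a ball of fixed radius is to stay bounded, which holds for
  \<open>M * b \<le> 1\<close>; and the gaps \<open>d\<close> are to be shorter than the time a spike needs to pass, which holds
  for \<open>M * d \<le> b / 16\<close>. All of them allow \<open>M\<close> of the order \<open>K * b powr (- r)\<close>; for the second one this uses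
  \<open>r < 1\<close>, that is \<open>s < 1/2\<close>.
\<close>

lemma resonant_bump_exists:
  fixes i j :: "'n :: finite" and P :: "real ^ 'n \<Rightarrow> real"
  assumes s: "0 < s" "s < 1/2" and ij: "i \<noteq> j" and eps: "\<And>k. k \<notin> {i, j} \<Longrightarrow> \<epsilon> k \<in> {-1, 1}"
    and P: "P = nonelliptic_symbol i j \<epsilon>"
    and t01: "\<And>n. t n \<in> {0<..<1}" and dec: "decseq t" and t0: "t \<longlonglongrightarrow> 0"
    and gaps: "decseq (\<lambda>n. t n - t (Suc n))" and nw: "t \<notin> weak_ell (s / (1 - s))" and \<delta>: "\<delta> > 0"
  obtains G N where "G \<in> L2_compact" "finite N" "N \<subseteq> {n0..}"
    "(\<integral>\<^sup>+\<xi>. ennreal ((1 + (norm \<xi>)\<^sup>2) powr s * (cmod (G \<xi>))\<^sup>2) \<partial>lborel) \<le> ennreal \<delta>"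
    "\<And>x. norm x \<le> 1 \<Longrightarrow> \<exists>n\<in>N. measure lborel (cball 0 (1/40) :: (real ^ 'n) set) / 2
       \<le> cmod (evolve P (t n) G x)"
proof -
  define r where "r = s / (1 - s)"
  have r: "r > 0" "r < 1" using s by (auto simp: r_def)
  have rs: "r * (1 - s) = s" using s by (simp add: r_def)
  have pos: "t n > 0" "t n < 1" for n using t01[of n] by auto
  define V where "V = measure lborel (cball 0 (1/40) :: (real ^ 'n) set)"
  have V: "V \<ge> 0" by (simp add: V_def)
  \<comment> \<open>The squared norm of the train will be at most \<open>11 * V * K powr (s - 1)\<close>; the exponent is negative.\<close>
  define K where "K = max 1 ((\<delta> / (11 * V + 1)) powr (1 / (s - 1)))"
  have K1: "K \<ge> 1" by (simp add: K_def)
  have K: "11 * V * K powr (s - 1) \<le> \<delta>"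
  proof -
    define q where "q = \<delta> / (11 * V + 1)"
    have q: "q > 0" using \<delta> V by (auto simp: q_def)
    have "K powr (s - 1) \<le> (q powr (1 / (s - 1))) powr (s - 1)"
      using s q unfolding K_def q_def[symmetric] by (intro powr_mono2') auto
    also have "\<dots> = \<delta> / (11 * V + 1)" using s q unfolding powr_powr q_def[symmetric] by simp
    finally have "11 * V * K powr (s - 1) \<le> 11 * V * (\<delta> / (11 * V + 1))" using V by (intro mult_left_mono) auto
    also have "\<dots> \<le> \<delta>" using V \<delta> by (simp add: divide_simps)
    finally show ?thesis .
  qed
  have "(\<lambda>n. 2 * K * (t n powr (1 - r))) \<longlonglongrightarrow> 2 * K * 0"
  proof (intro tendsto_intros)
    have "(\<lambda>n. t n powr (1 - r)) \<longlonglongrightarrow> 0 powr (1 - r)"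
      using r pos by (intro tendsto_powr' t0 tendsto_const) (auto intro!: always_eventually less_imp_le)
    thus "(\<lambda>n. t n powr (1 - r)) \<longlonglongrightarrow> 0" using r by simp
  qed
  hence "\<forall>\<^sub>F n in sequentially. 2 * K * (t n powr (1 - r)) < 1" by (intro order_tendstoD(2)) auto
  then obtain n' where n': "\<And>n. n \<ge> n' \<Longrightarrow> 2 * K * (t n powr (1 - r)) < 1" by (auto simp: eventually_sequentially)
  have "\<exists>n\<ge>max n0 n'. t n - t (Suc n) < 1 / (32 * K) * t n powr (1 + r)"
  proof (rule ccontr)
    assume "\<not> ?thesis"
    hence "t \<in> weak_ell r" using K1
      by (intro weak_ell_if_gaps_large[OF t01 t0 r(1), of "1 / (32 * K)" "max n0 n'"]) (auto simp: not_less)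
    thus False using nw by (simp add: r_def)
  qed
  then obtain n where n: "n \<ge> n0" "n \<ge> n'" "t n - t (Suc n) < 1 / (32 * K) * t n powr (1 + r)" by auto
  define b d where "b = t n" and "d = 1 / (32 * K) * b powr (1 + r)"
  have b: "b > 0" "b < 1" using pos by (auto simp: b_def)
  have d: "d > 0" using K1 b by (simp add: d_def)
  have gap: "t k - t (Suc k) \<le> d" if "k \<ge> n" for k
    using decseqD[OF gaps that] n(3) by (simp add: d_def b_def)
  have "\<forall>\<^sub>F k in sequentially. t k < d" using t0 d by (intro order_tendstoD(2)) auto
  then obtain n1' where n1': "\<And>k. k \<ge> n1' \<Longrightarrow> t k < d" by (auto simp: eventually_sequentially)
  define n1 where "n1 = max n n1'"
  have n1: "n1 \<ge> n" "t n1 \<le> d" using n1'[of n1] by (auto simp: n1_def)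
  \<comment> \<open>As \<open>K * b powr (- r) \<ge> 1\<close>, rounding up at most doubles it.\<close>
  define M where "M = nat \<lceil>K * b powr (- r)\<rceil>"
  have br1: "b powr (- r) \<ge> 1"
    using b r powr_mono2'[of "- r" b 1] by simp
  have KB: "K * b powr (- r) \<ge> 1" using mult_mono[OF K1 br1] K1 by simp
  have Mlo: "real M \<ge> K * b powr (- r)" unfolding M_def using KB by linarith
  have Mhi: "real M \<le> 2 * (K * b powr (- r))" unfolding M_def using KB by linarith
  have M1: "real M \<ge> 1" using Mlo KB by linarith
  hence M: "M > 0" by simp
  have Mb: "real M * b \<le> 1"
  proof -
    have "real M * b \<le> 2 * (K * b powr (- r)) * b" using Mhi b by (intro mult_right_mono) auto
    also have "\<dots> = 2 * K * b powr (1 - r)"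
      using b powr_add[of b "- r" 1] by simp
    also have "\<dots> \<le> 1" using n'[OF n(2)] by (simp add: b_def)
    finally show ?thesis .
  qed
  have Md: "real M * d \<le> b / 16"
  proof -
    have "real M * d \<le> 2 * (K * b powr (- r)) * d" using Mhi d by (intro mult_right_mono) auto
    also have "\<dots> = (b powr (- r) * b powr (1 + r)) / 16" using K1 by (simp add: d_def)
    also have "\<dots> = b / 16" using b by (simp flip: powr_add)
    finally show ?thesis .
  qed
  define \<mu> \<kappa> where "\<mu> = sqrt (real M / b)" and "\<kappa> = 2 * pi / (\<mu> * b)"
  have \<mu>2: "\<mu>\<^sup>2 = real M / b" using b by (simp add: \<mu>_def)
  have \<mu>1: "\<mu> \<ge> 1"
  proof -
    have "1 \<le> real M / b" using M1 b by (simp add: le_divide_eq)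
    thus ?thesis by (simp add: \<mu>_def)
  qed
  have \<mu>b: "\<mu> * b \<le> 1"
  proof -
    have "(\<mu> * b)\<^sup>2 = real M * b" using b by (simp only: power_mult_distrib \<mu>2) (simp add: power2_eq_square)
    hence "(\<mu> * b)\<^sup>2 \<le> 1\<^sup>2" using Mb by simp
    thus ?thesis by (rule power2_le_imp_le) simp
  qed
  have \<mu>b0: "\<mu> * b > 0" using \<mu>1 b by simp
  have \<kappa>pos: "\<kappa> > 0" using \<mu>b0 by (simp add: \<kappa>_def)
  have \<kappa>\<mu>b: "\<kappa> * (\<mu> * b) = 2 * pi" unfolding \<kappa>_def using less_imp_neq[OF \<mu>b0] by (subst nonzero_divide_eq_eq[symmetric]) auto
  have M\<mu>: "real M = \<mu> * (\<mu> * b)"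
  proof -
    have "\<mu> * (\<mu> * b) = \<mu>\<^sup>2 * b" by (simp add: power2_eq_square)
    thus ?thesis unfolding \<mu>2 using b by simp
  qed
  have \<kappa>M: "real M * \<kappa> = 2 * pi * \<mu>"
  proof -
    have "real M * \<kappa> = \<mu> * (\<kappa> * (\<mu> * b))" by (subst M\<mu>) (simp only: mult_ac)
    thus ?thesis unfolding \<kappa>\<mu>b by simp
  qed
  have \<kappa>4: "\<kappa> > 4 * (1/40)"
  proof -
    have "2 * pi \<le> \<kappa> * 1" unfolding \<kappa>\<mu>b[symmetric] using \<mu>b \<kappa>pos by (intro mult_left_mono) auto
    thus ?thesis using pi_gt3 by simp
  qed
  define G where "G = lattice_bump i j \<mu> \<kappa> M (1/40)"
  have G: "G \<in> L2_compact" unfolding G_def by (rule lattice_bump_L2_compact[OF ij \<kappa>4 M])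
  have norm: "(\<integral>\<^sup>+\<xi>. ennreal ((1 + (norm \<xi>)\<^sup>2) powr s * (cmod (G \<xi>))\<^sup>2) \<partial>lborel) \<le> ennreal \<delta>"
  proof -
    have W: "(1 + (norm \<xi>)\<^sup>2) powr s \<le> 11 * (real M / b) powr s"
      if m: "m < M" and \<xi>: "\<xi> \<in> cball (lattice_point i j \<mu> (real m * \<kappa>)) (1/40)" for m \<xi>
    proof -
      have "norm \<xi> \<le> norm (lattice_point i j \<mu> (real m * \<kappa>)) + dist (lattice_point i j \<mu> (real m * \<kappa>)) \<xi>"
        using norm_triangle_sub[of \<xi> "lattice_point i j \<mu> (real m * \<kappa>)"] by (simp add: dist_norm norm_minus_commute)
      also have "\<dots> \<le> (\<mu> + real m * \<kappa>) + 1/40"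
        using \<xi> \<mu>1 \<kappa>pos by (intro add_mono norm_lattice_point_le) auto
      also have "real m * \<kappa> \<le> real M * \<kappa>" using m \<kappa>pos by simp
      also have "\<dots> \<le> 8 * \<mu>" unfolding \<kappa>M using pi_less_4 \<mu>1 by simp
      finally have "norm \<xi> \<le> 10 * \<mu>" using \<mu>1 by simp
      hence "(norm \<xi>)\<^sup>2 \<le> (10 * \<mu>)\<^sup>2" by (intro power_mono) auto
      moreover have "1 \<le> \<mu>\<^sup>2" using \<mu>1 by simp
      ultimately have "1 + (norm \<xi>)\<^sup>2 \<le> 121 * \<mu>\<^sup>2" by (simp add: power_mult_distrib)
      hence "(1 + (norm \<xi>)\<^sup>2) powr s \<le> (121 * (real M / b)) powr s"
        unfolding \<mu>2 using s by (intro powr_mono2) auto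
      also have "\<dots> = 121 powr s * (real M / b) powr s" by (rule powr_mult)
      also have "\<dots> \<le> 11 * (real M / b) powr s"
      proof (intro mult_right_mono)
        have "(121::real) powr s \<le> 121 powr (1/2)" using s by (intro powr_mono) auto
        also have "\<dots> = 11" by (simp add: powr_half_sqrt real_sqrt_unique)
        finally show "(121::real) powr s \<le> 11" .
      qed simp
      finally show ?thesis .
    qed
    have "(\<integral>\<^sup>+\<xi>. ennreal ((1 + (norm \<xi>)\<^sup>2) powr s * (cmod (G \<xi>))\<^sup>2) \<partial>lborel)
      \<le> ennreal (11 * (real M / b) powr s / real M * V)"
      unfolding G_def V_def by (rule lattice_bump_weighted_norm[OF ij \<kappa>4 M _ W]) auto
    also have "11 * (real M / b) powr s / real M * V \<le> 11 * V * K powr (s - 1)"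
    proof -
      have "(real M / b) powr s / real M = real M powr (s - 1) * b powr (- s)"
      proof -
        have "(real M / b) powr s = real M powr s * b powr (- s)"
          by (simp add: powr_divide powr_minus_divide)
        moreover have "real M powr s / real M = real M powr (s - 1)"
          using M1 by (simp add: powr_diff)
        ultimately show ?thesis by (metis times_divide_eq_left)
      qed
      also have "\<dots> \<le> (K * b powr (- r)) powr (s - 1) * b powr (- s)"
        using s Mlo KB by (intro mult_right_mono powr_mono2') auto
      also have "\<dots> = K powr (s - 1) * (b powr (r * (1 - s)) * b powr (- s))"
        by (simp add: powr_mult powr_powr algebra_simps)
      also have "\<dots> = K powr (s - 1)" unfolding rs using b by (simp flip: powr_add)
      finally have "11 * V * ((real M / b) powr s / real M) \<le> 11 * V * K powr (s - 1)" using V by (intro mult_left_mono) auto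
      thus ?thesis by (simp add: mult_ac)
    qed
    also have "\<dots> \<le> \<delta>" by (rule K)
    finally show ?thesis by (simp add: ennreal_leI)
  qed
  have lower: "\<exists>k\<in>{n..n1}. V / 2 \<le> cmod (evolve P (t k) G x)" if x: "norm x \<le> 1" for x
  proof -
    define y where "y = (x $ i + x $ j) / 2"
    \<comment> \<open>The spike with number \<open>l\<close> passes over \<open>x\<close> at the time \<open>\<sigma>\<close> in \<open>(0, b]\<close>; one of the given times is close to it.\<close>
    define l where "l = \<lfloor>y / (\<mu> * b)\<rfloor> + 1"
    define \<sigma> where "\<sigma> = (of_int l * (\<mu> * b) - y) / \<mu>"
    have "y / (\<mu> * b) < of_int l" "of_int l \<le> y / (\<mu> * b) + 1" unfolding l_def by linarith+
    hence "y < of_int l * (\<mu> * b)" "of_int l * (\<mu> * b) \<le> y + \<mu> * b"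
    proof -
      have "y < L * c \<and> L * c \<le> y + c" if "y / c < L" "L \<le> y / c + 1" "c > 0" for L c :: real
        using that by (simp add: field_simps)
      from this[of "\<mu> * b" "of_int l"] \<open>y / (\<mu> * b) < of_int l\<close> \<open>of_int l \<le> y / (\<mu> * b) + 1\<close> \<mu>b0
      show "y < of_int l * (\<mu> * b)" "of_int l * (\<mu> * b) \<le> y + \<mu> * b" by auto
    qed
    hence \<sigma>: "0 < \<sigma>" "\<sigma> \<le> t n" unfolding \<sigma>_def b_def[symmetric] using \<mu>1 by (auto simp: field_simps)
    obtain k where k: "k \<in> {n..n1}" "\<bar>t k - \<sigma>\<bar> \<le> d"
      by (rule hitting_time[OF pos(1) dec gap n1 \<sigma>])
    have tk: "0 \<le> t k" "t k \<le> b" using pos[of k] decseqD[OF dec, of n k] k by (auto simp: b_def)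
    have "V / 2 \<le> cmod (evolve P (t k) G x)"
      unfolding V_def G_def
    proof (rule lattice_bump_lower_bound[OF ij M P])
      fix m :: nat and \<theta> :: "real ^ 'n"
      assume m: "m < M" and \<theta>: "norm \<theta> \<le> 1/40"
      have comp: "\<bar>\<theta> $ i\<bar> \<le> 1/40" "\<bar>\<theta> $ j\<bar> \<le> 1/40"
        using component_le_norm_cart[of \<theta> i] component_le_norm_cart[of \<theta> j] \<theta> by linarith+
      have comp2: "\<bar>\<theta> $ i + \<theta> $ j\<bar> \<le> 2/40" "\<bar>\<theta> $ i - \<theta> $ j\<bar> \<le> 2/40" using comp by linarith+
      \<comment> \<open>The radius \<open>1/40\<close> is small enough for the five parts of the phase to add up to at most 1.\<close>
      have e1: "\<bar>x \<bullet> \<theta>\<bar> \<le> 1 * (1/40)"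
        using Cauchy_Schwarz_ineq2[of x \<theta>] mult_mono[OF x \<theta>] by simp
      have e2: "real m * \<kappa> * (y + t k * \<mu>) - 2 * pi * of_int (int m * l) = real m * \<kappa> * (\<mu> * (t k - \<sigma>))"
      proof -
        have y_eq: "y = of_int l * (\<mu> * b) - \<mu> * \<sigma>" using \<mu>1 by (simp add: \<sigma>_def)
        have "real m * \<kappa> * (y + t k * \<mu>) = real m * of_int l * (\<kappa> * (\<mu> * b)) + real m * \<kappa> * (\<mu> * (t k - \<sigma>))"
          by (subst y_eq) (simp add: algebra_simps)
        thus ?thesis unfolding \<kappa>\<mu>b by simp
      qed
      have e2': "\<bar>real m * \<kappa> * (\<mu> * (t k - \<sigma>))\<bar> \<le> 1/2"
      proof -
        have "\<bar>real m * \<kappa> * (\<mu> * (t k - \<sigma>))\<bar> = real m * (\<kappa> * \<mu>) * \<bar>t k - \<sigma>\<bar>"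
          using \<kappa>pos \<mu>1 by (simp add: abs_mult)
        also have "\<dots> \<le> real M * (\<kappa> * \<mu>) * d"
          using m k \<kappa>pos \<mu>1 d by (intro mult_mono) auto
        also have "\<dots> = (\<kappa> * \<mu>) * (real M * d)" by (simp add: mult_ac)
        also have "\<dots> \<le> (\<kappa> * \<mu>) * (b / 16)" using Md \<kappa>pos \<mu>1 by (intro mult_left_mono) auto
        also have "\<dots> = 2 * pi / 16" using \<kappa>\<mu>b by (simp add: mult_ac)
        finally show ?thesis using pi_less_4 by simp
      qed
      have e3: "\<bar>t k * (\<mu> * (\<theta> $ i + \<theta> $ j))\<bar> \<le> 2/40"
      proof -
        have "\<bar>t k * (\<mu> * (\<theta> $ i + \<theta> $ j))\<bar> = (t k * \<mu>) * \<bar>\<theta> $ i + \<theta> $ j\<bar>" using tk \<mu>1 by (simp add: abs_mult)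
        also have "\<dots> \<le> (b * \<mu>) * (2/40)" using tk \<mu>1 by (intro mult_mono comp2) auto
        also have "\<dots> \<le> 1 * (2/40)" using \<mu>b by (intro mult_right_mono) (auto simp: mult.commute)
        finally show ?thesis by simp
      qed
      have e4: "\<bar>t k * (real m * \<kappa> * (\<theta> $ i - \<theta> $ j))\<bar> \<le> 16/40"
      proof -
        have "\<bar>t k * (real m * \<kappa> * (\<theta> $ i - \<theta> $ j))\<bar> = t k * (real m * \<kappa>) * \<bar>\<theta> $ i - \<theta> $ j\<bar>" using tk \<kappa>pos by (simp add: abs_mult)
        also have "\<dots> \<le> b * (real M * \<kappa>) * (2/40)" using tk \<kappa>pos m b by (intro mult_mono comp2) auto
        also have "\<dots> = (\<mu> * b) * (2 * pi * (2/40))" unfolding \<kappa>M by simp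
        also have "\<dots> \<le> 1 * (2 * 4 * (2/40))" using \<mu>b \<mu>b0 pi_less_4 by (intro mult_mono) auto
        finally show ?thesis by simp
      qed
      have e5: "\<bar>t k * P \<theta>\<bar> \<le> 1/40"
      proof -
        have "\<bar>t k * P \<theta>\<bar> = t k * \<bar>P \<theta>\<bar>" using tk by (simp add: abs_mult)
        also have "\<dots> \<le> 1 * (norm \<theta>)\<^sup>2"
          unfolding P using tk b by (intro mult_mono nonelliptic_symbol_le[OF ij eps]) auto
        also have "\<dots> \<le> (1/40)\<^sup>2" using \<theta> power_mono[OF \<theta>, of 2] by simp
        finally show ?thesis by (simp add: power2_eq_square)
      qed
      have "x \<bullet> \<theta> + real m * \<kappa> * ((x $ i + x $ j) / 2 + t k * \<mu>) - 2 * pi * of_int (int m * l)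
        + t k * (\<mu> * (\<theta> $ i + \<theta> $ j) + real m * \<kappa> * (\<theta> $ i - \<theta> $ j) + P \<theta>)
        = x \<bullet> \<theta> + real m * \<kappa> * (\<mu> * (t k - \<sigma>)) + t k * (\<mu> * (\<theta> $ i + \<theta> $ j))
         + t k * (real m * \<kappa> * (\<theta> $ i - \<theta> $ j)) + t k * P \<theta>"
        using e2 unfolding y_def by (simp add: distrib_left)
      hence "\<bar>x \<bullet> \<theta> + real m * \<kappa> * ((x $ i + x $ j) / 2 + t k * \<mu>) - 2 * pi * of_int (int m * l)
        + t k * (\<mu> * (\<theta> $ i + \<theta> $ j) + real m * \<kappa> * (\<theta> $ i - \<theta> $ j) + P \<theta>)\<bar> \<le> 1"
        using e1 e2' e3 e4 e5 by linarith
      thus "\<exists>k'::int. \<bar>x \<bullet> \<theta> + real m * \<kappa> * ((x $ i + x $ j) / 2 + t k * \<mu>) - 2 * pi * of_int k'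
        + t k * (\<mu> * (\<theta> $ i + \<theta> $ j) + real m * \<kappa> * (\<theta> $ i - \<theta> $ j) + P \<theta>)\<bar> \<le> 1" by blast
    qed
    thus ?thesis using k by blast
  qed
  show ?thesis
  proof (rule that[OF G _ _ norm])
    show "finite {n..n1}" "{n..n1} \<subseteq> {n0..}" using n by auto
  qed (use lower in \<open>auto simp: V_def\<close>)
qed

section \<open>The gliding hump\<close>

text \<open>
  The evolution of a band-limited function is uniformly continuous at time 0, at all points at once.
\<close>

lemma low_frequency_uniform:
  fixes P :: "real ^ 'n \<Rightarrow> real"
  assumes A: "A \<in> L2_compact" and [measurable]: "P \<in> borel_measurable borel" and P_le: "\<And>\<xi>. \<bar>P \<xi>\<bar> \<le> (norm \<xi>)\<^sup>2"
    and t: "\<And>n. t n > 0" "t \<longlonglongrightarrow> 0" and e: "e > 0"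
  obtains n0 where "\<And>n x. n \<ge> n0 \<Longrightarrow> cmod (evolve P (t n) A x - fourier_ext A x) \<le> e"
proof -
  obtain R where R: "\<And>x. norm x > R \<Longrightarrow> A x = 0" using A by (auto simp: L2_compact_def)
  note [measurable] = L2_compactD(1)[OF A]
  have int: "integrable lborel A" by (rule L2_compact_integrable[OF A])
  define I where "I = R\<^sup>2 * (\<integral>\<xi>. cmod (A \<xi>) \<partial>lborel)"
  have bound: "cmod (evolve P (t n) A x - fourier_ext A x) \<le> t n * I" for n x
  proof -
    have "evolve P (t n) A x - fourier_ext A x = fourier_ext (\<lambda>\<xi>. cis (t n * P \<xi>) * A \<xi> - A \<xi>) x"
      by (intro fourier_ext_diff[symmetric] integrable_cis_mult int) auto
    also have "cmod \<dots> \<le> (\<integral>\<xi>. cmod (cis (t n * P \<xi>) * A \<xi> - A \<xi>) \<partial>lborel)" by (rule norm_fourier_ext_le)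
    also have "\<dots> \<le> (\<integral>\<xi>. t n * R\<^sup>2 * cmod (A \<xi>) \<partial>lborel)"
    proof (rule integral_mono')
      show "integrable lborel (\<lambda>\<xi>. t n * R\<^sup>2 * cmod (A \<xi>))" using int by simp
      fix \<xi>
      show "cmod (cis (t n * P \<xi>) * A \<xi> - A \<xi>) \<le> t n * R\<^sup>2 * cmod (A \<xi>)"
      proof (cases "norm \<xi> > R")
        case False
        have "(cmod (cis (t n * P \<xi>) - cis 0))\<^sup>2 \<le> (t n * P \<xi> - 0)\<^sup>2" using cis_diff_bound[of "t n * P \<xi>" 0] by simp
        hence "cmod (cis (t n * P \<xi>) - 1) \<le> \<bar>t n * P \<xi>\<bar>" by (simp add: abs_le_square_iff[symmetric])
        also have "\<dots> = t n * \<bar>P \<xi>\<bar>" using t(1)[of n] by (simp add: abs_mult)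
        also have "\<dots> \<le> t n * R\<^sup>2"
        proof (intro mult_left_mono)
          have "(norm \<xi>)\<^sup>2 \<le> R\<^sup>2" using False by (intro power_mono) auto
          thus "\<bar>P \<xi>\<bar> \<le> R\<^sup>2" using P_le[of \<xi>] by linarith
        qed (use t(1)[of n] in auto)
        finally have "cmod (cis (t n * P \<xi>) - 1) * cmod (A \<xi>) \<le> t n * R\<^sup>2 * cmod (A \<xi>)" by (rule mult_right_mono) simp
        moreover have "cis (t n * P \<xi>) * A \<xi> - A \<xi> = (cis (t n * P \<xi>) - 1) * A \<xi>" by (simp add: left_diff_distrib)
        ultimately show ?thesis by (simp add: norm_mult)
      qed (use R in simp)
    qed (use t(1)[of n] in simp)
    also have "\<dots> = t n * I" by (simp add: I_def)
    finally show ?thesis .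
  qed
  have "(\<lambda>n. t n * I) \<longlonglongrightarrow> 0 * I" by (intro tendsto_intros t)
  hence "\<forall>\<^sub>F n in sequentially. t n * I < e" using e by (intro order_tendstoD(2)) auto
  then obtain n0 where "\<And>n. n \<ge> n0 \<Longrightarrow> t n * I < e" by (auto simp: eventually_sequentially)
  thus ?thesis using bound by (intro that[of n0]) (meson less_imp_le order_trans)
qed

text \<open>
  The Cauchy-Schwarz inequality against \<open>(1/2) ^ i\<close>.
\<close>

lemma series_tail_square:
  fixes g :: "nat \<Rightarrow> complex"
  assumes fin: "(\<Sum>i. ennreal (2 ^ i * (cmod (g i))\<^sup>2)) < \<infinity>"
  shows "ennreal ((cmod (suminf g - (\<Sum>i<k. g i)))\<^sup>2) \<le> 2 * (\<Sum>i. if k \<le> i then ennreal (2 ^ i * (cmod (g i))\<^sup>2) else 0)"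
proof -
  define S where "S = (\<Sum>i. ennreal (2 ^ i * (cmod (g i))\<^sup>2))"
  obtain s where s: "S = ennreal s" "s \<ge> 0" using fin unfolding S_def[symmetric] by (cases S) auto
  have "2 ^ i * (cmod (g i))\<^sup>2 \<le> s" for i
    using ennreal_le_suminf[of "\<lambda>i. ennreal (2 ^ i * (cmod (g i))\<^sup>2)" i] s unfolding S_def[symmetric] by simp
  hence sm: "summable g" by (rule summable_of_weighted_squares)
  have part: "ennreal ((cmod ((\<Sum>i<n. g i) - (\<Sum>i<k. g i)))\<^sup>2) \<le> 2 * (\<Sum>i. if k \<le> i then ennreal (2 ^ i * (cmod (g i))\<^sup>2) else 0)"
    if n: "n \<ge> k" for n
  proof -
    have "(\<Sum>i<n. g i) - (\<Sum>i<k. g i) = (\<Sum>i\<in>{k..<n}. g i)"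
      using n by (simp add: lessThan_atLeast0 sum_diff_nat_ivl)
    also have "(cmod \<dots>)\<^sup>2 \<le> (\<Sum>i\<in>{k..<n}. cmod (g i))\<^sup>2" by (intro power_mono norm_sum) auto
    also have "\<dots> = (\<Sum>i\<in>{k..<n}. sqrt ((1/2) ^ i) * (sqrt (2 ^ i) * cmod (g i)))\<^sup>2"
      by (simp add: power_one_over real_sqrt_divide)
    also have "\<dots> \<le> (\<Sum>i\<in>{k..<n}. (sqrt ((1/2) ^ i))\<^sup>2) * (\<Sum>i\<in>{k..<n}. (sqrt (2 ^ i) * cmod (g i))\<^sup>2)"
      by (rule Cauchy_Schwarz_ineq_sum)
    also have "\<dots> = (\<Sum>i\<in>{k..<n}. (1/2) ^ i) * (\<Sum>i\<in>{k..<n}. 2 ^ i * (cmod (g i))\<^sup>2)"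
      by (simp add: power_mult_distrib)
    also have "\<dots> \<le> 2 * (\<Sum>i\<in>{k..<n}. 2 ^ i * (cmod (g i))\<^sup>2)"
    proof (intro mult_right_mono sum_nonneg)
      have "(\<Sum>i\<in>{k..<n}. (1/2::real) ^ i) \<le> (\<Sum>i. (1/2) ^ i)"
        by (rule sum_le_suminf) (auto intro: summable_geometric)
      thus "(\<Sum>i\<in>{k..<n}. (1/2::real) ^ i) \<le> 2" by (simp add: suminf_geometric)
    qed auto
    finally have "ennreal ((cmod ((\<Sum>i<n. g i) - (\<Sum>i<k. g i)))\<^sup>2) \<le> ennreal (2 * (\<Sum>i\<in>{k..<n}. 2 ^ i * (cmod (g i))\<^sup>2))"
      by (rule ennreal_leI)
    also have "\<dots> = 2 * (\<Sum>i\<in>{k..<n}. ennreal (2 ^ i * (cmod (g i))\<^sup>2))"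
    proof -
      have "ennreal (2 * x) = 2 * ennreal x" if "x \<ge> 0" for x using that by (simp add: ennreal_mult)
      moreover have "(\<Sum>i\<in>{k..<n}. 2 ^ i * (cmod (g i))\<^sup>2) \<ge> 0" by (intro sum_nonneg) auto
      moreover have "(\<Sum>i\<in>{k..<n}. ennreal (2 ^ i * (cmod (g i))\<^sup>2)) = ennreal (\<Sum>i\<in>{k..<n}. 2 ^ i * (cmod (g i))\<^sup>2)"
        by (rule sum_ennreal) simp
      ultimately show ?thesis by simp
    qed
    also have "(\<Sum>i\<in>{k..<n}. ennreal (2 ^ i * (cmod (g i))\<^sup>2)) = (\<Sum>i\<in>{k..<n}. if k \<le> i then ennreal (2 ^ i * (cmod (g i))\<^sup>2) else 0)"
      by (intro sum.cong) auto
    also have "\<dots> \<le> (\<Sum>i. if k \<le> i then ennreal (2 ^ i * (cmod (g i))\<^sup>2) else 0)"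
      by (rule sum_le_suminf) auto
    finally show ?thesis by (simp add: mult_left_mono)
  qed
  have "(\<lambda>n. ennreal ((cmod ((\<Sum>i<n. g i) - (\<Sum>i<k. g i)))\<^sup>2)) \<longlonglongrightarrow> ennreal ((cmod (suminf g - (\<Sum>i<k. g i)))\<^sup>2)"
    by (intro tendsto_ennrealI tendsto_intros summable_LIMSEQ[OF sm])
  thus ?thesis by (rule LIMSEQ_le_const2) (use part in auto)
qed

text \<open>
  The hump \<open>g k\<close> is chosen after the humps before it and their sets of times. Its times are so late that
  the sum of the earlier humps is almost at rest, and its norm is so small, compared with the numbers of
  earlier times, that it is negligible at each of them outside a small set.
\<close>

lemma gliding_hump_sequence:
  fixes i j :: "'n :: finite" and P :: "real ^ 'n \<Rightarrow> real"
  assumes s: "0 < s" "s < 1/2" and ij: "i \<noteq> j" and eps: "\<And>k. k \<notin> {i, j} \<Longrightarrow> \<epsilon> k \<in> {-1, 1}"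
    and P: "P = nonelliptic_symbol i j \<epsilon>"
    and t01: "\<And>n. t n \<in> {0<..<1}" and dec: "decseq t" and t0: "t \<longlonglongrightarrow> 0"
    and gaps: "decseq (\<lambda>n. t n - t (Suc n))" and nw: "t \<notin> weak_ell (s / (1 - s))" and c: "c > 0"
    and c_le: "c \<le> measure lborel (cball 0 (1/40) :: (real ^ 'n) set) / 2"
  obtains g :: "nat \<Rightarrow> real ^ 'n \<Rightarrow> complex" and N :: "nat \<Rightarrow> nat set" where
    "\<And>k. g k \<in> L2_compact" "\<And>k. finite (N k)" "\<And>k. N k \<subseteq> {k..}"
    "\<And>k. (\<integral>\<^sup>+\<xi>. ennreal ((1 + (norm \<xi>)\<^sup>2) powr s * (cmod (g k \<xi>))\<^sup>2) \<partial>lborel)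
       \<le> ennreal ((1/16) ^ k / (1 + real (\<Sum>l<k. card (N l))))"
    "\<And>k x. norm x \<le> 1 \<Longrightarrow> \<exists>n\<in>N k. c \<le> cmod (evolve P (t n) (g k) x)"
    "\<And>k n x. n \<in> N k \<Longrightarrow> cmod (fourier_ext (\<lambda>\<xi>. cis (t n * P \<xi>) * (\<Sum>l<k. g l \<xi>)) x
       - fourier_ext (\<lambda>\<xi>. \<Sum>l<k. g l \<xi>) x) \<le> c / 8"
proof -
  have [measurable]: "P \<in> borel_measurable borel" unfolding P by measurable
  have P_le: "\<bar>P \<xi>\<bar> \<le> (norm \<xi>)\<^sup>2" for \<xi> unfolding P by (rule nonelliptic_symbol_le[OF ij eps])
  \<comment> \<open>What the new hump \<open>G\<close> with the times \<open>N'\<close> owes to the sum \<open>A\<close> and the number \<open>C\<close> of its predecessors.\<close>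
  define step where "step k A C G N' \<longleftrightarrow> G \<in> L2_compact \<and> finite N' \<and> N' \<subseteq> {k..} \<and>
     (\<integral>\<^sup>+\<xi>. ennreal ((1 + (norm \<xi>)\<^sup>2) powr s * (cmod (G \<xi>))\<^sup>2) \<partial>lborel) \<le> ennreal ((1/16) ^ k / (1 + real C)) \<and>
     (\<forall>x. norm x \<le> 1 \<longrightarrow> (\<exists>n\<in>N'. c \<le> cmod (evolve P (t n) G x))) \<and>
     (\<forall>n\<in>N'. \<forall>x. cmod (evolve P (t n) A x - fourier_ext A x) \<le> c / 8)"
    for k C :: nat and A G :: "real ^ 'n \<Rightarrow> complex" and N' :: "nat set"
  have step_ex: "\<exists>G N'. step k A C G N'" if A: "A \<in> L2_compact" for k C A
  proof -
    obtain n0 where n0: "\<And>n x. n \<ge> n0 \<Longrightarrow> cmod (evolve P (t n) A x - fourier_ext A x) \<le> c / 8"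
      using low_frequency_uniform[OF A _ P_le, of t "c / 8"] t01 t0 c by auto
    have \<delta>: "(1/16) ^ k / (1 + real C) > 0" by simp
    obtain G N' where GN: "G \<in> L2_compact" "finite N'" "N' \<subseteq> {max n0 k..}"
      "(\<integral>\<^sup>+\<xi>. ennreal ((1 + (norm \<xi>)\<^sup>2) powr s * (cmod (G \<xi>))\<^sup>2) \<partial>lborel) \<le> ennreal ((1/16) ^ k / (1 + real C))"
      "\<And>x. norm x \<le> 1 \<Longrightarrow> \<exists>n\<in>N'. measure lborel (cball 0 (1/40) :: (real ^ 'n) set) / 2
       \<le> cmod (evolve P (t n) G x)"
      by (rule resonant_bump_exists[OF s ij eps P t01 dec t0 gaps nw \<delta>]) blast+
    have low: "\<exists>n\<in>N'. c \<le> cmod (evolve P (t n) G x)" if "norm x \<le> 1" for x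
      using GN(5)[OF that] c_le by (meson order_trans)
    have "step k A C G N'"
      unfolding step_def using GN(1-4) n0 low by (auto simp: subset_iff)
    thus ?thesis by blast
  qed
  \<comment> \<open>A state consists of the sum of the humps so far, the last hump, its set of times, and the number
    of all times so far; only the sum and the number matter for the next choice.\<close>
  define inv where "inv k st \<longleftrightarrow> fst st \<in> L2_compact \<and> (k = 0 \<longrightarrow> st = ((\<lambda>_. 0), (\<lambda>_. 0), {}, 0))"
    for k :: nat and st :: "(real ^ 'n \<Rightarrow> complex) \<times> (real ^ 'n \<Rightarrow> complex) \<times> nat set \<times> nat"
  define rel where "rel k st st' \<longleftrightarrow> (case st of (A, G, N', C) \<Rightarrow> case st' of (A', G', N'', C') \<Rightarrow>
     step k A C G' N'' \<and> A' = (\<lambda>\<xi>. A \<xi> + G' \<xi>) \<and> C' = C + card N'')"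
    for k :: nat and st st' :: "(real ^ 'n \<Rightarrow> complex) \<times> (real ^ 'n \<Rightarrow> complex) \<times> nat set \<times> nat"
  have "\<exists>f. \<forall>k. inv k (f k) \<and> rel k (f k) (f (Suc k))"
  proof (rule dependent_nat_choice)
    have "(\<lambda>_. 0) \<in> (L2_compact :: (real ^ 'n \<Rightarrow> complex) set)" by (rule L2_compactI[of _ 0]) auto
    thus "\<exists>st. inv 0 st" by (auto simp: inv_def)
  next
    fix st k assume "inv k st"
    moreover obtain A G N' C where st: "st = (A, G, N', C)" by (cases st)
    ultimately have A: "A \<in> L2_compact" by (simp add: inv_def)
    obtain G' N'' where st': "step k A C G' N''" using step_ex[OF A] by blast
    hence "inv (Suc k) (\<lambda>\<xi>. A \<xi> + G' \<xi>, G', N'', C + card N'')"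
      using L2_compact_add[OF A, of G'] by (auto simp: inv_def step_def)
    moreover have "rel k st (\<lambda>\<xi>. A \<xi> + G' \<xi>, G', N'', C + card N'')"
      using st' by (simp add: rel_def st)
    ultimately show "\<exists>y. inv (Suc k) y \<and> rel k st y" by blast
  qed
  then obtain f where f: "\<And>k. inv k (f k)" "\<And>k. rel k (f k) (f (Suc k))" by blast
  define A where "A k = fst (f k)" for k
  define C where "C k = snd (snd (snd (f k)))" for k
  define g where "g k = fst (snd (f (Suc k)))" for k
  define N where "N k = fst (snd (snd (f (Suc k))))" for k
  have st: "step k (A k) (C k) (g k) (N k)" "A (Suc k) = (\<lambda>\<xi>. A k \<xi> + g k \<xi>)" "C (Suc k) = C k + card (N k)" for k
    using f(2)[of k] by (auto simp: rel_def A_def C_def g_def N_def split: prod.splits)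
  have init: "A 0 = (\<lambda>_. 0)" "C 0 = 0" using f(1)[of 0] by (auto simp: inv_def A_def C_def)
  have A_eq: "A k = (\<lambda>\<xi>. \<Sum>l<k. g l \<xi>)" for k
    by (induction k) (auto simp: init st(2))
  have C_eq: "C k = (\<Sum>l<k. card (N l))" for k
    by (induction k) (auto simp: init st(3))
  show ?thesis
    using st(1) unfolding step_def A_eq C_eq by (intro that[of g N]) blast+
qed

text \<open>
  At a time from \<open>N k\<close> at which the hump \<open>g k\<close> is large, four small terms remain to be excluded: the
  deviation of the whole function, assumed to tend to 0; the motion of the earlier humps; the hump
  \<open>g k\<close> at time 0; and the later humps. The last two are collected in \<open>Y k\<close>, whose integrals have a finite sum.
\<close>

theorem weak_ell_of_convergence:
  fixes i j :: "'n :: finite" and P :: "real ^ 'n \<Rightarrow> real"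
  assumes s: "0 < s" "s < 1/2" and ij: "i \<noteq> j" and eps: "\<And>k. k \<notin> {i, j} \<Longrightarrow> \<epsilon> k \<in> {-1, 1}"
    and P: "P = nonelliptic_symbol i j \<epsilon>"
    and t01: "\<And>n. t n \<in> {0<..<1}" and dec: "decseq t" and t0: "t \<longlonglongrightarrow> 0"
    and gaps: "decseq (\<lambda>n. t n - t (Suc n))"
    and conv: "\<And>f. f \<in> sobolev_space s \<Longrightarrow> AE x in lebesgue. (\<lambda>n. propagator P (t n) f x) \<longlonglongrightarrow> f x"
  shows "t \<in> weak_ell (s / (1 - s))"
proof (rule ccontr)
  assume nw: "t \<notin> weak_ell (s / (1 - s))"
  have Pm[measurable]: "P \<in> borel_measurable borel" unfolding P by measurable
  let ?C = "ennreal ((2*pi) ^ CARD('n))"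
  define c where "c = measure lborel (cball 0 (1/40) :: (real ^ 'n) set) / 2"
  have ball_pos: "measure lborel (cball 0 r :: (real ^ 'n) set) > 0" if "r > 0" for r
    using content_cball_pos[of r "0 :: real ^ 'n"] that by simp
  have c: "c > 0" using ball_pos[of "1/40"] by (simp add: c_def)
  define w where "w \<xi> = (1 + (norm \<xi>)\<^sup>2) powr s" for \<xi> :: "real ^ 'n"
  have [measurable]: "w \<in> borel_measurable borel" unfolding w_def by measurable
  have w1: "w \<xi> \<ge> 1" for \<xi> unfolding w_def using s by (intro ge_one_powr_ge_zero) auto
  have w0: "w \<xi> \<ge> 0" for \<xi> using w1[of \<xi>] by linarith
  obtain g N where gL: "\<And>k. g k \<in> L2_compact" and fin: "\<And>k. finite (N k)" and Nk: "\<And>k. N k \<subseteq> {k..}"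
    and gw: "\<And>k. (\<integral>\<^sup>+\<xi>. ennreal (w \<xi> * (cmod (g k \<xi>))\<^sup>2) \<partial>lborel) \<le> ennreal ((1/16) ^ k / (1 + real (\<Sum>l<k. card (N l))))"
    and glow: "\<And>k x. norm x \<le> 1 \<Longrightarrow> \<exists>n\<in>N k. c \<le> cmod (evolve P (t n) (g k) x)"
    and gpast: "\<And>k n x. n \<in> N k \<Longrightarrow> cmod (fourier_ext (\<lambda>\<xi>. cis (t n * P \<xi>) * (\<Sum>l<k. g l \<xi>)) x
       - fourier_ext (\<lambda>\<xi>. \<Sum>l<k. g l \<xi>) x) \<le> c / 8"
    unfolding w_def by (rule gliding_hump_sequence[OF s ij eps P t01 dec t0 gaps nw c]) (auto simp: c_def)
  define D where "D k = (\<Sum>l<k. card (N l))" for k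
  have Dmono: "D k \<le> D l" if "k \<le> l" for k l unfolding D_def using that by (intro sum_mono2) auto
  have DN: "card (N k) \<le> D (Suc k)" for k by (simp add: D_def)
  note [measurable] = L2_compactD(1)[OF gL]
  have term_w: "(\<integral>\<^sup>+\<xi>. ennreal (w \<xi>) * ennreal (2 ^ k * (cmod (g k \<xi>))\<^sup>2) \<partial>lborel) \<le> ennreal ((1/8) ^ k / (1 + real (D k)))" for k
  proof -
    have "(\<integral>\<^sup>+\<xi>. ennreal (w \<xi>) * ennreal (2 ^ k * (cmod (g k \<xi>))\<^sup>2) \<partial>lborel)
        = (\<integral>\<^sup>+\<xi>. ennreal (2 ^ k) * ennreal (w \<xi> * (cmod (g k \<xi>))\<^sup>2) \<partial>lborel)"
      using w0 by (intro nn_integral_cong) (simp add: ennreal_mult[symmetric] mult_ac)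
    also have "\<dots> = ennreal (2 ^ k) * (\<integral>\<^sup>+\<xi>. ennreal (w \<xi> * (cmod (g k \<xi>))\<^sup>2) \<partial>lborel)"
      by (rule nn_integral_cmult) measurable
    also have "\<dots> \<le> ennreal (2 ^ k) * ennreal ((1/16) ^ k / (1 + real (D k)))"
      using gw[of k] unfolding D_def by (intro mult_left_mono) auto
    also have "\<dots> = ennreal (2 ^ k * ((1/16) ^ k / (1 + real (D k))))" by (rule ennreal_mult[symmetric]) auto
    also have "2 ^ k * ((1/16::real) ^ k / (1 + real (D k))) = (1/8) ^ k / (1 + real (D k))"
    proof -
      have "2 ^ k * (1/16::real) ^ k = (1/8) ^ k" by (simp flip: power_mult_distrib)
      thus ?thesis by simp
    qed
    finally show ?thesis .
  qed
  have term_1: "(\<integral>\<^sup>+\<xi>. ennreal (2 ^ k * (cmod (g k \<xi>))\<^sup>2) \<partial>lborel) \<le> ennreal ((1/8) ^ k / (1 + real (D k)))" for k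
  proof -
    have "(\<integral>\<^sup>+\<xi>. ennreal (2 ^ k * (cmod (g k \<xi>))\<^sup>2) \<partial>lborel) \<le> (\<integral>\<^sup>+\<xi>. ennreal (w \<xi>) * ennreal (2 ^ k * (cmod (g k \<xi>))\<^sup>2) \<partial>lborel)"
    proof (intro nn_integral_mono)
      fix \<xi>
      have "1 * ennreal (2 ^ k * (cmod (g k \<xi>))\<^sup>2) \<le> ennreal (w \<xi>) * ennreal (2 ^ k * (cmod (g k \<xi>))\<^sup>2)"
        using w1[of \<xi>] by (intro mult_right_mono) auto
      thus "ennreal (2 ^ k * (cmod (g k \<xi>))\<^sup>2) \<le> ennreal (w \<xi>) * ennreal (2 ^ k * (cmod (g k \<xi>))\<^sup>2)" by simp
    qed
    with term_w[of k] show ?thesis by (rule order_trans[rotated])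
  qed
  have geo: "(\<Sum>k. ennreal ((1/2) ^ k)) = 2"
    by (subst ennreal_geometric) (auto simp: ennreal_numeral[symmetric] simp del: ennreal_numeral)
  have AEfin: "AE \<xi> in lborel. (\<Sum>k. ennreal (2 ^ k * (cmod (g k \<xi>))\<^sup>2)) < \<infinity>"
  proof (rule nn_integral_suminf_finite_AE)
    have "(\<Sum>k. \<integral>\<^sup>+\<xi>. ennreal (2 ^ k * (cmod (g k \<xi>))\<^sup>2) \<partial>lborel) \<le> (\<Sum>k. ennreal ((1/2) ^ k))"
    proof (rule suminf_le)
      fix k
      have "(1/8) ^ k / (1 + real (D k)) \<le> (1/8::real) ^ k / 1" by (intro divide_left_mono) auto
      also have "\<dots> \<le> (1/2) ^ k" by (simp add: power_mono)
      finally show "(\<integral>\<^sup>+\<xi>. ennreal (2 ^ k * (cmod (g k \<xi>))\<^sup>2) \<partial>lborel) \<le> ennreal ((1/2) ^ k)"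
        using term_1[of k] by (meson ennreal_leI order_trans)
    qed auto
    thus "(\<Sum>k. \<integral>\<^sup>+\<xi>. ennreal (2 ^ k * (cmod (g k \<xi>))\<^sup>2) \<partial>lborel) < \<infinity>" unfolding geo by (rule order_le_less_trans) simp
  qed measurable
  define F where "F \<xi> = (\<Sum>k. g k \<xi>)" for \<xi>
  have [measurable]: "F \<in> borel_measurable borel" unfolding F_def by measurable
  define A where "A k \<xi> = (\<Sum>l<k. g l \<xi>)" for k \<xi>
  have [measurable]: "A k \<in> borel_measurable borel" for k unfolding A_def by measurable
  have tail_pt: "AE \<xi> in lborel. ennreal ((cmod (F \<xi> - A k \<xi>))\<^sup>2) \<le> 2 * (\<Sum>i. if k \<le> i then ennreal (2 ^ i * (cmod (g i \<xi>))\<^sup>2) else 0)" for k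
    using AEfin unfolding F_def A_def by eventually_elim (rule series_tail_square)
  have sobF: "(\<integral>\<^sup>+\<xi>. ennreal (w \<xi> * (cmod (F \<xi>))\<^sup>2) \<partial>lborel) < \<infinity>"
  proof -
    have "(\<integral>\<^sup>+\<xi>. ennreal (w \<xi> * (cmod (F \<xi>))\<^sup>2) \<partial>lborel)
       \<le> (\<integral>\<^sup>+\<xi>. 2 * (\<Sum>k. ennreal (w \<xi>) * ennreal (2 ^ k * (cmod (g k \<xi>))\<^sup>2)) \<partial>lborel)"
    proof (rule nn_integral_mono_AE, use tail_pt[of 0] in eventually_elim)
      case (elim \<xi>)
      have "ennreal (w \<xi> * (cmod (F \<xi>))\<^sup>2) = ennreal (w \<xi>) * ennreal ((cmod (F \<xi> - A 0 \<xi>))\<^sup>2)"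
        using w0 by (simp add: A_def ennreal_mult)
      also have "\<dots> \<le> ennreal (w \<xi>) * (2 * (\<Sum>i. ennreal (2 ^ i * (cmod (g i \<xi>))\<^sup>2)))"
        using elim by (intro mult_left_mono) auto
      also have "\<dots> = 2 * (\<Sum>k. ennreal (w \<xi>) * ennreal (2 ^ k * (cmod (g k \<xi>))\<^sup>2))"
        by (simp add: ennreal_suminf_cmult mult_ac del: ennreal_mult'')
      finally show ?case .
    qed
    also have "\<dots> = 2 * (\<Sum>k. \<integral>\<^sup>+\<xi>. ennreal (w \<xi>) * ennreal (2 ^ k * (cmod (g k \<xi>))\<^sup>2) \<partial>lborel)"
      by (subst nn_integral_cmult, measurable, subst nn_integral_suminf, measurable)
    also have "\<dots> \<le> 2 * (\<Sum>k. ennreal ((1/2) ^ k))"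
    proof (intro mult_left_mono suminf_le)
      fix k
      have "(1/8) ^ k / (1 + real (D k)) \<le> (1/8::real) ^ k / 1" by (intro divide_left_mono) auto
      also have "\<dots> \<le> (1/2) ^ k" by (simp add: power_mono)
      finally show "(\<integral>\<^sup>+\<xi>. ennreal (w \<xi>) * ennreal (2 ^ k * (cmod (g k \<xi>))\<^sup>2) \<partial>lborel) \<le> ennreal ((1/2) ^ k)"
        using term_w[of k] by (meson ennreal_leI order_trans)
    qed auto
    also have "\<dots> < \<infinity>" unfolding geo by (simp add: ennreal_mult_less_top)
    finally show ?thesis .
  qed
  have FL: "F \<in> L2_borel"
  proof -
    have "sqn F \<le> (\<integral>\<^sup>+\<xi>. ennreal (w \<xi> * (cmod (F \<xi>))\<^sup>2) \<partial>lborel)"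
      unfolding sqn_lborel
    proof (intro nn_integral_mono ennreal_leI)
      fix \<xi> show "(cmod (F \<xi>))\<^sup>2 \<le> w \<xi> * (cmod (F \<xi>))\<^sup>2"
        using mult_right_mono[OF w1[of \<xi>], of "(cmod (F \<xi>))\<^sup>2"] by simp
    qed
    thus ?thesis using sobF by (auto simp: L2_borel_def)
  qed
  have AL: "A k \<in> L2_compact" for k
  proof (induction k)
    case 0 show ?case by (rule L2_compactI[of _ 0]) (auto simp: A_def)
  next
    case (Suc k)
    have "A (Suc k) = (\<lambda>\<xi>. A k \<xi> + g k \<xi>)" by (auto simp: A_def)
    thus ?case using L2_compact_add[OF Suc gL[of k]] by simp
  qed
  \<comment> \<open>The humps after \<open>g k\<close>. Their norm beats the number of times in \<open>N k\<close>, as each of them was chosen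
    with that number in view.\<close>
  define T where "T k \<xi> = F \<xi> - A (Suc k) \<xi>" for k \<xi>
  have TL: "T k \<in> L2_borel" for k
    unfolding T_def by (intro L2_borel_diff FL L2_compact_borel AL)
  note [measurable] = L2_borelD(1)[OF TL]
  have sqnT: "sqn (T k) \<le> ennreal (4 * (1/4) ^ k / (1 + real (D (Suc k))))" for k
  proof -
    have "sqn (T k) \<le> (\<integral>\<^sup>+\<xi>. 2 * (\<Sum>i. if Suc k \<le> i then ennreal (2 ^ i * (cmod (g i \<xi>))\<^sup>2) else 0) \<partial>lborel)"
      unfolding sqn_lborel T_def by (rule nn_integral_mono_AE[OF tail_pt])
    also have "\<dots> = 2 * (\<Sum>i. \<integral>\<^sup>+\<xi>. (if Suc k \<le> i then ennreal (2 ^ i * (cmod (g i \<xi>))\<^sup>2) else 0) \<partial>lborel)"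
      by (subst nn_integral_cmult, measurable, subst nn_integral_suminf, measurable)
    also have "\<dots> \<le> 2 * (\<Sum>i. ennreal ((1/4) ^ k / (1 + real (D (Suc k)))) * ennreal ((1/2) ^ i))"
    proof (intro mult_left_mono suminf_le)
      fix i
      show "(\<integral>\<^sup>+\<xi>. (if Suc k \<le> i then ennreal (2 ^ i * (cmod (g i \<xi>))\<^sup>2) else 0) \<partial>lborel)
         \<le> ennreal ((1/4) ^ k / (1 + real (D (Suc k)))) * ennreal ((1/2) ^ i)"
      proof (cases "Suc k \<le> i")
        case True
        have "(1/8) ^ i / (1 + real (D i)) \<le> (1/8::real) ^ i / (1 + real (D (Suc k)))"
          using Dmono[OF True] by (intro divide_left_mono) auto
        also have "\<dots> \<le> (1/4) ^ k * (1/2) ^ i / (1 + real (D (Suc k)))"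
        proof (intro divide_right_mono)
          have "(1/8::real) ^ i = (1/4) ^ i * (1/2) ^ i" by (simp flip: power_mult_distrib)
          also have "\<dots> \<le> (1/4) ^ k * (1/2) ^ i"
            using True by (intro mult_right_mono power_decreasing) auto
          finally show "(1/8::real) ^ i \<le> (1/4) ^ k * (1/2) ^ i" .
        qed simp
        finally have "ennreal ((1/8) ^ i / (1 + real (D i))) \<le> ennreal ((1/4) ^ k / (1 + real (D (Suc k))) * (1/2) ^ i)"
          by (intro ennreal_leI) simp
        also have "\<dots> = ennreal ((1/4) ^ k / (1 + real (D (Suc k)))) * ennreal ((1/2) ^ i)" by (rule ennreal_mult) auto
        finally show ?thesis using order_trans[OF term_1[of i]] True by simp
      qed simp
    qed auto
    also have "\<dots> = 2 * (ennreal ((1/4) ^ k / (1 + real (D (Suc k)))) * 2)"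
      by (simp only: ennreal_suminf_cmult geo)
    also have "\<dots> = ennreal (4 * (1/4) ^ k / (1 + real (D (Suc k))))"
    proof -
      have "2 * (ennreal x * 2) = ennreal (4 * x)" if "x \<ge> 0" for x
        using that by (simp add: ennreal_mult mult_ac)
      thus ?thesis by simp
    qed
    finally show ?thesis .
  qed
  obtain f where fL: "f \<in> L2_borel" and Ff: "is_ext F f" and FAE: "AE \<xi> in lebesgue. fourier_L2 f \<xi> = F \<xi>"
    by (rule fourier_L2_surj[OF FL])
  have fm: "fourier_L2 f \<in> L2_space"
    using fourier_L2_inverse[OF L2_borel_space[OF fL]] by blast
  have fsob: "f \<in> sobolev_space s"
  proof -
    have "(\<integral>\<^sup>+ \<xi>. ennreal ((1 + (norm \<xi>)\<^sup>2) powr s * (cmod (fourier_L2 f \<xi>))\<^sup>2) \<partial>lebesgue)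
      = (\<integral>\<^sup>+ \<xi>. ennreal (w \<xi> * (cmod (F \<xi>))\<^sup>2) \<partial>lebesgue)"
      unfolding w_def by (rule nn_integral_cong_AE) (use FAE in eventually_elim, simp)
    also have "\<dots> < \<infinity>" using sobF by (simp add: nn_integral_completion)
    finally show ?thesis using L2_borel_space[OF fL] by (simp add: sobolev_space_def)
  qed
  define good where "good n k h \<longleftrightarrow> h \<in> L2_borel \<and>
    sqn h \<le> ennreal (8 * (2*pi) ^ CARD('n)) * sqn (T k) \<and>
    (AE x in lebesgue. propagator P (t n) f x - f x
      = (evolve P (t n) (A (Suc k)) x - fourier_ext (A (Suc k)) x) + h x)" for n k h
  have "\<exists>h. good n k h" for n k
    by (rule propagator_split[OF Pm FL FAE fm Ff AL[of "Suc k"], of "t n"]) (auto simp: good_def T_def[abs_def])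
  then obtain h where "\<And>n k. good n k (h n k)" by metis
  hence hL: "\<And>n k. h n k \<in> L2_borel"
    and sqnh: "\<And>n k. sqn (h n k) \<le> ennreal (8 * (2*pi) ^ CARD('n)) * sqn (T k)"
    and split: "\<And>n k. AE x in lebesgue. propagator P (t n) f x - f x
      = (evolve P (t n) (A (Suc k)) x - fourier_ext (A (Suc k)) x) + h n k x"
    by (auto simp: good_def)
  note [measurable] = L2_borelD(1)[OF hL]
  define Y where "Y k x = ennreal ((cmod (fourier_ext (g k) x))\<^sup>2) + (\<Sum>n\<in>N k. ennreal ((cmod (h n k x))\<^sup>2))" for k x
  have Ym: "Y k \<in> borel_measurable lborel" for k unfolding Y_def by measurable
  define B where "B = (2*pi) ^ CARD('n) + 32 * (2*pi) ^ CARD('n)"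
  have B: "B \<ge> 0" by (simp add: B_def)
  have Yint: "(\<integral>\<^sup>+x. Y k x \<partial>lborel) \<le> ennreal B * ennreal ((1/2) ^ k)" for k
  proof -
    have "(\<integral>\<^sup>+x. Y k x \<partial>lborel) = sqn (fourier_ext (g k)) + (\<Sum>n\<in>N k. sqn (h n k))"
      unfolding Y_def sqn_lborel by (simp add: nn_integral_add nn_integral_sum del: sum_ennreal)
    also have "\<dots> \<le> ?C * sqn (g k) + (\<Sum>n\<in>N k. ennreal (8 * (2*pi) ^ CARD('n)) * sqn (T k))"
      by (intro add_mono sum_mono sqnh) (simp add: plancherel[OF gL])
    also have "sqn (g k) \<le> ennreal ((1/2) ^ k)"
    proof -
      have "sqn (g k) \<le> (\<integral>\<^sup>+\<xi>. ennreal (2 ^ k * (cmod (g k \<xi>))\<^sup>2) \<partial>lborel)"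
        unfolding sqn_lborel
      proof (intro nn_integral_mono ennreal_leI)
        fix \<xi> show "(cmod (g k \<xi>))\<^sup>2 \<le> 2 ^ k * (cmod (g k \<xi>))\<^sup>2"
          using mult_right_mono[of 1 "2 ^ k" "(cmod (g k \<xi>))\<^sup>2"] by simp
      qed
      also have "\<dots> \<le> ennreal ((1/8) ^ k / (1 + real (D k)))" by (rule term_1)
      also have "(1/8) ^ k / (1 + real (D k)) \<le> (1/8::real) ^ k / 1" by (intro divide_left_mono) auto
      also have "(1/8::real) ^ k / 1 \<le> (1/2) ^ k" by (simp add: power_mono)
      finally show ?thesis by (simp add: ennreal_leI)
    qed
    also have "(\<Sum>n\<in>N k. ennreal (8 * (2*pi) ^ CARD('n)) * sqn (T k))
       = ennreal (real (card (N k))) * (ennreal (8 * (2*pi) ^ CARD('n)) * sqn (T k))"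
      by (simp add: ennreal_of_nat_eq_real_of_nat)
    also have "\<dots> \<le> ennreal (real (card (N k))) * (ennreal (8 * (2*pi) ^ CARD('n)) * ennreal (4 * (1/4) ^ k / (1 + real (D (Suc k)))))"
      by (intro mult_left_mono sqnT) auto
    also have "\<dots> = ennreal (real (card (N k)) * (8 * (2*pi) ^ CARD('n) * (4 * (1/4) ^ k / (1 + real (D (Suc k))))))"
      by (subst ennreal_mult[symmetric], simp, simp, subst ennreal_mult[symmetric]) auto
    also have "real (card (N k)) * (8 * (2*pi) ^ CARD('n) * (4 * (1/4) ^ k / (1 + real (D (Suc k)))))
       \<le> 32 * (2*pi) ^ CARD('n) * (1/2) ^ k"
    proof -
      have "real (card (N k)) / (1 + real (D (Suc k))) \<le> 1" using DN[of k] by (simp add: divide_le_eq_1)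
      hence "32 * (2*pi) ^ CARD('n) * (1/4) ^ k * (real (card (N k)) / (1 + real (D (Suc k)))) \<le> 32 * (2*pi) ^ CARD('n) * (1/4) ^ k * 1"
        by (intro mult_left_mono) auto
      also have "\<dots> \<le> 32 * (2*pi) ^ CARD('n) * (1/2) ^ k" by (simp add: power_mono)
      finally show ?thesis by (simp add: mult_ac)
    qed
    also have "?C * ennreal ((1/2) ^ k) + ennreal (32 * (2*pi) ^ CARD('n) * (1/2) ^ k) = ennreal B * ennreal ((1/2) ^ k)"
    proof -
      have "?C * ennreal ((1/2) ^ k) + ennreal (32 * (2*pi) ^ CARD('n) * (1/2) ^ k)
         = ennreal ((2*pi) ^ CARD('n) * (1/2) ^ k + 32 * (2*pi) ^ CARD('n) * (1/2) ^ k)"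
        by (subst ennreal_mult[symmetric], simp, simp, rule ennreal_plus[symmetric]) auto
      also have "\<dots> = ennreal (B * (1/2) ^ k)" by (simp add: B_def distrib_right)
      also have "\<dots> = ennreal B * ennreal ((1/2) ^ k)" using B by (rule ennreal_mult) simp
      finally show ?thesis .
    qed
    finally show ?thesis by (simp add: add_mono mult_left_mono ennreal_leI)
  qed
  have Y0: "AE x in lebesgue. (\<lambda>k. Y k x) \<longlonglongrightarrow> 0"
  proof (rule AE_completion[OF AE_tendsto_0_of_summable_integrals[OF Ym]])
    have "(\<Sum>k. \<integral>\<^sup>+x. Y k x \<partial>lborel) \<le> (\<Sum>k. ennreal B * ennreal ((1/2) ^ k))"
      by (intro suminf_le Yint) auto
    also have "\<dots> = ennreal B * 2" by (simp only: ennreal_suminf_cmult geo)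
    also have "\<dots> < \<infinity>" by (simp add: ennreal_mult_less_top)
    finally show "(\<Sum>k. \<integral>\<^sup>+x. Y k x \<partial>lborel) < \<infinity>" .
  qed
  have split_all: "AE x in lebesgue. \<forall>n k. propagator P (t n) f x - f x
      = (evolve P (t n) (A (Suc k)) x - fourier_ext (A (Suc k)) x) + h n k x"
    using split by (simp add: AE_all_countable)
  have "AE x in (lebesgue :: (real ^ 'n) measure). norm x > 1"
    using Y0 split_all conv[OF fsob]
  proof eventually_elim
    case (elim x)
    show "norm x > 1"
    proof (rule ccontr)
      assume "\<not> norm x > 1"
      hence x: "norm x \<le> 1" by simp
      have "\<forall>\<^sub>F k in sequentially. Y k x < ennreal ((c/8)\<^sup>2)" using elim(1) c by (intro order_tendstoD(2)) auto
      then obtain k1 where k1: "\<And>k. k \<ge> k1 \<Longrightarrow> Y k x < ennreal ((c/8)\<^sup>2)" by (auto simp: eventually_sequentially)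
      have "c / 8 > 0" using c by simp
      then obtain k2 where k2: "\<And>n. n \<ge> k2 \<Longrightarrow> norm (propagator P (t n) f x - f x) < c / 8"
        using LIMSEQ_D[OF elim(3)] by blast
      define k where "k = max k1 k2"
      have Yk: "Y k x < ennreal ((c/8)\<^sup>2)" by (rule k1) (simp add: k_def)
      obtain n where n: "n \<in> N k" "c \<le> cmod (evolve P (t n) (g k) x)" using glow[OF x] by blast
      have "n \<ge> k2" using n Nk[of k] by (auto simp: k_def)
      hence u: "cmod (propagator P (t n) f x - f x) < c / 8" by (rule k2)
      have small: "cmod z < c / 8" if "ennreal ((cmod z)\<^sup>2) \<le> Y k x" for z
      proof -
        have "ennreal ((cmod z)\<^sup>2) < ennreal ((c/8)\<^sup>2)" using that Yk by (rule order_le_less_trans)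
        hence "(cmod z)\<^sup>2 < (c/8)\<^sup>2" by (simp add: ennreal_less_iff)
        thus ?thesis by (rule power2_less_imp_less) (use c in simp)
      qed
      have sm1: "cmod (fourier_ext (g k) x) < c / 8" by (rule small) (simp add: Y_def)
      have sm2: "cmod (h n k x) < c / 8"
      proof (rule small)
        have "ennreal ((cmod (h n k x))\<^sup>2) = (\<Sum>n\<in>{n}. ennreal ((cmod (h n k x))\<^sup>2))" by simp
        also have "\<dots> \<le> (\<Sum>n\<in>N k. ennreal ((cmod (h n k x))\<^sup>2))" using n fin by (intro sum_mono2) auto
        also have "\<dots> \<le> Y k x" by (simp add: Y_def)
        finally show "ennreal ((cmod (h n k x))\<^sup>2) \<le> Y k x" .
      qed
      have sm3: "cmod (evolve P (t n) (A k) x - fourier_ext (A k) x) \<le> c / 8"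
        using gpast[OF n(1), of x] by (simp add: A_def[abs_def])
      have A_Suc: "A (Suc k) = (\<lambda>\<xi>. A k \<xi> + g k \<xi>)" by (auto simp: A_def)
      have E1: "fourier_ext (A (Suc k)) x = fourier_ext (A k) x + fourier_ext (g k) x"
        unfolding A_Suc by (intro fourier_ext_add L2_compact_integrable AL gL)
      have "evolve P (t n) (A (Suc k)) x
         = fourier_ext (\<lambda>\<xi>. cis (t n * P \<xi>) * A k \<xi> + cis (t n * P \<xi>) * g k \<xi>) x"
        unfolding A_Suc by (simp add: distrib_left)
      also have "\<dots> = evolve P (t n) (A k) x + evolve P (t n) (g k) x"
        by (intro fourier_ext_add integrable_cis_mult L2_compact_integrable AL gL) measurable
      finally have E2: "evolve P (t n) (g k) x = (propagator P (t n) f x - f x)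
         - (evolve P (t n) (A k) x - fourier_ext (A k) x) + fourier_ext (g k) x - h n k x"
        using elim(2)[rule_format, of n k] E1 by simp
      have tri: "cmod (a - b + d - e) \<le> cmod a + cmod b + cmod d + cmod e" for a b d e
        by (intro order_trans[OF norm_triangle_ineq4] order_trans[OF norm_triangle_ineq] add_mono norm_triangle_ineq4 order_refl)
      have "c \<le> c / 8 + c / 8 + c / 8 + c / 8"
        using n(2) tri[of "propagator P (t n) f x - f x" "evolve P (t n) (A k) x - fourier_ext (A k) x"
           "fourier_ext (g k) x" "h n k x"] u sm1 sm2 sm3 unfolding E2 by linarith
      thus False using c by simp
    qed
  qed
  hence AE1: "AE x in (lborel :: (real ^ 'n) measure). \<not> norm x \<le> 1" by (simp add: AE_completion_iff not_le)
  have "{x \<in> space lborel. \<not> \<not> norm x \<le> 1} = (cball 0 1 :: (real ^ 'n) set)" by auto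
  with AE1 have "emeasure lborel (cball 0 1 :: (real ^ 'n) set) = 0"
    by (subst (asm) AE_iff_measurable) auto
  thus False using ball_pos[of 1] by (simp add: measure_def)
qed

theorem theorem1p3:
  fixes i j :: "'n :: finite" and \<epsilon> :: "'n \<Rightarrow> real"
    and P :: "real ^ 'n \<Rightarrow> real" and s :: real and t :: "nat \<Rightarrow> real"
  assumes "CARD('n) \<ge> 2"
    and "0 < s" and "s < 1 / 2"
    and "i \<noteq> j"
    and "\<And>k. k \<notin> {i, j} \<Longrightarrow> \<epsilon> k \<in> {-1, 1}"
    and "P = nonelliptic_symbol i j \<epsilon>"
    and "\<And>n. t n \<in> {0<..<1}"
    and "decseq t"
    and "t \<longlonglongrightarrow> 0"
    and "decseq (\<lambda>n. t n - t (Suc n))"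
  shows "(\<forall>f \<in> sobolev_space s :: (real ^ 'n \<Rightarrow> complex) set.
            AE x in lebesgue. (\<lambda>n. propagator P (t n) f x) \<longlonglongrightarrow> f x)
         \<longleftrightarrow> t \<in> weak_ell (s / (1 - s))"
proof
  assume "\<forall>f \<in> sobolev_space s :: (real ^ 'n \<Rightarrow> complex) set.
            AE x in lebesgue. (\<lambda>n. propagator P (t n) f x) \<longlonglongrightarrow> f x"
  thus "t \<in> weak_ell (s / (1 - s))"
    by (intro weak_ell_of_convergence[OF assms(2-10)]) auto
next
  assume tw: "t \<in> weak_ell (s / (1 - s))"
  show "\<forall>f \<in> sobolev_space s :: (real ^ 'n \<Rightarrow> complex) set.
            AE x in lebesgue. (\<lambda>n. propagator P (t n) f x) \<longlonglongrightarrow> f x"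
  proof
    fix f :: "real ^ 'n \<Rightarrow> complex" assume f: "f \<in> sobolev_space s"
    show "AE x in lebesgue. (\<lambda>n. propagator P (t n) f x) \<longlonglongrightarrow> f x"
    proof (rule convergence_of_weak_ell[OF _ _ assms(2,3,7,9) tw f])
      show "P \<in> borel_measurable borel" unfolding assms(6) by measurable
      show "\<bar>P \<xi>\<bar> \<le> (norm \<xi>)\<^sup>2" for \<xi> unfolding assms(6) by (rule nonelliptic_symbol_le[OF assms(4,5)])
    qed
  qed
qed

end
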